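(* Consider the two-group random mixture model with parameters $\pi_0,\pi_1\in(0,1)$, $\pi_0+\pi_1=1$, and densities $f_0,f_1$. For every $\alpha\in[0,1]$ the limit $$\mathsf{FNR}^*(\alpha)=\lim_{n\to\infty}\mathsf{FNR}^*_n(\alpha)$$ exists, and as a function of $\alpha$ it is the greatest convex minorant of the function $\mathsf{mFNR}^*$ on $[0,1]$, i.e. $$\mathsf{FNR}^*(\alpha)=\sup\{C(\alpha): C(t)\le \mathsf{mFNR}^*(t)\ \forall t\in[0,1],\ C \text{ is convex on }[0,1]\}.$$ Furthermore, for any $\alpha\in[0,1]$ there exist constants $0\le\alpha_1\le\alpha\le\alpha_2\le1$ such that the randomized decision rule $\delta^n_{\rm OR}(\alpha)$ which (using a single coin flip independent of everything else) equals $\delta^n_{\rm NP}(\alpha_1)$ with probability $\frac{\alpha_2-\alpha}{\alpha_2-\alpha_1}$ and equals $\delta^n_{\rm NP}(\alpha_2)$ with probability $\frac{\alpha-\alpha_1}{\alpha_2-\alpha_1}$ (and $\delta^n_{\rm OR}(\alpha)\equiv\delta^n_{\rm NP}(\alpha)$ if $\alpha_1=\alpha_2=\alpha$) satisfies $\mathrm{FDR}(\delta^n_{\rm OR}(\alpha))\le\alpha$ and $\lim_{n\to\infty}\mathrm{FNR}(\delta^n_{\rm OR}(\alpha))=\mathsf{FNR}^*(\alpha)$.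
   Context: Two-group random mixture model: $\pi_0,\pi_1\in(0,1)$ with $\pi_0+\pi_1=1$; $f_0,f_1$ are probability densities on a sample space $\mathcal X$ (with respect to a common dominating measure), $f=\pi_0f_0+\pi_1f_1$. The labels $\theta_1,\dots,\theta_n$ are iid $\mathrm{Bern}(\pi_1)$ and, conditionally on $\theta^n=(\theta_1,\dots,\theta_n)$, the observations $X_1,\dots,X_n$ are independent with $X_i\sim f_{\theta_i}$. A (possibly randomized) decision rule $\delta^n=(\delta_1,\dots,\delta_n)$ is given by a Markov kernel from $\mathcal X^n$ to $\{0,1\}^n$ applied to $X^n$ (so $\delta^n$ is conditionally independent of $\theta^n$ given $X^n$). Define $\mathrm{FDP}(\delta^n)=\frac{\sum_i\delta_i(1-\theta_i)}{1\vee\sum_i\delta_i}$, $\mathrm{FNP}(\delta^n)=\frac{\sum_i(1-\delta_i)\theta_i}{1\vee\sum_i(1-\delta_i)}$, $\mathrm{FDR}(\delta^n)=\mathbb E[\mathrm{FDP}(\delta^n)]$, $\mathrm{FNR}(\delta^n)=\mathbb E[\mathrm{FNP}(\delta^n)]$, and $\mathrm{mFDR}(\delta^n)=\frac{\mathbb E[\sum_i\delta_i(1-\theta_i)]}{\mathbb E[\sum_i\delta_i]}$, $\mathrm{mFNR}(\delta^n)=\frac{\mathbb E[\sum_i(1-\delta_i)\theta_i]}{\mathbb E[\sum_i(1-\delta_i)]}$ with $0/0=0$. $\mathsf{FNR}^*_n(\alpha)=\inf\{\mathrm{FNR}(\delta^n):\mathrm{FDR}(\delta^n)\le\alpha\}$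 and $\mathsf{mFNR}^*(\alpha)=\inf\{\mathrm{mFNR}(\delta^n):\mathrm{mFDR}(\delta^n)\le\alpha\}$, infima over all decision rules; the latter value does not depend on $n$. Neyman-Pearson rule $\delta^n_{\rm NP}(\alpha)$: let $W_i=\pi_0f_0(X_i)/f(X_i)$, and let $W=\pi_0f_0(X)/f(X)$ with $X\sim f$, $G(t)=\mathbb P(W\le t)$, $G^{-1}(u)=\inf\{t\in[0,1]:G(t)\ge u\}$ for $u\in[0,1]$. For $u\in[0,1]$ choose $p(u)\in[0,1]$ with $\mathbb P(W<G^{-1}(u))+p(u)\mathbb P(W=G^{-1}(u))=u$. Let $S_u=1$ if $W<G^{-1}(u)$, $S_u\sim\mathrm{Bern}(p(u))$ (independent coin) if $W=G^{-1}(u)$, $S_u=0$ if $W>G^{-1}(u)$. Set $a(u)=\mathbb E[W\mid S_u=1]$ for $u\in(0,1]$, $a(0)=0$, and $u^*(\alpha)=\sup\{u\in[0,1]:a(u)\le\alpha\}$. Then $\delta^n_{\rm NP}(\alpha)=(\delta_1,\dots,\delta_n)$ where $\delta_i=1$ if $W_i<G^{-1}(u^*(\alpha))$, $\delta_i\sim\mathrm{Bern}(p(u^*(\alpha)))$ (independent coins over $i$) if $W_i=G^{-1}(u^*(\alpha))$, and $\delta_i=0$ if $W_i>G^{-1}(u^*(\alpha))$. *)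

theory Defs
  imports "HOL-Probability.Probability"
begin

lemma measurable_PiM_prob_algebra:
  fixes K :: "'i \<Rightarrow> 'x \<Rightarrow> 'b measure"
  assumes fin: "finite I" and K: "\<And>i. i \<in> I \<Longrightarrow> K i \<in> L \<rightarrow>\<^sub>M prob_algebra (N i)"
  shows "(\<lambda>x. PiM I (\<lambda>i. K i x)) \<in> L \<rightarrow>\<^sub>M prob_algebra (PiM I N)"
proof (rule measurable_prob_algebra_generated)
  have prob: "prob_space (K i x)" and sets: "sets (K i x) = sets (N i)"
    if "i \<in> I" "x \<in> space L" for i x
    using measurable_space[OF K[OF that(1)] that(2)]
    by (auto simp: space_prob_algebra)
  show "sets (PiM I N) = sigma_sets (\<Pi>\<^sub>E i\<in>I. space (N i))
      {Pi\<^sub>E I E |E. \<forall>i\<in>I. E i \<in> sets (N i)}"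
    unfolding sets_PiM prod_algebra_eq_finite[OF fin]
    by (intro arg_cong2[where f = sigma_sets] refl) (auto simp: Pi_iff)
  show "Int_stable {Pi\<^sub>E I E |E. \<forall>i\<in>I. E i \<in> sets (N i)}"
    by (rule Int_stable_PiE)
  show "{Pi\<^sub>E I E |E. \<forall>i\<in>I. E i \<in> sets (N i)} \<subseteq> Pow (\<Pi>\<^sub>E i\<in>I. space (N i))"
    by (auto dest: sets.sets_into_space)
  show "prob_space (PiM I (\<lambda>i. K i x))" if "x \<in> space L" for x
    using prob that by (intro prob_space_PiM)
  show "sets (PiM I (\<lambda>i. K i x)) = sets (PiM I N)" if "x \<in> space L" for x
    using sets that by (intro sets_PiM_cong) auto
  fix A assume "A \<in> {Pi\<^sub>E I E |E. \<forall>i\<in>I. E i \<in> sets (N i)}"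
  then obtain E where A: "A = Pi\<^sub>E I E" and E: "\<And>i. i \<in> I \<Longrightarrow> E i \<in> sets (N i)"
    by auto
  have "emeasure (PiM I (\<lambda>i. K i x)) A = (\<Prod>i\<in>I. emeasure (K i x) (E i))" if x: "x \<in> space L" for x
  proof -
    define K' where "K' i = (if i \<in> I then K i x else return (count_space UNIV) undefined)" for i
    have "prob_space (K' i)" for i
      using prob x by (auto simp: K'_def intro: prob_space_return)
    then interpret product_sigma_finite K'
      by (auto simp: product_sigma_finite_def intro: prob_space_imp_sigma_finite)
    have "emeasure (PiM I K') (Pi\<^sub>E I E) = (\<Prod>i\<in>I. emeasure (K' i) (E i))"
      using fin E sets x by (intro emeasure_PiM) (auto simp: K'_def)
    moreover have "PiM I K' = PiM I (\<lambda>i. K i x)"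
      by (intro PiM_cong) (auto simp: K'_def)
    ultimately show ?thesis by (simp add: A K'_def)
  qed
  moreover have "(\<lambda>x. emeasure (K i x) (E i)) \<in> borel_measurable L" if "i \<in> I" for i
    using measurable_emeasure_kernel[OF measurable_prob_algebraD[OF K[OF that]] E[OF that]] .
  ultimately show "(\<lambda>x. emeasure (PiM I (\<lambda>i. K i x)) A) \<in> borel_measurable L"
    by (subst measurable_cong) auto
qed

abbreviation bools :: "nat \<Rightarrow> (nat \<Rightarrow> bool) measure" where
  "bools n \<equiv> PiM {..<n} (\<lambda>_. count_space UNIV)"

definition FDP :: "nat \<Rightarrow> (nat \<Rightarrow> bool) \<Rightarrow> (nat \<Rightarrow> bool) \<Rightarrow> real" where
  "FDP n \<theta> \<delta> = (\<Sum>i<n. of_bool (\<delta> i) * (1 - of_bool (\<theta> i))) / max 1 (\<Sum>i<n. of_bool (\<delta> i))"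

definition FNP :: "nat \<Rightarrow> (nat \<Rightarrow> bool) \<Rightarrow> (nat \<Rightarrow> bool) \<Rightarrow> real" where
  "FNP n \<theta> \<delta> = (\<Sum>i<n. (1 - of_bool (\<delta> i)) * of_bool (\<theta> i)) / max 1 (\<Sum>i<n. 1 - of_bool (\<delta> i))"

text \<open>The dominating measure \<open>M\<close> is not assumed to be \<open>\<sigma>\<close>-finite. Where \<open>f0\<close> and \<open>f1\<close> both
  vanish, \<open>W\<close> takes the conventional value \<open>0 / 0 = 0\<close>; this is a null event of the model.\<close>

locale two_group =
  fixes M :: "'a measure" and f0 f1 :: "'a \<Rightarrow> real" and \<pi>0 \<pi>1 :: real
  assumes pi0: "0 < \<pi>0" "\<pi>0 < 1" and pi1: "0 < \<pi>1" "\<pi>1 < 1" and pi_sum: "\<pi>0 + \<pi>1 = 1"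
    and f0_measurable[measurable]: "f0 \<in> borel_measurable M"
    and f1_measurable[measurable]: "f1 \<in> borel_measurable M"
    and f0_nonneg: "\<And>x. x \<in> space M \<Longrightarrow> 0 \<le> f0 x"
    and f1_nonneg: "\<And>x. x \<in> space M \<Longrightarrow> 0 \<le> f1 x"
    and f0_prob: "prob_space (density M f0)"
    and f1_prob: "prob_space (density M f1)"
begin

definition f :: "'a \<Rightarrow> real" where
  "f x = \<pi>0 * f0 x + \<pi>1 * f1 x"

definition labels :: "nat \<Rightarrow> (nat \<Rightarrow> bool) measure" where
  "labels n = PiM {..<n} (\<lambda>_. measure_pmf (bernoulli_pmf \<pi>1))"

definition observations :: "nat \<Rightarrow> (nat \<Rightarrow> bool) \<Rightarrow> (nat \<Rightarrow> 'a) measure" where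
  "observations n \<theta> = PiM {..<n} (\<lambda>i. density M (if \<theta> i then f1 else f0))"

text \<open>Randomized rules are Markov kernels from \<open>\<X>\<^sup>n\<close> to \<open>{0,1}\<^sup>n\<close>.\<close>

definition decision_rules :: "nat \<Rightarrow> ((nat \<Rightarrow> 'a) \<Rightarrow> (nat \<Rightarrow> bool) measure) set" where
  "decision_rules n = PiM {..<n} (\<lambda>_. M) \<rightarrow>\<^sub>M prob_algebra (bools n)"

definition joint :: "nat \<Rightarrow> ((nat \<Rightarrow> 'a) \<Rightarrow> (nat \<Rightarrow> bool) measure)
    \<Rightarrow> ((nat \<Rightarrow> bool) \<times> (nat \<Rightarrow> 'a) \<times> (nat \<Rightarrow> bool)) measure" where
  "joint n K = labels n \<bind> (\<lambda>\<theta>. observations n \<theta> \<bind> (\<lambda>x. K x \<bind> (\<lambda>\<delta>.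
     return (bools n \<Otimes>\<^sub>M PiM {..<n} (\<lambda>_. M) \<Otimes>\<^sub>M bools n) (\<theta>, x, \<delta>))))"

definition FDR :: "nat \<Rightarrow> ((nat \<Rightarrow> 'a) \<Rightarrow> (nat \<Rightarrow> bool) measure) \<Rightarrow> real" where
  "FDR n K = (LINT (\<theta>, x, \<delta>)|joint n K. FDP n \<theta> \<delta>)"

definition FNR :: "nat \<Rightarrow> ((nat \<Rightarrow> 'a) \<Rightarrow> (nat \<Rightarrow> bool) measure) \<Rightarrow> real" where
  "FNR n K = (LINT (\<theta>, x, \<delta>)|joint n K. FNP n \<theta> \<delta>)"

definition mFDR :: "nat \<Rightarrow> ((nat \<Rightarrow> 'a) \<Rightarrow> (nat \<Rightarrow> bool) measure) \<Rightarrow> real" where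
  "mFDR n K = (LINT (\<theta>, x, \<delta>)|joint n K. (\<Sum>i<n. of_bool (\<delta> i) * (1 - of_bool (\<theta> i))))
     / (LINT (\<theta>, x, \<delta>)|joint n K. (\<Sum>i<n. of_bool (\<delta> i)))"

definition mFNR :: "nat \<Rightarrow> ((nat \<Rightarrow> 'a) \<Rightarrow> (nat \<Rightarrow> bool) measure) \<Rightarrow> real" where
  "mFNR n K = (LINT (\<theta>, x, \<delta>)|joint n K. (\<Sum>i<n. (1 - of_bool (\<delta> i)) * of_bool (\<theta> i)))
     / (LINT (\<theta>, x, \<delta>)|joint n K. (\<Sum>i<n. 1 - of_bool (\<delta> i)))"

definition FNR_star :: "nat \<Rightarrow> real \<Rightarrow> real" where
  "FNR_star n \<alpha> = (INF K\<in>{K \<in> decision_rules n. FDR n K \<le> \<alpha>}. FNR n K)"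

text \<open>For \<open>n \<ge> 1\<close> the value of \<open>mFNR_star n \<alpha>\<close> does not depend on \<open>n\<close>; \<open>n = 0\<close> is degenerate.\<close>

definition mFNR_star :: "nat \<Rightarrow> real \<Rightarrow> real" where
  "mFNR_star n \<alpha> = (INF K\<in>{K \<in> decision_rules n. mFDR n K \<le> \<alpha>}. mFNR n K)"

definition FNR_limit :: "real \<Rightarrow> real" where
  "FNR_limit \<alpha> = lim (\<lambda>n. FNR_star n \<alpha>)"

definition W :: "'a \<Rightarrow> real" where
  "W x = \<pi>0 * f0 x / f x"

definition G :: "real \<Rightarrow> real" where
  "G t = measure (density M f) {x \<in> space M. W x \<le> t}"

definition Ginv :: "real \<Rightarrow> real" where
  "Ginv u = Inf {t \<in> {0..1}. u \<le> G t}"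

text \<open>\<open>p u\<close> is determined only where \<open>W\<close> has an atom at \<open>Ginv u\<close>, so the family \<open>p\<close> is a parameter.\<close>

definition tie_breaking :: "(real \<Rightarrow> real) \<Rightarrow> bool" where
  "tie_breaking p \<longleftrightarrow> (\<forall>u\<in>{0..1}. p u \<in> {0..1} \<and>
     measure (density M f) {x \<in> space M. W x < Ginv u}
       + p u * measure (density M f) {x \<in> space M. W x = Ginv u} = u)"

definition S :: "(real \<Rightarrow> real) \<Rightarrow> real \<Rightarrow> 'a \<Rightarrow> bool pmf" where
  "S p u x = (if W x < Ginv u then return_pmf True
     else if W x = Ginv u then bernoulli_pmf (p u) else return_pmf False)"

definition joint_XS :: "(real \<Rightarrow> real) \<Rightarrow> real \<Rightarrow> ('a \<times> bool) measure" where
  "joint_XS p u = density M f \<bind> (\<lambda>x. measure_pmf (S p u x) \<bind>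
     (\<lambda>s. return (M \<Otimes>\<^sub>M count_space UNIV) (x, s)))"

definition a :: "(real \<Rightarrow> real) \<Rightarrow> real \<Rightarrow> real" where
  "a p u = (if u = 0 then 0
     else LINT (x, s)|uniform_measure (joint_XS p u) {(x, s) \<in> space (joint_XS p u). s}. W x)"

definition u_star :: "(real \<Rightarrow> real) \<Rightarrow> real \<Rightarrow> real" where
  "u_star p \<alpha> = Sup {u \<in> {0..1}. a p u \<le> \<alpha>}"

definition NP_rule :: "nat \<Rightarrow> (real \<Rightarrow> real) \<Rightarrow> real \<Rightarrow> (nat \<Rightarrow> 'a) \<Rightarrow> (nat \<Rightarrow> bool) measure" where
  "NP_rule n p \<alpha> x = PiM {..<n} (\<lambda>i. measure_pmf (S p (u_star p \<alpha>) (x i)))"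

definition OR_rule :: "nat \<Rightarrow> (real \<Rightarrow> real) \<Rightarrow> real \<Rightarrow> real \<Rightarrow> real
    \<Rightarrow> (nat \<Rightarrow> 'a) \<Rightarrow> (nat \<Rightarrow> bool) measure" where
  "OR_rule n p \<alpha> \<alpha>1 \<alpha>2 x = (if \<alpha>1 = \<alpha>2 then NP_rule n p \<alpha> x
     else measure_pmf (bernoulli_pmf ((\<alpha> - \<alpha>1) / (\<alpha>2 - \<alpha>1))) \<bind>
       (\<lambda>b. if b then NP_rule n p \<alpha>2 x else NP_rule n p \<alpha>1 x))"

text \<open>The Giry bind is only meaningful on measurable kernels; the following facts show that this is
  the case for the laws and rules above, and that a tie-breaking family exists.\<close>

lemma f_measurable[measurable]: "f \<in> borel_measurable M"
  unfolding f_def by measurable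

lemma W_measurable[measurable]: "W \<in> borel_measurable M"
  unfolding W_def by measurable

lemma prob_space_f: "prob_space (density M f)"
proof
  have "emeasure (density M f) (space M) = (\<integral>\<^sup>+x. ennreal \<pi>0 * f0 x + ennreal \<pi>1 * f1 x \<partial>M)"
    using pi0 pi1 f0_nonneg f1_nonneg
    by (auto simp: emeasure_density f_def ennreal_plus ennreal_mult intro!: nn_integral_cong)
  also have "\<dots> = ennreal \<pi>0 * (\<integral>\<^sup>+x. f0 x \<partial>M) + ennreal \<pi>1 * (\<integral>\<^sup>+x. f1 x \<partial>M)"
    by (simp add: nn_integral_add nn_integral_cmult)
  also have "(\<integral>\<^sup>+x. f0 x \<partial>M) = 1"
    using prob_space.emeasure_space_1[OF f0_prob] by (simp add: emeasure_density cong: nn_integral_cong)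
  also have "(\<integral>\<^sup>+x. f1 x \<partial>M) = 1"
    using prob_space.emeasure_space_1[OF f1_prob] by (simp add: emeasure_density cong: nn_integral_cong)
  finally show "emeasure (density M f) (space (density M f)) = 1"
    using pi_sum pi0 pi1 by (simp flip: ennreal_plus)
qed

lemma prob_space_labels: "prob_space (labels n)"
  unfolding labels_def by (intro prob_space_PiM) (rule prob_space_measure_pmf)

lemma sets_labels[measurable_cong]: "sets (labels n) = sets (bools n)"
  unfolding labels_def by (intro sets_PiM_cong) auto

lemma observations_kernel: "observations n \<in> bools n \<rightarrow>\<^sub>M prob_algebra (PiM {..<n} (\<lambda>_. M))"
  unfolding observations_def
proof (rule measurable_PiM_prob_algebra)
  fix i assume i: "i \<in> {..<n}"
  have "(\<lambda>b. density M (if b then f1 else f0)) \<in> count_space UNIV \<rightarrow>\<^sub>M prob_algebra M"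
    using f0_prob f1_prob by (auto simp: space_prob_algebra)
  from measurable_compose[OF measurable_component_singleton[OF i] this]
  show "(\<lambda>\<theta>. density M (if \<theta> i then f1 else f0)) \<in> bools n \<rightarrow>\<^sub>M prob_algebra M"
    by simp
qed simp

lemma S_kernel: "(\<lambda>x. measure_pmf (S p u x)) \<in> M \<rightarrow>\<^sub>M prob_algebra (count_space UNIV)"
proof -
  have c: "(\<lambda>_. measure_pmf q) \<in> M \<rightarrow>\<^sub>M prob_algebra (count_space UNIV)" for q :: "bool pmf"
    by (intro measurable_const) (simp add: space_prob_algebra prob_space_measure_pmf)
  have "(\<lambda>x. if W x < Ginv u then measure_pmf (return_pmf True)
      else if W x = Ginv u then measure_pmf (bernoulli_pmf (p u)) else measure_pmf (return_pmf False))
     \<in> M \<rightarrow>\<^sub>M prob_algebra (count_space UNIV)"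
    by (intro measurable_If c) measurable
  then show ?thesis
    by (simp add: S_def if_distrib[of measure_pmf] cong: if_cong)
qed

lemma NP_rule_in_decision_rules: "NP_rule n p \<alpha> \<in> decision_rules n"
  unfolding NP_rule_def decision_rules_def
proof (rule measurable_PiM_prob_algebra)
  fix i assume "i \<in> {..<n}"
  then have "(\<lambda>x. x i) \<in> PiM {..<n} (\<lambda>_. M) \<rightarrow>\<^sub>M M"
    by (rule measurable_component_singleton)
  from measurable_compose[OF this S_kernel]
  show "(\<lambda>x. measure_pmf (S p (u_star p \<alpha>) (x i)))
      \<in> PiM {..<n} (\<lambda>_. M) \<rightarrow>\<^sub>M prob_algebra (count_space UNIV)" .
qed simp

lemma OR_rule_in_decision_rules: "OR_rule n p \<alpha> \<alpha>1 \<alpha>2 \<in> decision_rules n"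
proof (cases "\<alpha>1 = \<alpha>2")
  case True
  then show ?thesis
    using NP_rule_in_decision_rules[of n p \<alpha>] by (simp add: OR_rule_def[abs_def])
next
  case False
  have [measurable]: "NP_rule n p \<beta> \<in> PiM {..<n} (\<lambda>_. M) \<rightarrow>\<^sub>M prob_algebra (bools n)" for \<beta>
    using NP_rule_in_decision_rules by (simp add: decision_rules_def)
  show ?thesis
    unfolding decision_rules_def OR_rule_def[abs_def] if_not_P[OF False]
  proof (rule measurable_bind_prob_space2)
    show "(\<lambda>x. measure_pmf (bernoulli_pmf ((\<alpha> - \<alpha>1) / (\<alpha>2 - \<alpha>1))))
        \<in> PiM {..<n} (\<lambda>_. M) \<rightarrow>\<^sub>M prob_algebra (count_space UNIV)"
      by (intro measurable_const) (simp add: space_prob_algebra prob_space_measure_pmf)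
  qed measurable
qed

lemma joint_prob_algebra:
  assumes K: "K \<in> decision_rules n"
  shows "joint n K \<in> space (prob_algebra (bools n \<Otimes>\<^sub>M PiM {..<n} (\<lambda>_. M) \<Otimes>\<^sub>M bools n))"
proof -
  note observations_kernel[measurable]
  have [measurable]: "K \<in> PiM {..<n} (\<lambda>_. M) \<rightarrow>\<^sub>M prob_algebra (bools n)"
    using K by (simp add: decision_rules_def)
  have lab: "labels n \<in> space (prob_algebra (bools n))"
    by (simp add: space_prob_algebra prob_space_labels sets_labels)
  let ?J = "bools n \<Otimes>\<^sub>M PiM {..<n} (\<lambda>_. M) \<Otimes>\<^sub>M bools n"
  have "(\<lambda>_::unit. joint n K) \<in> count_space UNIV \<rightarrow>\<^sub>M prob_algebra ?J"
    unfolding joint_def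
    by (rule measurable_bind_prob_space2[where N = "bools n"])
       (use lab in measurable)
  from measurable_space[OF this] show ?thesis by simp
qed

lemma joint_XS_prob_algebra: "joint_XS p u \<in> space (prob_algebra (M \<Otimes>\<^sub>M count_space UNIV))"
proof -
  note S_kernel[measurable]
  have X: "density M f \<in> space (prob_algebra M)"
    by (simp add: space_prob_algebra prob_space_f)
  have "(\<lambda>_::unit. joint_XS p u) \<in> count_space UNIV \<rightarrow>\<^sub>M prob_algebra (M \<Otimes>\<^sub>M count_space UNIV)"
    unfolding joint_XS_def
    by (rule measurable_bind_prob_space2[where N = M]) (use X in measurable)
  from measurable_space[OF this] show ?thesis by simp
qed

lemma W_range:
  assumes x: "x \<in> space M"
  shows "W x \<in> {0..1}"
proof -
  have "0 \<le> \<pi>0 * f0 x" "0 \<le> \<pi>1 * f1 x"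
    using pi0 pi1 f0_nonneg[OF x] f1_nonneg[OF x] by auto
  then show ?thesis
    by (auto simp: W_def f_def divide_le_eq_1)
qed

lemma tie_breaking_exists: "\<exists>p. tie_breaking p"
proof -
  interpret F: prob_space "density M f" by (rule prob_space_f)
  let ?D = "distr (density M f) borel W"
  interpret D: real_distribution ?D
    by (rule F.real_distribution_distr) simp
  have m: "measure ?D A = measure (density M f) {x \<in> space M. W x \<in> A}" if "A \<in> sets borel" for A
    using that by (auto simp: measure_distr intro!: arg_cong[where f = "measure _"])
  have G: "cdf ?D = G"
    by (auto simp: cdf_def G_def m)
  have G1: "G 1 = 1"
    using F.prob_space W_range by (auto simp: G_def cong: conj_cong)
  have "\<exists>r\<in>{0..1}. measure (density M f) {x \<in> space M. W x < Ginv u}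
       + r * measure (density M f) {x \<in> space M. W x = Ginv u} = u" if u: "u \<in> {0..1}" for u
  proof -
    let ?T = "{t \<in> {0..1}. u \<le> G t}" and ?q = "Ginv u"
    let ?lo = "measure ?D {..<?q}" and ?at = "measure ?D {?q}"
    have ne: "1 \<in> ?T" using u G1 by auto
    have bdd: "bdd_below ?T" by (rule bdd_belowI[of _ 0]) auto
    have q1: "?q \<le> 1" unfolding Ginv_def by (rule cInf_lower[OF ne bdd])
    have up: "u \<le> G t" if t: "?q < t" for t
    proof -
      obtain s where "s \<in> ?T" "s < t"
        using cInf_lessD[of ?T t] ne t unfolding Ginv_def by blast
      moreover have "G s \<le> G t" using D.cdf_nondecreasing[of s t] \<open>s < t\<close> by (simp add: G)
      ultimately show ?thesis by simp
    qed
    have dn: "G t \<le> u" if t: "t < ?q" for t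
    proof (cases "0 \<le> t")
      case True
      show ?thesis
      proof (rule ccontr)
        assume "\<not> G t \<le> u"
        then have "t \<in> ?T" using True t q1 by auto
        then have "?q \<le> t" unfolding Ginv_def by (rule cInf_lower[OF _ bdd])
        with t show False by simp
      qed
    next
      case False
      have "{x \<in> space M. W x \<le> t} = {}" using W_range False by force
      then have "G t = 0" unfolding G_def by (simp only: measure_empty)
      then show ?thesis using u by simp
    qed
    have "(G \<longlongrightarrow> G ?q) (at_right ?q)"
      using D.cdf_is_right_cont[of ?q] by (simp add: G continuous_within)
    then have hi: "u \<le> G ?q"
      by (rule tendsto_lowerbound) (auto intro!: eventually_at_rightI[of _ "?q + 1"] up)
    have "(G \<longlongrightarrow> ?lo) (at_left ?q)"
      using D.cdf_at_left[of ?q] by (simp add: G)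
    then have lo: "?lo \<le> u"
      by (rule tendsto_upperbound) (auto intro!: eventually_at_leftI[of "?q - 1"] dn)
    have "{..?q} = {..<?q} \<union> {?q}" by auto
    then have Gq: "G ?q = ?lo + ?at"
      unfolding G[symmetric] cdf_def using D.finite_measure_Union[of "{..<?q}" "{?q}"] by simp
    have "\<exists>r\<in>{0..1}. ?lo + r * ?at = u"
    proof (cases "?at = 0")
      case True
      then show ?thesis using hi lo Gq by (intro bexI[of _ 0]) auto
    next
      case False
      then have "0 < ?at" by (simp add: order_less_le)
      then show ?thesis using hi lo Gq
        by (intro bexI[of _ "(u - ?lo) / ?at"]) auto
    qed
    then show ?thesis using m[of "{..<?q}"] m[of "{?q}"] by simp
  qed
  then have "\<forall>u. \<exists>r. u \<in> {0..1} \<longrightarrow> r \<in> {0..1} \<and>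
      measure (density M f) {x \<in> space M. W x < Ginv u}
       + r * measure (density M f) {x \<in> space M. W x = Ginv u} = u"
    by blast
  then show ?thesis
    unfolding tie_breaking_def by (drule_tac choice) blast
qed

end

end

theory Submission
  imports Defs
begin

text \<open>Given the observations the labels are independent with null probabilities \<open>W\<close>, so each error rate is
  an expectation over the observations alone, and a rule matters only through its conditional
  probabilities of the finitely many decision vectors. Write \<open>A u = u * a u\<close>; this is the Legendre
  transform of \<open>t \<mapsto> E (t - W)\<^sup>+\<close>, hence convex, and the Neyman-Pearson rule attains it. With \<open>b u\<close>
  the marginal false nondiscovery rate of that rule at rejection probability \<open>u\<close>, it yields \<open>mFNR* = v\<close>
  for the lower semicontinuous function \<open>v \<alpha> = b (u* \<alpha>)\<close>.

  For the lower bound let \<open>c - l * t\<close> be an affine minorant of \<open>v\<close>. For every sample and every decision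
  vector with rejected fraction \<open>u\<close>, the posterior false discovery proportion \<open>F\<close> and false nondiscovery
  proportion \<open>N\<close> satisfy \<open>u * F \<ge> A u - E\<close> and \<open>(1 - u) * N \<ge> \<pi>1 - u + u * F - E\<close>, where \<open>E\<close> is an empirical
  deviation that tends to 0 in mean. Hence \<open>N + l * F \<ge> c - o(1)\<close>. Conversely, mixing two Neyman-Pearson
  rules at the points where a supporting line touches \<open>v\<close> attains the convex minorant.\<close>

section \<open>Convex minorants of lower semicontinuous functions\<close>

text \<open>FDR and FNR average quotients with random denominators, while mFDR and mFNR are
  quotients of averages. Averages are affine in the rule, so a coin between two rules moves along a
  chord and the limiting curve has to be convex; \<open>v\<close> in general is not, and an atom of
  \<open>W\<close> at a positive essential infimum can even make it jump. A rule may choose its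
  rejected fraction after seeing the sample, so a law of large numbers at one fixed threshold does
  not suffice for the lower bound: the deviation must control all quantile thresholds at once, and a
  finite grid of them is enough. Fractions near 0 or 1, where dividing by \<open>u\<close> or
  \<open>1 - u\<close> would magnify the deviation, are cut off at a level \<eta> and compared with
  \<open>v 0\<close> and \<open>v \<pi>0\<close> instead. At level 0 the curve may start with
  infinite slope. Optimality is therefore certified by affine minorants up to an arbitrary error
  \<open>e\<close>, not by a supporting line.\<close>

text \<open>The values \<open>v (t k)\<close> need not converge, so the limit is taken along a
  convergent upper bound \<open>r\<close>.\<close>

lemma lsc_sequentially:
  fixes v :: "real \<Rightarrow> real"
  assumes lsc: "\<And>x e. x \<in> S \<Longrightarrow> e > 0 \<Longrightarrow> \<exists>d>0. \<forall>t\<in>S. \<bar>t - x\<bar> < d \<longrightarrow> v x - e \<le> v t"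
    and t: "\<And>k. t k \<in> S" "t \<longlonglongrightarrow> x" "x \<in> S"
    and r: "\<And>k. v (t k) \<le> r k" "r \<longlonglongrightarrow> c"
  shows "v x \<le> c"
proof (rule field_le_epsilon)
  fix e :: real assume "e > 0"
  from lsc[OF t(3) this] obtain d where d: "d > 0" "\<forall>s\<in>S. \<bar>s - x\<bar> < d \<longrightarrow> v x - e \<le> v s" by blast
  have "\<forall>\<^sub>F k in sequentially. \<bar>t k - x\<bar> < d"
    using tendstoD[OF t(2) d(1)] by (simp add: dist_real_def)
  then have "\<forall>\<^sub>F k in sequentially. v x - e \<le> r k"
    by eventually_elim (use d(2) t(1) r(1) order_trans in blast)
  then have "v x - e \<le> c"
    by (intro tendsto_lowerbound[OF r(2)]) auto
  then show "v x \<le> c + e" by simp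
qed

section \<open>Supporting lines and their contact points\<close>

text \<open>Equivalently, the line of slope \<open>- l\<close> through the graph point over
  \<open>t\<close> supports \<open>v\<close> on the unit interval; \<open>l\<close> is a Lagrange
  multiplier for the level constraint.\<close>

definition penalized_minimizer :: "(real \<Rightarrow> real) \<Rightarrow> real \<Rightarrow> real \<Rightarrow> bool" where
  "penalized_minimizer v l t \<longleftrightarrow> (\<forall>s\<in>{0..1}. v t + l * t \<le> v s + l * s)"

text \<open>Compactness of \<open>{a..b}\<close> yields a convergent subsequence of minimizers.
  Minimality bounds \<open>v\<close> along it by an expression continuous in slope and point, and
  lower semicontinuity carries the bound to the limit point.\<close>

lemma closed_penalized_minimizer:
  assumes lsc: "\<And>x e. x \<in> {0..1} \<Longrightarrow> e > 0 \<Longrightarrow> \<exists>d>0. \<forall>t\<in>{0..1}. \<bar>t - x\<bar> < d \<longrightarrow> v x - e \<le> v t"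
    and ab: "0 \<le> a" "b \<le> 1"
  shows "closed {l. \<exists>t\<in>{a..b}. penalized_minimizer v l t}"
  unfolding closed_sequential_limits
proof (intro allI impI, elim conjE)
  fix l :: "nat \<Rightarrow> real" and l0
  assume l: "\<forall>n. l n \<in> {l. \<exists>t\<in>{a..b}. penalized_minimizer v l t}" and lim: "l \<longlonglongrightarrow> l0"
  from l have "\<forall>n. \<exists>t. t \<in> {a..b} \<and> penalized_minimizer v (l n) t" by blast
  then obtain t where t: "\<And>n. t n \<in> {a..b}" "\<And>n. penalized_minimizer v (l n) (t n)" by metis
  from compact_Icc[of a b] t(1) obtain t0 r where tr: "t0 \<in> {a..b}" "strict_mono r" "(t \<circ> r) \<longlonglongrightarrow> t0"
    unfolding compact_def by (metis (lifting))
  have lr: "(l \<circ> r) \<longlonglongrightarrow> l0" by (rule LIMSEQ_subseq_LIMSEQ[OF lim tr(2)])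
  have "penalized_minimizer v l0 t0"
    unfolding penalized_minimizer_def
  proof
    fix s :: real assume s: "s \<in> {0..1}"
    have "v t0 \<le> v s + l0 * s - l0 * t0"
    proof (rule lsc_sequentially[OF lsc])
      show "(t \<circ> r) k \<in> {0..1}" for k using t(1)[of "r k"] ab by auto
      show "t0 \<in> {0..1}" using tr ab by auto
      show "v ((t \<circ> r) k) \<le> v s + (l \<circ> r) k * s - (l \<circ> r) k * (t \<circ> r) k" for k
      proof -
        have "v (t (r k)) + l (r k) * t (r k) \<le> v s + l (r k) * s"
          using t(2) s unfolding penalized_minimizer_def by blast
        then show ?thesis by simp
      qed
      show "(\<lambda>k. v s + (l \<circ> r) k * s - (l \<circ> r) k * (t \<circ> r) k) \<longlonglongrightarrow> v s + l0 * s - l0 * t0"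
        by (intro tendsto_intros lr tr)
    qed (use tr in \<open>auto simp: comp_def\<close>)
    then show "v t0 + l0 * t0 \<le> v s + l0 * s" by simp
  qed
  then show "l0 \<in> {l. \<exists>t\<in>{a..b}. penalized_minimizer v l t}" using tr by auto
qed

text \<open>Direct method: a minimizing sequence in a compact interval and lower semicontinuity at
  its limit. The signs of \<open>v\<close> and \<open>l\<close> keep the infimum finite.\<close>

lemma penalized_minimizer_exists:
  assumes lsc: "\<And>x e. x \<in> {0..1} \<Longrightarrow> e > 0 \<Longrightarrow> \<exists>d>0. \<forall>t\<in>{0..1}. \<bar>t - x\<bar> < d \<longrightarrow> v x - e \<le> v t"
    and nonneg: "\<And>t. t \<in> {0..1} \<Longrightarrow> 0 \<le> v t" and l: "0 \<le> l"
  shows "\<exists>t\<in>{0..1}. penalized_minimizer v l t"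
proof -
  define m where "m = (INF t\<in>{0..1}. v t + l * t)"
  have bdd: "bdd_below ((\<lambda>t. v t + l * t) ` {0..1})"
    using nonneg l by (intro bdd_belowI[of _ 0]) auto
  have "\<exists>t\<in>{0..1}. v t + l * t < m + inverse (real (Suc k))" for k
    using cINF_less_iff[OF _ bdd, of "m + inverse (real (Suc k))"] by (auto simp: m_def)
  then obtain t where t: "\<And>k. t k \<in> {0..1}" "\<And>k. v (t k) + l * t k < m + inverse (real (Suc k))"
    by metis
  from compact_Icc[of "0::real" 1] t(1) obtain t0 r where tr: "t0 \<in> {0..1}" "strict_mono r" "(t \<circ> r) \<longlonglongrightarrow> t0"
    unfolding compact_def by (metis (lifting))
  have "v t0 \<le> m + 0 - l * t0"
  proof (rule lsc_sequentially[OF lsc])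
    show "(t \<circ> r) k \<in> {0..1}" for k using t(1)[of "r k"] by auto
    show "v ((t \<circ> r) k) \<le> m + ((\<lambda>k. inverse (real (Suc k))) \<circ> r) k - l * (t \<circ> r) k" for k
      using t(2)[of "r k"] by auto
    show "(\<lambda>k. m + ((\<lambda>k. inverse (real (Suc k))) \<circ> r) k - l * (t \<circ> r) k) \<longlonglongrightarrow> m + 0 - l * t0"
      by (intro tendsto_intros tr LIMSEQ_subseq_LIMSEQ[OF LIMSEQ_inverse_real_of_nat tr(2)])
  qed (use tr in \<open>auto simp: comp_def\<close>)
  moreover have "m \<le> v s + l * s" if "s \<in> {0..1}" for s
    unfolding m_def by (rule cINF_lower[OF bdd that])
  ultimately have "penalized_minimizer v l t0"
    unfolding penalized_minimizer_def by fastforce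
  then show ?thesis using tr(1) by blast
qed

text \<open>The slopes whose supporting line touches \<open>v\<close> left, respectively right, of \<open>x\<close> form two closed
  sets covering an interval of slopes, so some line touches on both sides. At \<open>x = 0\<close> a supporting
  line need not exist and lower semicontinuity is used instead.\<close>

lemma convex_minorant_contact:
  fixes v :: "real \<Rightarrow> real"
  assumes lsc: "\<And>x e. x \<in> {0..1} \<Longrightarrow> e > 0 \<Longrightarrow> \<exists>d>0. \<forall>t\<in>{0..1}. \<bar>t - x\<bar> < d \<longrightarrow> v x - e \<le> v t"
    and range: "\<And>t. t \<in> {0..1} \<Longrightarrow> v t \<in> {0..1}" and v1: "v 1 = 0" and x: "x \<in> {0..1}"
  obtains x1 x2 where "0 \<le> x1" "x1 \<le> x" "x \<le> x2" "x2 \<le> 1"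
    "\<And>e. e > 0 \<Longrightarrow> \<exists>c l. 0 \<le> l \<and> (\<forall>t\<in>{0..1}. c - l * t \<le> v t) \<and>
        v x1 + (x - x1) / (x2 - x1) * (v x2 - v x1) - e \<le> c - l * x"
proof (cases "x = 0")
  case True
  have "\<exists>c l. 0 \<le> l \<and> (\<forall>t\<in>{0..1}. c - l * t \<le> v t) \<and> v 0 - e \<le> c" if "e > 0" for e
  proof -
    from lsc[OF _ that, of 0] obtain d where d: "d > 0" "\<forall>t\<in>{0..1}. \<bar>t\<bar> < d \<longrightarrow> v 0 - e \<le> v t" by auto
    \<comment> \<open>At distance \<open>d\<close> a line of slope \<open>- 1 / d\<close> has
      dropped by 1, the full range of \<open>v\<close>, so only points closer than \<open>d\<close>
      matter.\<close>
    have "v 0 - e - 1 / d * t \<le> v t" if t: "t \<in> {0..1}" for t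
    proof (cases "t < d")
      case True
      moreover have "0 \<le> 1 / d * t" using d t by simp
      moreover have "v 0 - e \<le> v t" using d(2) t True by auto
      ultimately show ?thesis by linarith
    next
      case False
      then have "1 \<le> 1 / d * t" using d by (simp add: field_simps)
      then show ?thesis using range[of 0] range[of t] t \<open>e > 0\<close> by auto
    qed
    then show ?thesis using d by (intro exI[of _ "v 0 - e"] exI[of _ "1 / d"]) auto
  qed
  \<comment> \<open>With \<open>x1 = x2 = 0\<close> the quotient is 0 by the default of division and
    the mixed value is \<open>v 0\<close>.\<close>
  then show ?thesis using that[of 0 0] True by simp
next
  case False
  with x have x0: "0 < x" "x \<le> 1" by auto
  let ?L = "{l. \<exists>t\<in>{0..x}. penalized_minimizer v l t}" and ?R = "{l. \<exists>t\<in>{x..1}. penalized_minimizer v l t}"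
  have ex: "\<exists>t\<in>{0..1}. penalized_minimizer v l t" if "0 \<le> l" for l
    using penalized_minimizer_exists[OF lsc _ that] range by auto
  have cl: "closed ?L" "closed ?R"
    using x by (auto intro!: closed_penalized_minimizer[OF lsc])
  have cover: "{0..1/x} \<subseteq> ?L \<union> ?R"
  proof
    fix l assume "l \<in> {0..1/x}"
    then obtain t where t: "t \<in> {0..1}" "penalized_minimizer v l t" using ex[of l] by auto
    then show "l \<in> ?L \<union> ?R" by (cases "t \<le> x") (auto intro: bexI[of _ t])
  qed
  \<comment> \<open>The horizontal line touches at the right end, where \<open>v\<close> takes its
    least possible value.\<close>
  have "penalized_minimizer v 0 1"
    using range v1 by (simp add: penalized_minimizer_def)
  then have "0 \<in> ?R" using x0 by auto
  then have R: "?R \<inter> {0..1/x} \<noteq> {}" using x0 by auto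
  \<comment> \<open>Moving right of \<open>x\<close> at penalty \<open>1 / x\<close> costs more than
    1, more than \<open>v\<close> can gain, so a line this steep touches no further right than
    \<open>x\<close>.\<close>
  have "1/x \<in> ?L"
  proof -
    from ex[of "1/x"] obtain t where t: "t \<in> {0..1}" "penalized_minimizer v (1/x) t" using x0 by auto
    have "v t + 1/x * t \<le> v 0 + 1/x * 0" using t(2) unfolding penalized_minimizer_def by (rule bspec) simp
    with range[of t] range[of 0] t have "1/x * t \<le> 1" by auto
    then have "t \<le> x" using x0 by (simp add: field_simps)
    with t show ?thesis by auto
  qed
  then have L: "?L \<inter> {0..1/x} \<noteq> {}" using x0 by auto
  have "?L \<inter> ?R \<inter> {0..1/x} \<noteq> {}"
    using connected_Icc[of 0 "1/x"] cl cover L R unfolding connected_closed by blast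
  then obtain l where "l \<in> ?L \<inter> ?R \<inter> {0..1/x}" by blast
  then have "l \<in> ?L" "l \<in> ?R" and l: "0 \<le> l" by (simp_all only: Int_iff atLeastAtMost_iff)
  then obtain x1 x2 where 1: "x1 \<in> {0..x}" "penalized_minimizer v l x1"
    and 2: "x2 \<in> {x..1}" "penalized_minimizer v l x2" by blast
  define c where "c = v x1 + l * x1"
  have eq: "v x1 + l * x1 = v x2 + l * x2"
    using 1 2 x0 by (intro antisym) (auto simp: penalized_minimizer_def)
  have min: "\<forall>t\<in>{0..1}. c - l * t \<le> v t"
    using 1 by (auto simp: penalized_minimizer_def c_def algebra_simps)
  \<comment> \<open>Both contact points lie on one line, so the chord between them is that line and
    the bound holds with no error.\<close>
  have "v x1 + (x - x1) / (x2 - x1) * (v x2 - v x1) = c - l * x"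
  proof -
    have d: "v x2 - v x1 = - l * (x2 - x1)" using eq by (simp add: algebra_simps)
    show ?thesis
    proof (cases "x1 = x2")
      case True then show ?thesis using 1 2 by (simp add: c_def)
    next
      case False
      then have "(x - x1) / (x2 - x1) * (- l * (x2 - x1)) = - l * (x - x1)" by simp
      then show ?thesis unfolding d c_def by (simp add: algebra_simps)
    qed
  qed
  then show ?thesis using that[of x1 x2] 1 2 l min by (metis atLeastAtMost_iff diff_ge_0_iff_ge less_imp_le diff_le_eq le_add_same_cancel1)
qed

text \<open>Convexity puts every minorant below the chord between \<open>x1\<close> and
  \<open>x2\<close>, and affine minorants come within any \<open>e\<close> of that chord at
  \<open>x\<close>. The slack covers the point 0, where no line need reach the supremum.\<close>

lemma Sup_convex_minorants:
  fixes v :: "real \<Rightarrow> real"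
  assumes x: "0 \<le> x1" "x1 \<le> x" "x \<le> x2" "x2 \<le> 1"
    and lines: "\<And>e. e > 0 \<Longrightarrow> \<exists>c l. 0 \<le> l \<and> (\<forall>t\<in>{0..1}. c - l * t \<le> v t) \<and>
        v x1 + (x - x1) / (x2 - x1) * (v x2 - v x1) - e \<le> c - l * x"
  shows "Sup {C x | C. convex_on {0..1} C \<and> (\<forall>t\<in>{0..1}. C t \<le> v t)}
    = v x1 + (x - x1) / (x2 - x1) * (v x2 - v x1)" (is "Sup ?A = ?y")
proof (rule cSup_eq)
  fix z assume "z \<in> ?A"
  then obtain C where z: "z = C x" and C: "convex_on {0..1} C" "\<forall>t\<in>{0..1}. C t \<le> v t" by auto
  \<comment> \<open>If \<open>x1 = x2\<close> then \<open>w = 0\<close>, and the combination below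
    still returns \<open>x\<close>.\<close>
  define w where "w = (x - x1) / (x2 - x1)"
  have w: "0 \<le> w" "w \<le> 1" "x = (1 - w) * x1 + w * x2"
    using x by (auto simp: w_def divide_simps) (auto simp: algebra_simps)
  have "C ((1 - w) *\<^sub>R x1 + w *\<^sub>R x2) \<le> (1 - w) * C x1 + w * C x2"
    using x by (intro convex_onD[OF C(1)] w) auto
  also have "\<dots> \<le> (1 - w) * v x1 + w * v x2"
    using w C(2) x by (intro add_mono mult_left_mono) auto
  also have "\<dots> = v x1 + w * (v x2 - v x1)" by (simp add: algebra_simps)
  finally show "z \<le> ?y" unfolding z w_def[symmetric] using w(3) by simp
next
  fix y assume y: "\<And>z. z \<in> ?A \<Longrightarrow> z \<le> y"
  show "?y \<le> y"
  proof (rule field_le_epsilon)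
    fix e :: real assume "e > 0"
    from lines[OF this] obtain c l where cl: "0 \<le> l" "\<forall>t\<in>{0..1}. c - l * t \<le> v t" "?y - e \<le> c - l * x" by auto
    have "convex_on {0..1} (\<lambda>t. c - l * t)"
      by (intro convex_onI) (auto simp: algebra_simps)
    then have "c - l * x \<in> ?A" using cl by auto
    from y[OF this] cl show "?y \<le> y + e" by simp
  qed
qed

section \<open>The Neyman-Pearson trade-off curve\<close>

locale two_group_ties = two_group +
  fixes p :: "real \<Rightarrow> real"
  assumes ties: "tie_breaking p"
begin

abbreviation P :: "'a measure" where
  "P \<equiv> density M f"

sublocale P: prob_space P
  by (rule prob_space_f)

text \<open>Conditional probability of a rejection given the observation: with the coin integrated
  out, the randomized test is an ordinary function.\<close>

definition rej :: "real \<Rightarrow> 'a \<Rightarrow> real" where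
  "rej u x = (if W x < Ginv u then 1 else if W x = Ginv u then p u else 0)"

text \<open>This is the integral of \<open>G\<close> up to \<open>t\<close>; its slope at
  \<open>t\<close> is \<open>G t\<close>, which is why the quantile \<open>Ginv u\<close> is the
  point dual to \<open>u\<close>.\<close>

definition \<psi> :: "real \<Rightarrow> real" where
  "\<psi> t = (LINT x|P. max 0 (t - W x))"

text \<open>The probability that a single coordinate is null and rejected by the test with rejection
  probability \<open>u\<close>.\<close>

definition A :: "real \<Rightarrow> real" where
  "A u = (LINT x|P. W x * rej u x)"

text \<open>Accepted coordinates have mass \<open>1 - u\<close>, of which
  \<open>\<pi>0 - A u\<close> is null; the rest is the numerator. At \<open>u = 1\<close> the
  default of division agrees with the convention 0/0 = 0 for mFNR.\<close>

definition b :: "real \<Rightarrow> real" where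
  "b u = (\<pi>1 - u + A u) / (1 - u)"

lemma p_range: "u \<in> {0..1} \<Longrightarrow> 0 \<le> p u" "u \<in> {0..1} \<Longrightarrow> p u \<le> 1"
  using ties by (auto simp: tie_breaking_def)

lemma rej_measurable[measurable]: "rej u \<in> borel_measurable M"
  unfolding rej_def by measurable

lemma rej_range: "u \<in> {0..1} \<Longrightarrow> rej u x \<in> {0..1}"
  using p_range[of u] by (auto simp: rej_def)

lemma pmf_S: "u \<in> {0..1} \<Longrightarrow> pmf (S p u x) True = rej u x" "u \<in> {0..1} \<Longrightarrow> pmf (S p u x) False = 1 - rej u x"
  using p_range[of u] by (auto simp: S_def rej_def)

lemma integrable_bounded:
  assumes [measurable]: "h \<in> borel_measurable M" and h: "\<And>x. x \<in> space M \<Longrightarrow> \<bar>h x\<bar> \<le> B"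
  shows "integrable P (h :: 'a \<Rightarrow> real)"
  using h by (intro P.integrable_const_bound[of _ B]) (auto intro!: AE_I2)

lemma W_abs: "x \<in> space M \<Longrightarrow> \<bar>W x\<bar> \<le> 1"
  using W_range[of x] by auto

lemma integral_rej: assumes u: "u \<in> {0..1}" shows "(LINT x|P. rej u x) = u"
proof -
  have "(LINT x|P. rej u x) = (LINT x|P. indicator {x\<in>space M. W x < Ginv u} x + p u * indicator {x\<in>space M. W x = Ginv u} x)"
    by (intro Bochner_Integration.integral_cong) (auto simp: rej_def)
  also have "\<dots> = u"
    using ties u by (subst Bochner_Integration.integral_add) (auto simp: tie_breaking_def P.emeasure_eq_measure)
  finally show ?thesis .
qed

section \<open>The two conditional laws relative to the marginal law\<close>

text \<open>Bayes' formula read as a change of measure. Where \<open>f\<close> vanishes so does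
  \<open>f0\<close>, hence the default value of \<open>W\<close> there is harmless.\<close>

lemma density_f0: "density M f0 = density P (\<lambda>x. W x / \<pi>0)"
proof -
  have "density P (\<lambda>x. W x / \<pi>0) = density M (\<lambda>x. ennreal (f x) * ennreal (W x / \<pi>0))"
    by (subst density_density_eq) auto
  also have "\<dots> = density M f0"
  proof (intro density_cong AE_I2)
    fix x assume x: "x \<in> space M"
    have "0 \<le> \<pi>0 * f0 x" "0 \<le> \<pi>1 * f1 x"
      using f0_nonneg[OF x] f1_nonneg[OF x] pi0 pi1 by auto
    then have "f x * (W x / \<pi>0) = f0 x"
      using pi0 by (cases "f x = 0") (auto simp: W_def f_def add_nonneg_eq_0_iff)
    moreover have "0 \<le> f x"
      using \<open>0 \<le> \<pi>0 * f0 x\<close> \<open>0 \<le> \<pi>1 * f1 x\<close> by (simp add: f_def)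
    ultimately show "ennreal (f x) * ennreal (W x / \<pi>0) = ennreal (f0 x)"
      by (simp flip: ennreal_mult')
  qed auto
  finally show ?thesis by simp
qed

lemma density_f1: "density M f1 = density P (\<lambda>x. (1 - W x) / \<pi>1)"
proof -
  have "density P (\<lambda>x. (1 - W x) / \<pi>1) = density M (\<lambda>x. ennreal (f x) * ennreal ((1 - W x) / \<pi>1))"
    by (subst density_density_eq) auto
  also have "\<dots> = density M f1"
  proof (intro density_cong AE_I2)
    fix x assume x: "x \<in> space M"
    have *: "0 \<le> \<pi>0 * f0 x" "0 \<le> \<pi>1 * f1 x"
      using f0_nonneg[OF x] f1_nonneg[OF x] pi0 pi1 by auto
    have "f x * ((1 - W x) / \<pi>1) = f1 x"
    proof (cases "f x = 0")
      case True
      then show ?thesis using * pi1 by (auto simp: f_def add_nonneg_eq_0_iff)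
    next
      case False
      then have "f x * (1 - W x) = \<pi>1 * f1 x"
        by (simp add: W_def right_diff_distrib) (simp add: f_def)
      then show ?thesis using pi1 by (simp add: field_simps)
    qed
    moreover have "0 \<le> f x"
      using * by (simp add: f_def)
    ultimately show "ennreal (f x) * ennreal ((1 - W x) / \<pi>1) = ennreal (f1 x)"
      by (simp flip: ennreal_mult')
  qed auto
  finally show ?thesis by simp
qed

text \<open>By \<open>density_f0\<close>, \<open>W / \<pi>0\<close> is a probability density
  relative to \<open>P\<close>.\<close>

lemma integral_W: "(LINT x|P. W x) = \<pi>0"
proof -
  have "emeasure (density P (\<lambda>x. W x / \<pi>0)) (space M) = 1"
    using prob_space.emeasure_space_1[OF f0_prob] by (simp flip: density_f0)
  then have "(\<integral>\<^sup>+x. ennreal (W x / \<pi>0) \<partial>P) = 1"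
    by (subst (asm) emeasure_density) (auto simp: nn_integral_density cong: nn_integral_cong_simp)
  then have "(LINT x|P. W x / \<pi>0) = 1"
    using W_range pi0 by (subst integral_eq_nn_integral) (auto intro!: AE_I2)
  then show ?thesis using pi0 by simp
qed

lemma G_1: "G 1 = 1"
  using P.prob_space W_range by (auto simp: G_def cong: conj_cong)

lemma Ginv_range: assumes u: "u \<in> {0..1}" shows "Ginv u \<in> {0..1}"
proof -
  have 1: "1 \<in> {t \<in> {0..1}. u \<le> G t}" using u G_1 by auto
  have bdd: "bdd_below {t \<in> {0..1}. u \<le> G t}" by (rule bdd_belowI[of _ 0]) auto
  have "Ginv u \<le> 1" unfolding Ginv_def by (rule cInf_lower[OF 1 bdd])
  moreover have "0 \<le> Ginv u" unfolding Ginv_def by (rule cInf_greatest) (use 1 in auto)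
  ultimately show ?thesis by simp
qed

lemma integrable_W: "integrable P W"
  by (rule integrable_bounded[OF W_measurable W_abs])

lemma integrable_rej: "u \<in> {0..1} \<Longrightarrow> integrable P (rej u)"
  using rej_range[of u] by (intro integrable_bounded[of _ 1]) auto

lemma integrable_W_rej: "u \<in> {0..1} \<Longrightarrow> integrable P (\<lambda>x. W x * rej u x)"
  using rej_range[of u] W_range by (intro integrable_bounded[of _ 1]) (auto simp: abs_mult intro!: mult_le_one)

section \<open>Legendre duality and convexity of \<open>A\<close>\<close>

lemma integrable_pos_part: "integrable P (\<lambda>x. max 0 (t - W x))"
proof (rule integrable_bounded)
  fix x assume "x \<in> space M"
  from W_range[OF this] show "\<bar>max 0 (t - W x)\<bar> \<le> \<bar>t\<bar> + 1" by auto
qed measurable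

text \<open>The test rejects below the quantile and accepts above it, and its coin acts only where
  \<open>Ginv u - W\<close> is 0; so \<open>(Ginv u - W) * rej u\<close> is exactly the positive
  part.\<close>

lemma A_eq: assumes u: "u \<in> {0..1}" shows "A u = Ginv u * u - \<psi> (Ginv u)"
proof -
  have "A u = (LINT x|P. Ginv u * rej u x - max 0 (Ginv u - W x))"
    unfolding A_def by (intro Bochner_Integration.integral_cong) (auto simp: rej_def)
  also have "\<dots> = Ginv u * u - \<psi> (Ginv u)"
    using u by (subst Bochner_Integration.integral_diff) (auto simp: \<psi>_def integral_rej integrable_rej integrable_pos_part)
  finally show ?thesis .
qed

text \<open>A decision, even a fractional one, gains at most the positive part of
  \<open>t - w\<close>. This inequality gives the optimality of the one-coordinate test and, applied
  to 0/1 decisions, the bounds for arbitrary rules.\<close>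

lemma legendre_pointwise:
  fixes w s t :: real
  assumes "s \<in> {0..1}"
  shows "t * s - max 0 (t - w) \<le> w * s"
proof -
  have "(t - w) * s \<le> max 0 (t - w)"
  proof (cases "w \<le> t")
    case True
    then show ?thesis using assms mult_left_le[of s "t - w"] by auto
  next
    case False
    then show ?thesis using assms mult_nonpos_nonneg[of "t - w" s] by auto
  qed
  then show ?thesis by (simp add: algebra_simps)
qed

lemma A_ge: assumes u: "u \<in> {0..1}" shows "t * u - \<psi> t \<le> A u"
proof -
  have "t * u - \<psi> t = (LINT x|P. t * rej u x - max 0 (t - W x))"
    using u by (subst Bochner_Integration.integral_diff) (auto simp: \<psi>_def integral_rej integrable_rej integrable_pos_part)
  also have "\<dots> \<le> A u"
    unfolding A_def using u
    by (intro integral_mono integrable_W_rej integrable_rej integrable_pos_part Bochner_Integration.integrable_diff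
        integrable_mult_right legendre_pointwise rej_range) auto
  finally show ?thesis .
qed

text \<open>The affine function that attains the supremum at \<open>u\<close> is a minorant of
  \<open>A\<close> elsewhere. Convexity of \<open>A\<close> is used in this form only.\<close>

lemma A_subgradient: "u \<in> {0..1} \<Longrightarrow> u' \<in> {0..1} \<Longrightarrow> A u + Ginv u * (u' - u) \<le> A u'"
  using A_ge[of u' "Ginv u"] A_eq[of u] by (simp add: algebra_simps)

lemma A_nonneg: "u \<in> {0..1} \<Longrightarrow> 0 \<le> A u"
  unfolding A_def using rej_range[of u] W_range by (intro integral_nonneg_AE AE_I2) auto

lemma A_le: assumes u: "u \<in> {0..1}" shows "A u \<le> u"
proof -
  have "A u \<le> (LINT x|P. rej u x)"
    unfolding A_def using u rej_range[of u] W_range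
    by (intro integral_mono integrable_W_rej integrable_rej) (auto intro!: mult_left_le_one_le)
  then show ?thesis using u by (simp add: integral_rej)
qed

lemma A_0: "A 0 = 0"
  using A_nonneg[of 0] A_le[of 0] by auto

lemma A_1: "A 1 = \<pi>0"
proof -
  have "A 1 \<le> (LINT x|P. W x)"
    unfolding A_def using rej_range[of 1] W_range
    by (intro integral_mono integrable_W_rej integrable_W) (auto intro!: mult_right_le_one_le)
  \<comment> \<open>Rejection at level 1 is almost sure, but it is simpler to bound
    \<open>W * rej 1\<close> below by an integrand whose integral is known.\<close>
  moreover have "(LINT x|P. W x - (1 - rej 1 x)) \<le> A 1"
    unfolding A_def
  proof (intro integral_mono)
    show "integrable P (\<lambda>x. W x - (1 - rej 1 x))"
      by (intro Bochner_Integration.integrable_diff integrable_W integrable_rej) auto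
    fix x assume "x \<in> space P"
    then have "0 \<le> (1 - W x) * (1 - rej 1 x)" using rej_range[of 1 x] W_range[of x] by auto
    then show "W x - (1 - rej 1 x) \<le> W x * rej 1 x" by (simp add: algebra_simps)
  qed (auto intro: integrable_W_rej)
  then have "\<pi>0 - (1 - 1) \<le> A 1"
    by (subst (asm) Bochner_Integration.integral_diff, (auto intro!: integrable_W integrable_rej simp: integral_W integral_rej)[2])
       (subst (asm) Bochner_Integration.integral_diff, auto intro!: integrable_W integrable_rej simp: integral_W integral_rej P.prob_space[simplified])
  ultimately show ?thesis by (simp add: integral_W)
qed

text \<open>The subgradients are quantiles of \<open>W\<close> and so lie in the unit
  interval.\<close>

lemma A_lipschitz: assumes "u \<in> {0..1}" "u' \<in> {0..1}" shows "\<bar>A u' - A u\<bar> \<le> \<bar>u' - u\<bar>"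
proof -
  have "A u' - A u \<le> \<bar>u' - u\<bar>" if "u \<in> {0..1}" "u' \<in> {0..1}" for u u'
  proof -
    have "A u' - A u \<le> Ginv u' * (u' - u)"
      using A_subgradient[OF that(2,1)] by (simp add: algebra_simps)
    also have "\<dots> \<le> \<bar>Ginv u' * (u' - u)\<bar>" by simp
    also have "\<dots> \<le> 1 * \<bar>u' - u\<bar>"
      unfolding abs_mult using Ginv_range[OF that(2)] by (intro mult_right_mono) auto
    finally show ?thesis by simp
  qed
  from this[of u u'] this[of u' u] assms show ?thesis by auto
qed

text \<open>Slopes of chords from the origin increase for a convex function vanishing at 0. So once
  the level constraint fails at some \<open>u\<close>, it fails at all larger ones.\<close>

lemma A_slope_mono:
  assumes "0 < u" "u \<le> u'" "u' \<le> 1" shows "A u / u \<le> A u' / u'"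
proof -
  have "A u / u \<le> Ginv u"
    using A_subgradient[of u 0] assms by (simp add: A_0 divide_simps)
  then have "A u / u * (u' - u) \<le> Ginv u * (u' - u)"
    using assms by (intro mult_right_mono) auto
  then have "A u + A u / u * (u' - u) \<le> A u'"
    using A_subgradient[of u u'] assms by auto
  moreover have "A u + A u / u * (u' - u) = A u / u * u'"
    using assms by (simp add: field_simps)
  ultimately show ?thesis using assms by (simp add: field_simps)
qed

section \<open>False nondiscovery as a function of the rejection probability\<close>

lemma b_1: "b 1 = 0"
  by (simp add: b_def)

text \<open>One minus a chord slope of \<open>A\<close> towards the right end, which turns range and
  monotonicity of \<open>b\<close> into facts about chords of a convex function.\<close>

lemma b_alt: "u < 1 \<Longrightarrow> b u = 1 - (A 1 - A u) / (1 - u)"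
  using pi_sum by (simp add: b_def A_1 field_simps)

lemma b_range: assumes u: "u \<in> {0..1}" shows "b u \<in> {0..1}"
proof (cases "u = 1")
  case False
  with u have u1: "u < 1" by auto
  have "A u \<le> A 1"
    using A_subgradient[of u 1] mult_nonneg_nonneg[of "Ginv u" "1 - u"] Ginv_range[OF u] u
    by (simp del: mult_nonneg_nonneg)
  moreover have "A 1 - A u \<le> 1 - u" using A_lipschitz[of u 1] u by auto
  ultimately show ?thesis using u1 by (auto simp: b_alt divide_le_eq)
qed (simp add: b_1)

text \<open>Chord slopes towards the right end increase with the left end. At 1, where
  \<open>b\<close> is 0 by the default of division, nonnegativity of \<open>b u\<close>
  suffices.\<close>

lemma b_antimono: assumes "0 \<le> u" "u \<le> u'" "u' \<le> 1" shows "b u' \<le> b u"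
proof (cases "u' = 1")
  case True
  then show ?thesis using b_range[of u] assms by (simp add: b_1)
next
  case False
  then have u': "u' < 1" using assms by auto
  let ?s = "(A 1 - A u') / (1 - u')"
  have s: "?s * (1 - u') = A 1 - A u'" using u' by simp
  have "Ginv u' \<le> ?s"
    using A_subgradient[of u' 1] u' assms by (simp add: divide_simps)
  then have "Ginv u' * (u' - u) \<le> ?s * (u' - u)"
    using assms by (intro mult_right_mono) auto
  moreover have "A u' - A u \<le> Ginv u' * (u' - u)"
    using A_subgradient[of u' u] assms by (simp add: algebra_simps)
  ultimately have "A 1 - A u \<le> ?s * (1 - u') + ?s * (u' - u)" using s by linarith
  also have "\<dots> = ?s * (1 - u)" by (simp only: flip: distrib_left) simp
  finally have "(A 1 - A u) / (1 - u) \<le> ?s" using u' assms by (simp add: divide_le_eq)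
  then show ?thesis using u' assms by (simp add: b_alt)
qed

section \<open>The conditional mean of \<open>W\<close> given a rejection\<close>

lemma nn_integral_joint_XS:
  assumes [measurable]: "h \<in> borel_measurable (M \<Otimes>\<^sub>M count_space UNIV)"
  shows "(\<integral>\<^sup>+z. h z \<partial>joint_XS p u) = (\<integral>\<^sup>+x. \<integral>\<^sup>+s. h (x, s) \<partial>S p u x \<partial>P)"
proof -
  note S_kernel[measurable]
  have 1: "(\<lambda>x. measure_pmf (S p u x) \<bind> (\<lambda>s. return (M \<Otimes>\<^sub>M count_space UNIV) (x, s)))
      \<in> M \<rightarrow>\<^sub>M prob_algebra (M \<Otimes>\<^sub>M count_space UNIV)"
    by measurable
  have "(\<integral>\<^sup>+z. h z \<partial>joint_XS p u)
      = (\<integral>\<^sup>+x. \<integral>\<^sup>+z. h z \<partial>(measure_pmf (S p u x) \<bind> (\<lambda>s. return (M \<Otimes>\<^sub>M count_space UNIV) (x, s))) \<partial>P)"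
    unfolding joint_XS_def
    using measurable_prob_algebraD[OF 1] by (intro nn_integral_bind[where B = "M \<Otimes>\<^sub>M count_space UNIV"]) simp_all
  also have "\<dots> = (\<integral>\<^sup>+x. \<integral>\<^sup>+s. h (x, s) \<partial>S p u x \<partial>P)"
  proof (intro nn_integral_cong)
    fix x assume x: "x \<in> space P"
    have "(\<lambda>s. return (M \<Otimes>\<^sub>M count_space UNIV) (x, s))
        \<in> measure_pmf (S p u x) \<rightarrow>\<^sub>M subprob_algebra (M \<Otimes>\<^sub>M count_space UNIV)"
      using x by (auto simp: space_subprob_algebra space_pair_measure intro!: prob_space_imp_subprob_space prob_space_return)
    then show "(\<integral>\<^sup>+z. h z \<partial>(measure_pmf (S p u x) \<bind> (\<lambda>s. return (M \<Otimes>\<^sub>M count_space UNIV) (x, s))))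
        = (\<integral>\<^sup>+s. h (x, s) \<partial>S p u x)"
      using x by (subst nn_integral_bind[where B = "M \<Otimes>\<^sub>M count_space UNIV"])
        (auto simp: nn_integral_return space_pair_measure intro!: nn_integral_cong)
  qed
  finally show ?thesis .
qed

text \<open>Rejection has probability \<open>u\<close>, so \<open>uniform_measure\<close> is
  elementary conditioning and the mean becomes a quotient. At \<open>u = 0\<close> the separate case
  in \<open>a\<close> agrees with division by zero.\<close>

lemma a_eq: assumes u: "u \<in> {0..1}" shows "a p u = A u / u"
proof (cases "u = 0")
  case False
  with u have u0: "0 < u" by auto
  let ?J = "joint_XS p u"
  have sJ[measurable_cong]: "sets ?J = sets (M \<Otimes>\<^sub>M count_space UNIV)"
    using joint_XS_prob_algebra[of p u] by (simp add: space_prob_algebra)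
  have spJ: "space ?J = space M \<times> UNIV"
    using sets_eq_imp_space_eq[OF sJ] by (simp add: space_pair_measure)
  let ?E = "{(x, s) \<in> space ?J. s}"
  have E[measurable]: "?E \<in> sets ?J" 
  proof -
    have "?E = space M \<times> {True}" by (auto simp: spJ)
    then show ?thesis by (simp add: sJ)
  qed
  have S: "(\<integral>\<^sup>+s. c * indicator {True} s \<partial>S p u x) = c * ennreal (rej u x)" for x c
    using u by (simp add: nn_integral_cmult pmf_S emeasure_pmf_single)
  have "emeasure ?J ?E = (\<integral>\<^sup>+z. indicator ?E z \<partial>?J)" by simp
  also have "\<dots> = (\<integral>\<^sup>+x. \<integral>\<^sup>+s. indicator ?E (x, s) \<partial>S p u x \<partial>P)"
    by (rule nn_integral_joint_XS) measurable
  also have "\<dots> = (\<integral>\<^sup>+x. \<integral>\<^sup>+s. 1 * indicator {True} s \<partial>S p u x \<partial>P)"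
    by (intro nn_integral_cong) (auto simp: spJ indicator_def)
  also have "\<dots> = (\<integral>\<^sup>+x. ennreal (rej u x) \<partial>P)"
    unfolding S by simp
  also have "\<dots> = ennreal u"
    using u rej_range[OF u] by (subst nn_integral_eq_integral[OF integrable_rej[OF u]]) (auto simp: integral_rej)
  finally have eE: "emeasure ?J ?E = ennreal u" .
  have "(\<integral>\<^sup>+z. ennreal (W (fst z)) \<partial>uniform_measure ?J ?E) = (\<integral>\<^sup>+z. ennreal (W (fst z)) * indicator ?E z \<partial>?J) / ennreal u"
    by (subst nn_integral_uniform_measure) (auto simp: eE)
  also have "(\<integral>\<^sup>+z. ennreal (W (fst z)) * indicator ?E z \<partial>?J) = (\<integral>\<^sup>+x. \<integral>\<^sup>+s. ennreal (W x) * indicator ?E (x, s) \<partial>S p u x \<partial>P)"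
    by (subst nn_integral_joint_XS) auto
  also have "\<dots> = (\<integral>\<^sup>+x. \<integral>\<^sup>+s. ennreal (W x) * indicator {True} s \<partial>S p u x \<partial>P)"
    by (intro nn_integral_cong) (auto simp: spJ indicator_def)
  also have "\<dots> = (\<integral>\<^sup>+x. ennreal (W x * rej u x) \<partial>P)"
    unfolding S using W_range rej_range[OF u] by (intro nn_integral_cong) (auto simp: ennreal_mult)
  also have "\<dots> = ennreal (A u)"
    unfolding A_def using u rej_range[OF u] W_range by (subst nn_integral_eq_integral[OF integrable_W_rej[OF u]]) (auto intro!: AE_I2)
  also have "ennreal (A u) / ennreal u = ennreal (A u / u)"
    using u0 A_nonneg[OF u] by (simp add: divide_ennreal)
  finally have nn: "(\<integral>\<^sup>+z. ennreal (W (fst z)) \<partial>uniform_measure ?J ?E) = ennreal (A u / u)" .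
  have "a p u = (LINT z|uniform_measure ?J ?E. W (fst z))"
    using False by (simp add: a_def case_prod_beta')
  also have "\<dots> = enn2real (\<integral>\<^sup>+z. ennreal (W (fst z)) \<partial>uniform_measure ?J ?E)"
    using W_range by (intro integral_eq_nn_integral) (auto simp: spJ intro!: AE_I2)
  also have "\<dots> = A u / u"
    unfolding nn using A_nonneg[OF u] u0 by simp
  finally show ?thesis .
qed (simp add: a_def)

section \<open>The value function and its lower semicontinuity\<close>

definition v :: "real \<Rightarrow> real" where
  "v \<alpha> = b (u_star p \<alpha>)"

text \<open>Clearing the denominator yields a constraint continuous in \<open>u\<close> that always
  admits 0; \<open>a\<close> itself may jump there.\<close>

lemma a_le_iff: "0 \<le> \<alpha> \<Longrightarrow> u \<in> {0..1} \<Longrightarrow> a p u \<le> \<alpha> \<longleftrightarrow> A u \<le> \<alpha> * u"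
  by (cases "u = 0") (auto simp: a_eq A_0 divide_le_eq)

lemma continuous_on_A: "continuous_on {0..1} A"
proof (rule continuous_onI)
  fix x e :: real assume "x \<in> {0..1}" "e > 0"
  then show "\<exists>d>0. \<forall>x'\<in>{0..1}. dist x' x < d \<longrightarrow> dist (A x') (A x) \<le> e"
    using A_lipschitz[of x] by (intro exI[of _ e]) (force simp: dist_real_def)
qed

text \<open>The constraint set is compact, so its supremum is feasible and the Neyman-Pearson rule
  respects its own level.\<close>

lemma u_star_mem: assumes \<alpha>: "0 \<le> \<alpha>" shows "u_star p \<alpha> \<in> {u \<in> {0..1}. A u \<le> \<alpha> * u}"
proof -
  have "closed {u \<in> {0..1}. A u \<le> \<alpha> * u}"
    by (intro continuous_on_closed_Collect_le continuous_on_A continuous_intros)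
  moreover have "{u \<in> {0..1}. A u \<le> \<alpha> * u} \<noteq> {}" by (auto simp: A_0 intro!: exI[of _ 0])
  moreover have "bdd_above {u \<in> {0..1}. A u \<le> \<alpha> * u}" by (rule bdd_aboveI[of _ 1]) auto
  ultimately have mem: "Sup {u \<in> {0..1}. A u \<le> \<alpha> * u} \<in> {u \<in> {0..1}. A u \<le> \<alpha> * u}"
    by (intro closed_contains_Sup)
  have eq: "{u \<in> {0..1}. a p u \<le> \<alpha>} = {u \<in> {0..1}. A u \<le> \<alpha> * u}"
    using a_le_iff[OF \<alpha>] by blast
  show ?thesis unfolding u_star_def eq by (rule mem)
qed

lemma u_star_range: "0 \<le> \<alpha> \<Longrightarrow> u_star p \<alpha> \<in> {0..1}"
  using u_star_mem by auto

lemma A_u_star: "0 \<le> \<alpha> \<Longrightarrow> A (u_star p \<alpha>) \<le> \<alpha> * u_star p \<alpha>"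
  using u_star_mem by auto

lemma le_u_star: assumes "0 \<le> \<alpha>" "u \<in> {0..1}" "A u \<le> \<alpha> * u" shows "u \<le> u_star p \<alpha>"
proof -
  have "bdd_above {u \<in> {0..1}. a p u \<le> \<alpha>}" by (rule bdd_aboveI[of _ 1]) auto
  then show ?thesis
    unfolding u_star_def using assms by (intro cSup_upper) (auto simp: a_le_iff)
qed

lemma v_range: "0 \<le> \<alpha> \<Longrightarrow> v \<alpha> \<in> {0..1}"
  unfolding v_def using b_range[OF u_star_range] .

text \<open>Since \<open>b\<close> decreases, the largest admissible rejection probability is the
  best one.\<close>

lemma v_le_b: assumes "0 \<le> \<alpha>" "u \<in> {0..1}" "A u \<le> \<alpha> * u" shows "v \<alpha> \<le> b u"
  unfolding v_def using le_u_star[OF assms] u_star_range[of \<alpha>] assms by (intro b_antimono) auto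

lemma v_1: "v 1 = 0"
proof -
  have "u_star p 1 = 1"
    using le_u_star[of 1 1] u_star_range[of 1] A_1 pi0 by auto
  then show ?thesis by (simp add: v_def b_1)
qed

text \<open>As \<open>v\<close> decreases, only levels slightly above \<open>x\<close> could lower
  it. They cannot push \<open>u_star\<close> past a point \<open>u1\<close> just above
  \<open>u_star p x\<close>, because the slope \<open>A u1 / u1\<close> already exceeds
  \<open>x\<close>.\<close>

lemma v_lsc:
  assumes x: "x \<in> {0..1}" and e: "e > 0"
  shows "\<exists>d>0. \<forall>t\<in>{0..1}. \<bar>t - x\<bar> < d \<longrightarrow> v x - e \<le> v t"
proof (cases "u_star p x = 1")
  case True
  then have "v x - e \<le> v t" if "t \<in> {0..1}" for t
    using v_range[of t] that e by (auto simp: v_def b_1)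
  then show ?thesis by (intro exI[of _ 1]) auto
next
  case False
  define u0 where "u0 = u_star p x"
  have u0: "0 \<le> u0" "u0 < 1" using False u_star_range[of x] x by (auto simp: u0_def)
  have "continuous_on {0..<1} b"
    unfolding b_def by (intro continuous_intros continuous_on_subset[OF continuous_on_A]) auto
  then obtain d where d: "d > 0" "\<forall>u\<in>{0..<1}. dist u u0 < d \<longrightarrow> dist (b u) (b u0) < e"
    using u0 e unfolding continuous_on_iff by (metis atLeastLessThan_iff)
  \<comment> \<open>Strictly right of \<open>u0\<close>, within the continuity radius of
    \<open>b\<close>, and strictly left of 1, where \<open>b\<close> may jump.\<close>
  define u1 where "u1 = u0 + min (d / 2) ((1 - u0) / 2)"
  have "u0 + (1 - u0) / 2 < 1" using u0 by (simp add: field_simps)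
  then have u1: "u0 < u1" "u1 < 1" "dist u1 u0 < d"
    using d(1) u0 by (auto simp: u1_def dist_real_def min_def)
  have b1: "v x - e \<le> b u1"
  proof -
    have "dist (b u1) (b u0) < e" using d(2) u1 u0 by auto
    then show ?thesis by (auto simp: v_def u0_def dist_real_def)
  qed
  \<comment> \<open>Beyond the supremum the constraint fails; the slack of the slope over
    \<open>x\<close> serves as the radius of the neighbourhood.\<close>
  have "\<not> A u1 \<le> x * u1"
    using le_u_star[of x u1] x u1 u0 by (auto simp: u0_def)
  then have pos: "0 < A u1 / u1 - x" using u1 u0 by (simp add: field_simps)
  have "v x - e \<le> v t" if t: "t \<in> {0..1}" "\<bar>t - x\<bar> < A u1 / u1 - x" for t
  proof -
    have "u_star p t \<le> u1"
    proof (rule ccontr)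
      assume "\<not> ?thesis"
      then have "A u1 / u1 \<le> A (u_star p t) / u_star p t"
        using u1 u0 u_star_range[of t] t by (intro A_slope_mono) auto
      also have "\<dots> \<le> t"
        using A_u_star[of t] t u_star_range[of t] by (auto simp: divide_le_eq)
      finally show False using t by auto
    qed
    then have "b u1 \<le> v t"
      unfolding v_def using u_star_range[of t] t u1 by (intro b_antimono) auto
    then show ?thesis using b1 by simp
  qed
  then show ?thesis using pos by blast
qed

section \<open>Integrating out the labels\<close>

abbreviation labelings :: "nat \<Rightarrow> (nat \<Rightarrow> bool) set" where
  "labelings n \<equiv> PiE {..<n} (\<lambda>_. UNIV)"

lemma finite_labelings: "finite (labelings n)"
  by (intro finite_PiE) auto

lemma bools_eq: "bools n = count_space (labelings n)"
  by (rule count_space_PiM_finite) auto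

abbreviation Q :: "nat \<Rightarrow> (nat \<Rightarrow> 'a) measure" where
  "Q n \<equiv> PiM {..<n} (\<lambda>_. P)"

definition weight :: "((nat \<Rightarrow> 'a) \<Rightarrow> (nat \<Rightarrow> bool) measure) \<Rightarrow> (nat \<Rightarrow> 'a) \<Rightarrow> (nat \<Rightarrow> bool) \<Rightarrow> real" where
  "weight K x d = measure (K x) {d}"

text \<open>The conditional expectation of \<open>c\<close> applied to the label, given the
  observation \<open>y\<close>.\<close>

definition posterior :: "(bool \<Rightarrow> ennreal) \<Rightarrow> 'a \<Rightarrow> ennreal" where
  "posterior c y = c True * ennreal (1 - W y) + c False * ennreal (W y)"

lemma prob_space_Q: "prob_space (Q n)"
  by (intro prob_space_PiM P.prob_space_axioms)

lemma sets_Q[measurable_cong]: "sets (Q n) = sets (PiM {..<n} (\<lambda>_. M))"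
  by (intro sets_PiM_cong) auto

lemma space_Q: "space (Q n) = space (PiM {..<n} (\<lambda>_. M))"
  using sets_Q by (rule sets_eq_imp_space_eq)

lemma W_component: "x \<in> space (Q n) \<Longrightarrow> i < n \<Longrightarrow> W (x i) \<in> {0..1}"
  by (intro W_range) (auto simp: space_Q space_PiM)

text \<open>Density of one observation under label \<open>t\<close> relative to \<open>P\<close>.
  With a probability measure as reference, product measures and Fubini apply although
  \<open>M\<close> may fail to be sigma-finite.\<close>

definition likelihood :: "bool \<Rightarrow> 'a \<Rightarrow> ennreal" where
  "likelihood t y = ennreal (if t then (1 - W y) / \<pi>1 else W y / \<pi>0)"

lemma likelihood_measurable[measurable]: "likelihood t \<in> borel_measurable M"
  unfolding likelihood_def by measurable

lemma density_likelihood: "density P (likelihood t) = density M (if t then f1 else f0)"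
  by (cases t) (auto simp: likelihood_def[abs_def] density_f0 density_f1)

lemma observations_eq: "observations n \<theta> = density (Q n) (\<lambda>x. \<Prod>j<n. likelihood (\<theta> j) (x j))"
proof -
  define N where "N j = density M (if \<theta> j then f1 else f0)" for j
  have N: "prob_space (N j)" for j
    using f0_prob f1_prob by (simp add: N_def)
  then interpret N: product_sigma_finite N
    by (auto simp: product_sigma_finite_def intro: prob_space_imp_sigma_finite)
  interpret PP: product_sigma_finite "\<lambda>_::nat. P"
    by (auto simp: product_sigma_finite_def P.sigma_finite_measure_axioms)
  have "density (Q n) (\<lambda>x. \<Prod>j<n. likelihood (\<theta> j) (x j)) = PiM {..<n} N"
  proof (rule N.PiM_eqI)
    show "sets (density (Q n) (\<lambda>x. \<Prod>j<n. likelihood (\<theta> j) (x j))) = sets (PiM {..<n} N)"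
      by (simp, intro sets_PiM_cong) (auto simp: N_def)
    fix B assume B: "\<And>i. i \<in> {..<n} \<Longrightarrow> B i \<in> sets (N i)"
    then have B': "\<And>i. i < n \<Longrightarrow> B i \<in> sets M" by (auto simp: N_def)
    then have PB: "Pi\<^sub>E {..<n} B \<in> sets (Q n)" by (intro sets_PiM_I_finite) auto
    have "emeasure (density (Q n) (\<lambda>x. \<Prod>j<n. likelihood (\<theta> j) (x j))) (Pi\<^sub>E {..<n} B)
        = (\<integral>\<^sup>+x. (\<Prod>j<n. likelihood (\<theta> j) (x j)) * indicator (Pi\<^sub>E {..<n} B) x \<partial>Q n)"
      by (rule emeasure_density[OF _ PB]) measurable
    also have "\<dots> = (\<integral>\<^sup>+x. (\<Prod>j<n. likelihood (\<theta> j) (x j) * indicator (B j) (x j)) \<partial>Q n)"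
    proof (intro nn_integral_cong)
      fix x assume "x \<in> space (Q n)"
      then have "indicator (Pi\<^sub>E {..<n} B) x = (\<Prod>j<n. indicator (B j) (x j) :: ennreal)"
        by (auto simp: indicator_def space_PiM PiE_iff prod_zero_iff intro!: prod.neutral[symmetric])
      then show "(\<Prod>j<n. likelihood (\<theta> j) (x j)) * indicator (Pi\<^sub>E {..<n} B) x
          = (\<Prod>j<n. likelihood (\<theta> j) (x j) * indicator (B j) (x j))"
        by (simp add: prod.distrib)
    qed
    also have "\<dots> = (\<Prod>j<n. \<integral>\<^sup>+y. likelihood (\<theta> j) y * indicator (B j) y \<partial>P)"
      using B' by (intro PP.product_nn_integral_prod) auto
    also have "\<dots> = (\<Prod>j<n. emeasure (N j) (B j))"
      using B' by (intro prod.cong refl) (simp add: N_def flip: density_likelihood, simp add: emeasure_density)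
    finally show "emeasure (density (Q n) (\<lambda>x. \<Prod>j<n. likelihood (\<theta> j) (x j))) (Pi\<^sub>E {..<n} B)
        = (\<Prod>j<n. emeasure (N j) (B j))" .
  qed simp
  then show ?thesis by (simp add: observations_def N_def[abs_def])
qed

text \<open>Fubini moves the labels inside, where a product function of them factorizes. In each
  factor the prior weight cancels the denominator of the likelihood and leaves the posterior
  probabilities \<open>1 - W\<close> and \<open>W\<close>.\<close>

lemma bayes:
  assumes [measurable]: "h \<in> borel_measurable (PiM {..<n} (\<lambda>_. M))"
  shows "(\<integral>\<^sup>+\<theta>. (\<Prod>j<n. c j (\<theta> j)) * (\<integral>\<^sup>+x. h x \<partial>observations n \<theta>) \<partial>labels n)
    = (\<integral>\<^sup>+x. (\<Prod>j<n. posterior (c j) (x j)) * h x \<partial>Q n)"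
proof -
  interpret L: prob_space "labels n" by (rule prob_space_labels)
  interpret Q: prob_space "Q n" by (rule prob_space_Q)
  interpret LQ: pair_sigma_finite "Q n" "labels n" ..
  interpret B: product_sigma_finite "\<lambda>_::nat. measure_pmf (bernoulli_pmf \<pi>1)"
    by (auto simp: product_sigma_finite_def intro: prob_space_imp_sigma_finite prob_space_measure_pmf)
  have [measurable]: "(\<lambda>z. c j (fst z j)) \<in> borel_measurable (labels n \<Otimes>\<^sub>M Q n)" if "j \<in> {..<n}" for j
    using that by measurable
  have m: "(\<lambda>(x, \<theta>). (\<Prod>j<n. c j (\<theta> j)) * ((\<Prod>j<n. likelihood (\<theta> j) (x j)) * h x))
      \<in> borel_measurable (Q n \<Otimes>\<^sub>M labels n)"
    unfolding likelihood_def by measurable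
  have "(\<integral>\<^sup>+\<theta>. (\<Prod>j<n. c j (\<theta> j)) * (\<integral>\<^sup>+x. h x \<partial>observations n \<theta>) \<partial>labels n)
    = (\<integral>\<^sup>+\<theta>. \<integral>\<^sup>+x. (\<Prod>j<n. c j (\<theta> j)) * ((\<Prod>j<n. likelihood (\<theta> j) (x j)) * h x) \<partial>Q n \<partial>labels n)"
    unfolding observations_eq
    by (intro nn_integral_cong, subst nn_integral_density, measurable) (subst nn_integral_cmult, auto)
  also have "\<dots> = (\<integral>\<^sup>+x. \<integral>\<^sup>+\<theta>. (\<Prod>j<n. c j (\<theta> j)) * ((\<Prod>j<n. likelihood (\<theta> j) (x j)) * h x) \<partial>labels n \<partial>Q n)"
    using LQ.Fubini[OF m] by simp
  also have "\<dots> = (\<integral>\<^sup>+x. (\<Prod>j<n. posterior (c j) (x j)) * h x \<partial>Q n)"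
  proof (intro nn_integral_cong)
    fix x assume x: "x \<in> space (Q n)"
    have "(\<integral>\<^sup>+\<theta>. (\<Prod>j<n. c j (\<theta> j)) * ((\<Prod>j<n. likelihood (\<theta> j) (x j)) * h x) \<partial>labels n)
        = (\<integral>\<^sup>+\<theta>. (\<Prod>j<n. c j (\<theta> j) * likelihood (\<theta> j) (x j)) * h x \<partial>labels n)"
      by (simp add: prod.distrib mult.assoc)
    also have "\<dots> = (\<integral>\<^sup>+\<theta>. (\<Prod>j<n. c j (\<theta> j) * likelihood (\<theta> j) (x j)) \<partial>labels n) * h x"
      by (rule nn_integral_multc) measurable
    also have "(\<integral>\<^sup>+\<theta>. (\<Prod>j<n. c j (\<theta> j) * likelihood (\<theta> j) (x j)) \<partial>labels n)
        = (\<Prod>j<n. \<integral>\<^sup>+t. c j t * likelihood t (x j) \<partial>bernoulli_pmf \<pi>1)"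
      unfolding labels_def
      by (rule B.product_nn_integral_prod[where f = "\<lambda>j t. c j t * likelihood t (x j)"]) auto
    also have "\<dots> = (\<Prod>j<n. posterior (c j) (x j))"
    proof (intro prod.cong refl)
      fix j assume "j \<in> {..<n}"
      have "ennreal (1 - \<pi>1) = ennreal \<pi>0" using pi_sum by (intro arg_cong[where f = ennreal]) simp
      moreover have "ennreal (w / q) * ennreal q = ennreal w" if "0 < q" for w q :: real
        using that by (simp flip: ennreal_mult'')
      ultimately show "(\<integral>\<^sup>+t. c j t * likelihood t (x j) \<partial>bernoulli_pmf \<pi>1) = posterior (c j) (x j)"
        using pi0 pi1 by (simp add: likelihood_def posterior_def mult.assoc)
    qed
    finally show "(\<integral>\<^sup>+\<theta>. (\<Prod>j<n. c j (\<theta> j)) * ((\<Prod>j<n. likelihood (\<theta> j) (x j)) * h x) \<partial>labels n)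
        = (\<Prod>j<n. posterior (c j) (x j)) * h x" .
  qed
  finally show ?thesis .
qed

text \<open>Every coordinate except \<open>i\<close> carries the constant 1, whose posterior mean is
  1 since \<open>W\<close> lies between 0 and 1.\<close>

lemma bayes_single:
  assumes [measurable]: "h \<in> borel_measurable (PiM {..<n} (\<lambda>_. M))" and i: "i < n"
  shows "(\<integral>\<^sup>+\<theta>. c (\<theta> i) * (\<integral>\<^sup>+x. h x \<partial>observations n \<theta>) \<partial>labels n)
    = (\<integral>\<^sup>+x. posterior c (x i) * h x \<partial>Q n)"
proof -
  define C where "C j t = (if j = i then c t else 1)" for j t
  have c: "c (\<theta> i) = (\<Prod>j<n. C j (\<theta> j))" for \<theta>
    using i by (simp add: C_def prod.delta)
  have p: "posterior c (x i) = (\<Prod>j<n. posterior (C j) (x j))" if x: "x \<in> space (Q n)" for x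
  proof -
    have "posterior (C j) (x j) = (if j = i then posterior c (x i) else 1)" if "j < n" for j
      using W_component[OF x that] by (auto simp: C_def posterior_def simp flip: ennreal_plus)
    then have "(\<Prod>j<n. posterior (C j) (x j)) = (\<Prod>j<n. if j = i then posterior c (x i) else 1)"
      by (intro prod.cong) auto
    then show ?thesis using i by (simp add: prod.delta)
  qed
  show ?thesis
    unfolding c bayes[OF assms(1), of C] by (intro nn_integral_cong) (simp add: p)
qed

text \<open>Each bind can be unfolded only once the remaining kernel is known to be measurable; this
  is where a rule being a Markov kernel enters.\<close>

lemma nn_integral_joint:
  assumes K: "K \<in> decision_rules n"
    and h[measurable]: "h \<in> borel_measurable (bools n \<Otimes>\<^sub>M PiM {..<n} (\<lambda>_. M) \<Otimes>\<^sub>M bools n)"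
  shows "(\<integral>\<^sup>+z. h z \<partial>joint n K)
    = (\<integral>\<^sup>+\<theta>. \<integral>\<^sup>+x. \<integral>\<^sup>+\<delta>. h (\<theta>, x, \<delta>) \<partial>K x \<partial>observations n \<theta> \<partial>labels n)"
proof -
  let ?X = "PiM {..<n} (\<lambda>_. M)"
  let ?J = "bools n \<Otimes>\<^sub>M ?X \<Otimes>\<^sub>M bools n"
  note observations_kernel[measurable]
  have [measurable]: "K \<in> ?X \<rightarrow>\<^sub>M prob_algebra (bools n)"
    using K by (simp add: decision_rules_def)
  have 1: "(\<lambda>\<theta>. observations n \<theta> \<bind> (\<lambda>x. K x \<bind> (\<lambda>\<delta>. return ?J (\<theta>, x, \<delta>)))) \<in> bools n \<rightarrow>\<^sub>M prob_algebra ?J"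
    by measurable
  have "(\<integral>\<^sup>+z. h z \<partial>joint n K) = (\<integral>\<^sup>+\<theta>. \<integral>\<^sup>+z. h z \<partial>(observations n \<theta> \<bind> (\<lambda>x. K x \<bind> (\<lambda>\<delta>. return ?J (\<theta>, x, \<delta>)))) \<partial>labels n)"
    unfolding joint_def using measurable_prob_algebraD[OF 1]
    by (intro nn_integral_bind[where B = ?J] h) (simp cong: measurable_cong_sets add: sets_labels)
  also have "\<dots> = (\<integral>\<^sup>+\<theta>. \<integral>\<^sup>+x. \<integral>\<^sup>+\<delta>. h (\<theta>, x, \<delta>) \<partial>K x \<partial>observations n \<theta> \<partial>labels n)"
  proof (intro nn_integral_cong)
    fix \<theta> assume "\<theta> \<in> space (labels n)"
    then have \<theta>[measurable]: "\<theta> \<in> space (bools n)"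
      using sets_eq_imp_space_eq[OF sets_labels] by simp
    have so: "sets (observations n \<theta>) = sets ?X"
      using measurable_space[OF observations_kernel \<theta>] by (simp add: space_prob_algebra)
    have 2: "(\<lambda>x. K x \<bind> (\<lambda>\<delta>. return ?J (\<theta>, x, \<delta>))) \<in> ?X \<rightarrow>\<^sub>M prob_algebra ?J"
      by measurable
    have "(\<integral>\<^sup>+z. h z \<partial>(observations n \<theta> \<bind> (\<lambda>x. K x \<bind> (\<lambda>\<delta>. return ?J (\<theta>, x, \<delta>)))))
       = (\<integral>\<^sup>+x. \<integral>\<^sup>+z. h z \<partial>(K x \<bind> (\<lambda>\<delta>. return ?J (\<theta>, x, \<delta>))) \<partial>observations n \<theta>)"
      using measurable_prob_algebraD[OF 2]
      by (intro nn_integral_bind[where B = ?J] h) (simp cong: measurable_cong_sets add: so)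
    also have "\<dots> = (\<integral>\<^sup>+x. \<integral>\<^sup>+\<delta>. h (\<theta>, x, \<delta>) \<partial>K x \<partial>observations n \<theta>)"
    proof (intro nn_integral_cong)
      fix x assume "x \<in> space (observations n \<theta>)"
      then have x[measurable]: "x \<in> space ?X"
        using sets_eq_imp_space_eq[OF so] by simp
      have sK: "sets (K x) = sets (bools n)"
        using measurable_space[OF _ x, of K "prob_algebra (bools n)"] by (simp add: space_prob_algebra)
      have 3: "(\<lambda>\<delta>. return ?J (\<theta>, x, \<delta>)) \<in> bools n \<rightarrow>\<^sub>M prob_algebra ?J"
        by measurable
      have "(\<integral>\<^sup>+z. h z \<partial>(K x \<bind> (\<lambda>\<delta>. return ?J (\<theta>, x, \<delta>)))) = (\<integral>\<^sup>+\<delta>. \<integral>\<^sup>+z. h z \<partial>return ?J (\<theta>, x, \<delta>) \<partial>K x)"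
        using measurable_prob_algebraD[OF 3]
        by (intro nn_integral_bind[where B = ?J] h) (simp cong: measurable_cong_sets add: sK)
      also have "\<dots> = (\<integral>\<^sup>+\<delta>. h (\<theta>, x, \<delta>) \<partial>K x)"
        using sets_eq_imp_space_eq[OF sK] \<theta> x
        by (intro nn_integral_cong nn_integral_return h) (auto simp: space_pair_measure)
      finally show "(\<integral>\<^sup>+z. h z \<partial>(K x \<bind> (\<lambda>\<delta>. return ?J (\<theta>, x, \<delta>)))) = (\<integral>\<^sup>+\<delta>. h (\<theta>, x, \<delta>) \<partial>K x)" .
    qed
    finally show "(\<integral>\<^sup>+z. h z \<partial>(observations n \<theta> \<bind> (\<lambda>x. K x \<bind> (\<lambda>\<delta>. return ?J (\<theta>, x, \<delta>)))))
       = (\<integral>\<^sup>+x. \<integral>\<^sup>+\<delta>. h (\<theta>, x, \<delta>) \<partial>K x \<partial>observations n \<theta>)" .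
  qed
  finally show ?thesis .
qed

section \<open>Rules as finite distributions over decision vectors\<close>

lemma rule_prob_space:
  assumes K: "K \<in> decision_rules n" and x: "x \<in> space (Q n)"
  shows "prob_space (K x)" and "sets (K x) = sets (bools n)"
  using measurable_space[of K "PiM {..<n} (\<lambda>_. M)" "prob_algebra (bools n)" x] assms
  by (auto simp: decision_rules_def space_Q space_prob_algebra)

lemma nn_integral_rule:
  assumes K: "K \<in> decision_rules n" and x: "x \<in> space (Q n)" and g: "\<And>d. d \<in> labelings n \<Longrightarrow> 0 \<le> g d"
  shows "(\<integral>\<^sup>+\<delta>. ennreal (g \<delta>) \<partial>K x) = ennreal (\<Sum>d\<in>labelings n. weight K x d * g d)"
proof -
  interpret K: prob_space "K x" using rule_prob_space[OF K x] by simp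
  have s: "sets (K x) = Pow (labelings n)" using rule_prob_space(2)[OF K x] by (simp add: bools_eq)
  have sp: "space (K x) = labelings n" using sets_eq_imp_space_eq[OF rule_prob_space(2)[OF K x]] by (simp add: bools_eq)
  have "(\<integral>\<^sup>+\<delta>. ennreal (g \<delta>) \<partial>K x) = (\<integral>\<^sup>+\<delta>. (\<Sum>d\<in>labelings n. ennreal (g d) * indicator {d} \<delta>) \<partial>K x)"
  proof (intro nn_integral_cong)
    fix \<delta> assume "\<delta> \<in> space (K x)"
    then show "ennreal (g \<delta>) = (\<Sum>d\<in>labelings n. ennreal (g d) * indicator {d} \<delta>)"
      using finite_labelings[of n] unfolding sp
      by (subst sum.remove[of _ \<delta>]) (auto intro!: sum.neutral)
  qed
  also have "\<dots> = (\<Sum>d\<in>labelings n. ennreal (g d) * emeasure (K x) {d})"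
  proof -
    have [measurable]: "{d} \<in> sets (K x)" if "d \<in> labelings n" for d
      using that unfolding s by blast
    have "(\<integral>\<^sup>+\<delta>. (\<Sum>d\<in>labelings n. ennreal (g d) * indicator {d} \<delta>) \<partial>K x)
        = (\<Sum>d\<in>labelings n. \<integral>\<^sup>+\<delta>. ennreal (g d) * indicator {d} \<delta> \<partial>K x)"
      by (rule nn_integral_sum) measurable
    also have "\<dots> = (\<Sum>d\<in>labelings n. ennreal (g d) * emeasure (K x) {d})"
      by (intro sum.cong refl nn_integral_cmult_indicator) measurable
    finally show ?thesis .
  qed
  also have "\<dots> = (\<Sum>d\<in>labelings n. ennreal (weight K x d * g d))"
    using g by (intro sum.cong refl) (simp add: weight_def K.emeasure_eq_measure ennreal_mult'' mult.commute)
  also have "\<dots> = ennreal (\<Sum>d\<in>labelings n. weight K x d * g d)"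
    using g by (intro sum_ennreal) (auto simp: weight_def)
  finally show ?thesis .
qed

lemma weight_nonneg: "0 \<le> weight K x d"
  by (simp add: weight_def)

lemma sum_weight:
  assumes K: "K \<in> decision_rules n" and x: "x \<in> space (Q n)"
  shows "(\<Sum>d\<in>labelings n. weight K x d) = 1"
proof -
  interpret K: prob_space "K x" using rule_prob_space[OF K x] by simp
  have "ennreal (\<Sum>d\<in>labelings n. weight K x d) = 1"
    using nn_integral_rule[OF K x, of "\<lambda>_. 1"] by (simp add: K.emeasure_space_1)
  then show ?thesis by simp
qed

lemma weight_measurable[measurable]:
  assumes K: "K \<in> decision_rules n" and d: "d \<in> labelings n"
  shows "(\<lambda>x. weight K x d) \<in> borel_measurable (Q n)"
proof -
  have "K \<in> Q n \<rightarrow>\<^sub>M subprob_algebra (bools n)"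
    using K measurable_prob_algebraD unfolding decision_rules_def measurable_cong_sets[OF sets_Q refl] by blast
  moreover have "{d} \<in> sets (bools n)" using d by (simp add: bools_eq)
  ultimately show ?thesis unfolding weight_def
    by (rule measurable_compose[OF _ measurable_measure_subprob_algebra])
qed

text \<open>The decision depends on the labels only through the observations, so the label factor
  leaves both inner integrals and what remains is a function of \<open>x\<close> for
  \<open>bayes_single\<close>.\<close>

lemma joint_nn_integral_single:
  assumes K: "K \<in> decision_rules n" and i: "i < n" and g: "\<And>d. d \<in> labelings n \<Longrightarrow> 0 \<le> g d"
  shows "(\<integral>\<^sup>+(\<theta>, x, \<delta>). c (\<theta> i) * ennreal (g \<delta>) \<partial>joint n K)
    = (\<integral>\<^sup>+x. posterior c (x i) * ennreal (\<Sum>d\<in>labelings n. weight K x d * g d) \<partial>Q n)"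
proof -
  let ?X = "PiM {..<n} (\<lambda>_. M)"
  have [measurable]: "g \<in> borel_measurable (bools n)"
    by (simp add: bools_eq)
  have [measurable]: "(\<lambda>\<theta>. c (\<theta> i)) \<in> borel_measurable (bools n)"
    by (simp add: bools_eq)
  have [measurable]: "K \<in> ?X \<rightarrow>\<^sub>M subprob_algebra (bools n)"
    using K measurable_prob_algebraD by (auto simp: decision_rules_def)
  have [measurable]: "(\<lambda>x. \<integral>\<^sup>+\<delta>. ennreal (g \<delta>) \<partial>K x) \<in> borel_measurable ?X"
    by measurable
  have "(\<integral>\<^sup>+(\<theta>, x, \<delta>). c (\<theta> i) * ennreal (g \<delta>) \<partial>joint n K)
    = (\<integral>\<^sup>+\<theta>. \<integral>\<^sup>+x. \<integral>\<^sup>+\<delta>. c (\<theta> i) * ennreal (g \<delta>) \<partial>K x \<partial>observations n \<theta> \<partial>labels n)"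
    by (subst nn_integral_joint[OF K]) auto
  also have "\<dots> = (\<integral>\<^sup>+\<theta>. c (\<theta> i) * (\<integral>\<^sup>+x. \<integral>\<^sup>+\<delta>. ennreal (g \<delta>) \<partial>K x \<partial>observations n \<theta>) \<partial>labels n)"
  proof (intro nn_integral_cong)
    fix \<theta>
    have so: "sets (observations n \<theta>) = sets (Q n)"
      by (simp add: observations_eq)
    have "(\<integral>\<^sup>+x. \<integral>\<^sup>+\<delta>. c (\<theta> i) * ennreal (g \<delta>) \<partial>K x \<partial>observations n \<theta>)
       = (\<integral>\<^sup>+x. c (\<theta> i) * (\<integral>\<^sup>+\<delta>. ennreal (g \<delta>) \<partial>K x) \<partial>observations n \<theta>)"
    proof (intro nn_integral_cong nn_integral_cmult)
      fix x assume "x \<in> space (observations n \<theta>)"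
      then have "sets (K x) = sets (bools n)"
        using sets_eq_imp_space_eq[OF so] rule_prob_space[OF K] by auto
      then show "(\<lambda>\<delta>. ennreal (g \<delta>)) \<in> borel_measurable (K x)"
        by (simp cong: measurable_cong_sets)
    qed
    also have "\<dots> = c (\<theta> i) * (\<integral>\<^sup>+x. \<integral>\<^sup>+\<delta>. ennreal (g \<delta>) \<partial>K x \<partial>observations n \<theta>)"
      by (intro nn_integral_cmult) (simp add: so sets_Q cong: measurable_cong_sets)
    finally show "(\<integral>\<^sup>+x. \<integral>\<^sup>+\<delta>. c (\<theta> i) * ennreal (g \<delta>) \<partial>K x \<partial>observations n \<theta>)
       = c (\<theta> i) * (\<integral>\<^sup>+x. \<integral>\<^sup>+\<delta>. ennreal (g \<delta>) \<partial>K x \<partial>observations n \<theta>)" .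
  qed
  also have "\<dots> = (\<integral>\<^sup>+x. posterior c (x i) * (\<integral>\<^sup>+\<delta>. ennreal (g \<delta>) \<partial>K x) \<partial>Q n)"
    using i by (intro bayes_single) auto
  also have "\<dots> = (\<integral>\<^sup>+x. posterior c (x i) * ennreal (\<Sum>d\<in>labelings n. weight K x d * g d) \<partial>Q n)"
    by (intro nn_integral_cong) (simp add: nn_integral_rule[OF K _ g])
  finally show ?thesis .
qed

text \<open>All error quantities have this shape, with the random denominators absorbed into
  \<open>g\<close>. Nonnegativity lets the computation run in \<open>ennreal\<close>, where sums and
  integrals commute without integrability conditions.\<close>

lemma integral_joint:
  fixes g :: "nat \<Rightarrow> (nat \<Rightarrow> bool) \<Rightarrow> real" and c :: "bool \<Rightarrow> real"
  assumes K: "K \<in> decision_rules n" and g: "\<And>i d. i < n \<Longrightarrow> d \<in> labelings n \<Longrightarrow> 0 \<le> g i d"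
    and c: "\<And>t. 0 \<le> c t"
  shows "(LINT (\<theta>, x, \<delta>)|joint n K. (\<Sum>i<n. g i \<delta> * c (\<theta> i)))
    = (LINT x|Q n. (\<Sum>d\<in>labelings n. weight K x d * (\<Sum>i<n. g i d * (c True * (1 - W (x i)) + c False * W (x i)))))"
    (is "_ = (LINT x|Q n. ?R x)")
proof -
  let ?X = "PiM {..<n} (\<lambda>_. M)"
  let ?J = "bools n \<Otimes>\<^sub>M ?X \<Otimes>\<^sub>M bools n"
  let ?c = "\<lambda>x i. c True * (1 - W (x i)) + c False * W (x i)"
  have sJ: "sets (joint n K) = sets ?J"
    using joint_prob_algebra[OF K] by (simp add: space_prob_algebra)
  have spJ: "space (joint n K) = labelings n \<times> space ?X \<times> labelings n"
    using sets_eq_imp_space_eq[OF sJ] by (simp add: space_pair_measure space_PiM)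
  have [measurable]: "g i \<in> borel_measurable (bools n)" for i
    by (simp add: bools_eq)
  have [measurable]: "(\<lambda>\<theta>. c (\<theta> i)) \<in> borel_measurable (bools n)" for i
    by (simp add: bools_eq)
  have m: "(\<lambda>(\<theta>, x, \<delta>). g i \<delta> * c (\<theta> i)) \<in> borel_measurable (joint n K)" for i
    by (simp add: sJ cong: measurable_cong_sets)
  have "(\<integral>\<^sup>+(\<theta>, x, \<delta>). ennreal (\<Sum>i<n. g i \<delta> * c (\<theta> i)) \<partial>joint n K)
     = (\<integral>\<^sup>+z. (\<Sum>i<n. (\<lambda>(\<theta>, x, \<delta>). ennreal (c (\<theta> i)) * ennreal (g i \<delta>)) z) \<partial>joint n K)"
    using g c by (intro nn_integral_cong) (auto simp: spJ mult.commute simp flip: ennreal_mult intro!: sum_ennreal[symmetric])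
  also have "\<dots> = (\<Sum>i<n. \<integral>\<^sup>+z. (\<lambda>(\<theta>, x, \<delta>). ennreal (c (\<theta> i)) * ennreal (g i \<delta>)) z \<partial>joint n K)"
    by (intro nn_integral_sum) (simp add: sJ cong: measurable_cong_sets)
  also have "\<dots> = (\<Sum>i<n. \<integral>\<^sup>+x. posterior (\<lambda>t. ennreal (c t)) (x i) * ennreal (\<Sum>d\<in>labelings n. weight K x d * g i d) \<partial>Q n)"
    using g by (intro sum.cong refl, subst joint_nn_integral_single[OF K, of _ "g _" "\<lambda>t. ennreal (c t)", symmetric]) auto
  also have "\<dots> = (\<integral>\<^sup>+x. (\<Sum>i<n. posterior (\<lambda>t. ennreal (c t)) (x i) * ennreal (\<Sum>d\<in>labelings n. weight K x d * g i d)) \<partial>Q n)"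
    using K by (intro nn_integral_sum[symmetric]) (simp add: posterior_def)
  also have "\<dots> = (\<integral>\<^sup>+x. ennreal (?R x) \<partial>Q n)"
  proof (intro nn_integral_cong)
    fix x assume x: "x \<in> space (Q n)"
    have "posterior (\<lambda>t. ennreal (c t)) (x i) * ennreal (\<Sum>d\<in>labelings n. weight K x d * g i d)
        = ennreal (?c x i * (\<Sum>d\<in>labelings n. weight K x d * g i d))"
      and "0 \<le> ?c x i * (\<Sum>d\<in>labelings n. weight K x d * g i d)" if "i < n" for i
    proof -
      have "posterior (\<lambda>t. ennreal (c t)) (x i) = ennreal (?c x i)" "0 \<le> ?c x i"
        using W_component[OF x that] c by (auto simp: posterior_def ennreal_mult)
      moreover have "0 \<le> (\<Sum>d\<in>labelings n. weight K x d * g i d)"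
        using g[OF that] by (intro sum_nonneg mult_nonneg_nonneg weight_nonneg) auto
      ultimately show "posterior (\<lambda>t. ennreal (c t)) (x i) * ennreal (\<Sum>d\<in>labelings n. weight K x d * g i d)
        = ennreal (?c x i * (\<Sum>d\<in>labelings n. weight K x d * g i d))"
        and "0 \<le> ?c x i * (\<Sum>d\<in>labelings n. weight K x d * g i d)"
        by (auto simp: ennreal_mult)
    qed
    then have "(\<Sum>i<n. posterior (\<lambda>t. ennreal (c t)) (x i) * ennreal (\<Sum>d\<in>labelings n. weight K x d * g i d))
       = ennreal (\<Sum>i<n. ?c x i * (\<Sum>d\<in>labelings n. weight K x d * g i d))"
      by (subst sum_ennreal[symmetric]) auto
    also have "(\<Sum>i<n. ?c x i * (\<Sum>d\<in>labelings n. weight K x d * g i d)) = ?R x"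
    proof -
      have "(\<Sum>i<n. ?c x i * (\<Sum>d\<in>labelings n. weight K x d * g i d)) = (\<Sum>i<n. \<Sum>d\<in>labelings n. weight K x d * (g i d * ?c x i))"
        unfolding sum_distrib_left by (intro sum.cong refl) (simp only: mult_ac)
      also have "\<dots> = (\<Sum>d\<in>labelings n. \<Sum>i<n. weight K x d * (g i d * ?c x i))"
        by (rule sum.swap)
      finally show ?thesis by (simp only: sum_distrib_left)
    qed
    finally show "(\<Sum>i<n. posterior (\<lambda>t. ennreal (c t)) (x i) * ennreal (\<Sum>d\<in>labelings n. weight K x d * g i d)) = ennreal (?R x)" .
  qed
  finally have nn: "(\<integral>\<^sup>+(\<theta>, x, \<delta>). ennreal (\<Sum>i<n. g i \<delta> * c (\<theta> i)) \<partial>joint n K) = (\<integral>\<^sup>+x. ennreal (?R x) \<partial>Q n)" .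
  have "(LINT (\<theta>, x, \<delta>)|joint n K. (\<Sum>i<n. g i \<delta> * c (\<theta> i)))
     = enn2real (\<integral>\<^sup>+z. ennreal ((\<lambda>(\<theta>, x, \<delta>). (\<Sum>i<n. g i \<delta> * c (\<theta> i))) z) \<partial>joint n K)"
    using g c by (intro integral_eq_nn_integral)
      (auto simp: spJ sJ intro!: AE_I2 sum_nonneg mult_nonneg_nonneg cong: measurable_cong_sets)
  also have "\<dots> = enn2real (\<integral>\<^sup>+x. ennreal (?R x) \<partial>Q n)"
    by (simp add: case_prod_beta' flip: nn)
  also have "\<dots> = (LINT x|Q n. ?R x)"
  proof (rule integral_eq_nn_integral[symmetric])
    show "?R \<in> borel_measurable (Q n)" using K by measurable
    show "AE x in Q n. 0 \<le> ?R x"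
      using g c W_component by (intro AE_I2 sum_nonneg mult_nonneg_nonneg weight_nonneg add_nonneg_nonneg) auto
  qed
  finally show ?thesis .
qed

section \<open>Error rates as posterior expectations\<close>

definition expect :: "nat \<Rightarrow> ((nat \<Rightarrow> 'a) \<Rightarrow> (nat \<Rightarrow> bool) measure) \<Rightarrow> ((nat \<Rightarrow> 'a) \<Rightarrow> (nat \<Rightarrow> bool) \<Rightarrow> real) \<Rightarrow> real" where
  "expect n K H = (LINT x|Q n. (\<Sum>d\<in>labelings n. weight K x d * H x d))"

definition ones :: "nat \<Rightarrow> (nat \<Rightarrow> bool) \<Rightarrow> real" where
  "ones n d = (\<Sum>i<n. of_bool (d i))"

definition zeros :: "nat \<Rightarrow> (nat \<Rightarrow> bool) \<Rightarrow> real" where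
  "zeros n d = (\<Sum>i<n. 1 - of_bool (d i))"

lemma zeros_eq: "zeros n d = n - ones n d"
  by (simp add: zeros_def ones_def sum_subtractf)

lemma ones_range: "0 \<le> ones n d" "ones n d \<le> n"
  unfolding ones_def using sum_mono[of "{..<n}" "\<lambda>i. of_bool (d i)" "\<lambda>_. 1::real"] by (auto intro: sum_nonneg)

lemma weight_le_1:
  assumes "K \<in> decision_rules n" "x \<in> space (Q n)" shows "weight K x d \<le> 1"
  using prob_space.prob_le_1[OF rule_prob_space(1)[OF assms]] by (simp add: weight_def)

lemma integrable_weight:
  assumes K: "K \<in> decision_rules n" and d: "d \<in> labelings n" and h: "integrable (Q n) h"
  shows "integrable (Q n) (\<lambda>x. weight K x d * (h x :: real))"
  using h
proof (rule Bochner_Integration.integrable_bound)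
  show "(\<lambda>x. weight K x d * h x) \<in> borel_measurable (Q n)"
    using K d borel_measurable_integrable[OF h] by measurable
  show "AE x in Q n. norm (weight K x d * h x) \<le> norm (h x)"
    using weight_le_1[OF K] weight_nonneg[of K]
    by (intro AE_I2) (auto simp: abs_mult intro!: mult_left_le_one_le)
qed

lemma integrable_expect:
  assumes "K \<in> decision_rules n" and "\<And>d. d \<in> labelings n \<Longrightarrow> integrable (Q n) (\<lambda>x. H x d)"
  shows "integrable (Q n) (\<lambda>x. \<Sum>d\<in>labelings n. weight K x d * H x d)"
  using assms by (intro Bochner_Integration.integrable_sum integrable_weight)

lemma expect_sum:
  assumes "K \<in> decision_rules n" and "\<And>d. d \<in> labelings n \<Longrightarrow> integrable (Q n) (\<lambda>x. H x d)"
  shows "expect n K H = (\<Sum>d\<in>labelings n. LINT x|Q n. weight K x d * H x d)"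
  unfolding expect_def using assms by (intro Bochner_Integration.integral_sum integrable_weight)

lemma expect_mono:
  assumes K: "K \<in> decision_rules n"
    and H: "\<And>d. d \<in> labelings n \<Longrightarrow> integrable (Q n) (\<lambda>x. H x d)"
    and H': "\<And>d. d \<in> labelings n \<Longrightarrow> integrable (Q n) (\<lambda>x. H' x d)"
    and le: "\<And>x d. x \<in> space (Q n) \<Longrightarrow> d \<in> labelings n \<Longrightarrow> H x d \<le> H' x d"
  shows "expect n K H \<le> expect n K H'"
  unfolding expect_def
  by (intro integral_mono integrable_expect K H H' sum_mono mult_left_mono le weight_nonneg)

lemma expect_add:
  assumes K: "K \<in> decision_rules n"
    and H: "\<And>d. d \<in> labelings n \<Longrightarrow> integrable (Q n) (\<lambda>x. H x d)"
    and H': "\<And>d. d \<in> labelings n \<Longrightarrow> integrable (Q n) (\<lambda>x. H' x d)"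
  shows "expect n K (\<lambda>x d. H x d + H' x d) = expect n K H + expect n K H'"
  unfolding expect_def
  by (subst Bochner_Integration.integral_add[symmetric])
     (auto intro!: integrable_expect K H H' Bochner_Integration.integral_cong simp: sum.distrib distrib_left)

lemma expect_diff:
  assumes K: "K \<in> decision_rules n"
    and H: "\<And>d. d \<in> labelings n \<Longrightarrow> integrable (Q n) (\<lambda>x. H x d)"
    and H': "\<And>d. d \<in> labelings n \<Longrightarrow> integrable (Q n) (\<lambda>x. H' x d)"
  shows "expect n K (\<lambda>x d. H x d - H' x d) = expect n K H - expect n K H'"
  unfolding expect_def
  by (subst Bochner_Integration.integral_diff[symmetric])
     (auto intro!: integrable_expect K H H' Bochner_Integration.integral_cong simp: sum_subtractf right_diff_distrib)

lemma expect_cmult: "expect n K (\<lambda>x d. c * H x d) = c * expect n K H"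
  unfolding expect_def
  by (subst integral_mult_right_zero[symmetric])
     (auto intro!: Bochner_Integration.integral_cong simp: sum_distrib_left algebra_simps)

lemma expect_obs:
  assumes K: "K \<in> decision_rules n"
  shows "expect n K (\<lambda>x d. h x) = (LINT x|Q n. h x)"
  unfolding expect_def
  by (intro Bochner_Integration.integral_cong refl) (simp add: sum_weight[OF K] flip: sum_distrib_right)

lemma expect_const: "K \<in> decision_rules n \<Longrightarrow> expect n K (\<lambda>x d. c) = c"
  using prob_space.prob_space[OF prob_space_Q] by (simp add: expect_obs)

lemma integrable_const_Q[simp, intro]: "integrable (Q n) (\<lambda>x. c :: real)"
proof -
  interpret Q: prob_space "Q n" by (rule prob_space_Q)
  show ?thesis by simp
qed

lemma component_Q:
  assumes "i < n" and h: "integrable P h"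
  shows "integrable (Q n) (\<lambda>x. h (x i) :: real)" and "(LINT x|Q n. h (x i)) = (LINT y|P. h y)"
proof -
  have d: "distr (Q n) P (\<lambda>x. x i) = P"
    using assms by (intro distr_PiM_component P.prob_space_axioms) auto
  have m: "(\<lambda>x. x i) \<in> Q n \<rightarrow>\<^sub>M P" using assms by (intro measurable_component_singleton) auto
  have hm: "h \<in> borel_measurable P" using h by (rule borel_measurable_integrable)
  show "integrable (Q n) (\<lambda>x. h (x i))"
    using h integrable_distr_eq[OF m hm] by (simp add: d)
  show "(LINT x|Q n. h (x i)) = (LINT y|P. h y)"
    using integral_distr[OF m hm] by (simp add: d)
qed

lemma integrable_W_component[simp, intro]: "i < n \<Longrightarrow> integrable (Q n) (\<lambda>x. W (x i))"
  by (rule component_Q(1)[OF _ integrable_W])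

text \<open>The indicator of a null label has posterior mean \<open>W\<close>, that of a non-null
  label \<open>1 - W\<close>, and the denominators depend on the decisions alone.\<close>

lemma rates_eq:
  assumes K: "K \<in> decision_rules n"
  shows "FDR n K = expect n K (\<lambda>x d. \<Sum>i<n. of_bool (d i) / max 1 (ones n d) * W (x i))"
    and "FNR n K = expect n K (\<lambda>x d. \<Sum>i<n. (1 - of_bool (d i)) / max 1 (zeros n d) * (1 - W (x i)))"
    and "mFDR n K = expect n K (\<lambda>x d. \<Sum>i<n. of_bool (d i) * W (x i)) / expect n K (\<lambda>x. ones n)"
    and "mFNR n K = expect n K (\<lambda>x d. \<Sum>i<n. (1 - of_bool (d i)) * (1 - W (x i))) / expect n K (\<lambda>x. zeros n)"
proof -
  note J = integral_joint[OF K]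
  have FDP: "FDP n \<theta> d = (\<Sum>i<n. of_bool (d i) / max 1 (ones n d) * (1 - of_bool (\<theta> i)))" for \<theta> d
    by (simp only: FDP_def ones_def sum_divide_distrib times_divide_eq_left)
  have FNP: "FNP n \<theta> d = (\<Sum>i<n. (1 - of_bool (d i)) / max 1 (zeros n d) * of_bool (\<theta> i))" for \<theta> d
    by (simp only: FNP_def zeros_def sum_divide_distrib times_divide_eq_left)
  show "FDR n K = expect n K (\<lambda>x d. \<Sum>i<n. of_bool (d i) / max 1 (ones n d) * W (x i))"
    unfolding FDR_def FDP expect_def
    by (rule trans[OF J[of "\<lambda>i d. of_bool (d i) / max 1 (ones n d)" "\<lambda>t. 1 - of_bool t"]]) auto
  show "FNR n K = expect n K (\<lambda>x d. \<Sum>i<n. (1 - of_bool (d i)) / max 1 (zeros n d) * (1 - W (x i)))"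
    unfolding FNR_def FNP expect_def
    by (rule trans[OF J[of "\<lambda>i d. (1 - of_bool (d i)) / max 1 (zeros n d)" "\<lambda>t. of_bool t"]]) auto
  have "(LINT (\<theta>, x, \<delta>)|joint n K. (\<Sum>i<n. of_bool (\<delta> i) * (1 - of_bool (\<theta> i)))) = expect n K (\<lambda>x d. \<Sum>i<n. of_bool (d i) * W (x i))"
    unfolding expect_def by (rule trans[OF J[of "\<lambda>i d. of_bool (d i)" "\<lambda>t. 1 - of_bool t"]]) auto
  \<comment> \<open>The constant label function 1 brings a plain count into the shape of
    \<open>integral_joint\<close>.\<close>
  moreover have "(LINT (\<theta>, x, \<delta>)|joint n K. (\<Sum>i<n. of_bool (\<delta> i) * 1)) = expect n K (\<lambda>x. ones n)"
    unfolding expect_def ones_def by (rule trans[OF J[of "\<lambda>i d. of_bool (d i)" "\<lambda>t. 1"]]) auto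
  ultimately show "mFDR n K = expect n K (\<lambda>x d. \<Sum>i<n. of_bool (d i) * W (x i)) / expect n K (\<lambda>x. ones n)"
    unfolding mFDR_def by (simp only: mult_1_right)
  have "(LINT (\<theta>, x, \<delta>)|joint n K. (\<Sum>i<n. (1 - of_bool (\<delta> i)) * of_bool (\<theta> i))) = expect n K (\<lambda>x d. \<Sum>i<n. (1 - of_bool (d i)) * (1 - W (x i)))"
    unfolding expect_def by (rule trans[OF J[of "\<lambda>i d. 1 - of_bool (d i)" "\<lambda>t. of_bool t"]]) auto
  moreover have "(LINT (\<theta>, x, \<delta>)|joint n K. (\<Sum>i<n. (1 - of_bool (\<delta> i)) * 1)) = expect n K (\<lambda>x. zeros n)"
    unfolding expect_def zeros_def by (rule trans[OF J[of "\<lambda>i d. 1 - of_bool (d i)" "\<lambda>t. 1"]]) auto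
  ultimately show "mFNR n K = expect n K (\<lambda>x d. \<Sum>i<n. (1 - of_bool (d i)) * (1 - W (x i))) / expect n K (\<lambda>x. zeros n)"
    unfolding mFNR_def by (simp only: mult_1_right)
qed

section \<open>Lower bound for the marginal rates\<close>

lemma expect_nonneg:
  assumes "\<And>x d. x \<in> space (Q n) \<Longrightarrow> d \<in> labelings n \<Longrightarrow> 0 \<le> H x d"
  shows "0 \<le> expect n K H"
  unfolding expect_def using assms by (intro integral_nonneg_AE AE_I2 sum_nonneg mult_nonneg_nonneg weight_nonneg)

lemma rates_nonneg:
  assumes K: "K \<in> decision_rules n"
  shows "0 \<le> FDR n K" "0 \<le> FNR n K" "0 \<le> mFNR n K"
  using W_component unfolding rates_eq[OF K]
  by (auto intro!: expect_nonneg sum_nonneg mult_nonneg_nonneg divide_nonneg_nonneg simp: zeros_def)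

text \<open>Averaging the pointwise Legendre inequality over coordinates and samples shows that a
  rule with average rejection rate \<open>u\<close> has at least \<open>n * A u\<close> expected
  false rejections. The level constraint then makes \<open>u\<close> admissible for
  \<open>v_le_b\<close>, and false rejections and \<open>u\<close> together determine mFNR.\<close>

lemma le_mFNR:
  assumes K: "K \<in> decision_rules n" and n: "n \<ge> 1" and \<alpha>: "0 \<le> \<alpha>" and le: "mFDR n K \<le> \<alpha>"
  shows "v \<alpha> \<le> mFNR n K"
proof -
  define U where "U = expect n K (\<lambda>x. ones n)"
  define V where "V = expect n K (\<lambda>x d. \<Sum>i<n. of_bool (d i) * W (x i))"
  define u where "u = U / n"
  have "U \<le> expect n K (\<lambda>x d. n)"
    unfolding U_def using ones_range by (intro expect_mono K) auto
  then have "U \<le> n" by (simp add: expect_const[OF K])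
  moreover have "0 \<le> U" unfolding U_def using ones_range by (intro expect_nonneg) auto
  ultimately have u: "u \<in> {0..1}" and U: "0 \<le> U" "U \<le> n" using n by (auto simp: u_def)
  have "V \<le> U"
    unfolding U_def V_def ones_def using W_component
    by (intro expect_mono K sum_mono) (auto intro!: mult_left_le)
  \<comment> \<open>If \<open>U = 0\<close> then mFDR is 0 by default and carries no information,
    but \<open>V \<le> U\<close> still forces \<open>V\<close> to vanish.\<close>
  then have V\<alpha>: "V \<le> \<alpha> * U"
    using le U unfolding rates_eq[OF K] U_def[symmetric] V_def[symmetric]
    by (cases "U = 0") (auto simp: divide_le_eq)
  \<comment> \<open>The threshold dual to the average rejection rate, for which the averaged bound
    equals \<open>A u\<close> exactly.\<close>
  let ?t = "Ginv u"
  have I: "integrable (Q n) (\<lambda>x. \<Sum>i<n. max 0 (?t - W (x i)))"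
    using component_Q(1)[OF _ integrable_pos_part] by (intro Bochner_Integration.integrable_sum) auto
  have I': "integrable (Q n) (\<lambda>x. \<Sum>i<n. of_bool (d i) * W (x i))" for d
    by (intro Bochner_Integration.integrable_sum integrable_mult_right integrable_W_component) auto
  have "expect n K (\<lambda>x d. ?t * ones n d - (\<Sum>i<n. max 0 (?t - W (x i)))) \<le> V"
    unfolding V_def
  proof (intro expect_mono K)
    fix x :: "nat \<Rightarrow> 'a" and d :: "nat \<Rightarrow> bool"
    have "?t * of_bool (d i) - max 0 (?t - W (x i)) \<le> W (x i) * of_bool (d i)" for i
      by (rule legendre_pointwise) auto
    then have "(\<Sum>i<n. ?t * of_bool (d i) - max 0 (?t - W (x i))) \<le> (\<Sum>i<n. W (x i) * of_bool (d i))"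
      by (intro sum_mono)
    then show "?t * ones n d - (\<Sum>i<n. max 0 (?t - W (x i))) \<le> (\<Sum>i<n. of_bool (d i) * W (x i))"
      by (simp add: ones_def sum_distrib_left sum_subtractf mult.commute)
  qed (intro Bochner_Integration.integrable_diff integrable_const_Q I I')+
  also have "expect n K (\<lambda>x d. ?t * ones n d - (\<Sum>i<n. max 0 (?t - W (x i)))) = ?t * U - n * \<psi> ?t"
    using component_Q[OF _ integrable_pos_part]
    by (subst expect_diff[OF K integrable_const_Q I])
       (simp add: expect_cmult expect_obs[OF K] U_def \<psi>_def Bochner_Integration.integral_sum)
  also have "\<dots> = n * A u"
  proof -
    have "n * A u = ?t * (n * u) - n * \<psi> ?t" by (simp add: A_eq[OF u] algebra_simps)
    moreover have "n * u = U" using n by (simp add: u_def)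
    ultimately show ?thesis by simp
  qed
  finally have "n * A u \<le> V" .
  then have Au: "A u \<le> V / n" using n by (simp add: field_simps)
  have "V / n \<le> \<alpha> * u" using V\<alpha> n by (simp add: u_def divide_right_mono)
  with Au have "v \<alpha> \<le> b u" using \<alpha> u by (intro v_le_b) auto
  also have "\<dots> \<le> mFNR n K"
  proof -
    have I2: "integrable (Q n) (\<lambda>x. \<Sum>i<n. W (x i))"
      by (intro Bochner_Integration.integrable_sum integrable_W_component) auto
    have z: "expect n K (\<lambda>x. zeros n) = n - U"
      unfolding zeros_eq U_def by (subst expect_diff[OF K]) (auto simp: expect_const[OF K])
    \<comment> \<open>In posterior mass, accepted non-nulls are the accepted coordinates minus all
      nulls plus the rejected nulls.\<close>
    have "expect n K (\<lambda>x d. \<Sum>i<n. (1 - of_bool (d i)) * (1 - W (x i)))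
        = expect n K (\<lambda>x d. (zeros n d - (\<Sum>i<n. W (x i))) + (\<Sum>i<n. of_bool (d i) * W (x i)))"
      by (rule arg_cong[where f = "expect n K"]) (simp add: fun_eq_iff zeros_def algebra_simps sum.distrib sum_subtractf)
    also have "\<dots> = expect n K (\<lambda>x d. zeros n d - (\<Sum>i<n. W (x i))) + V"
      unfolding V_def by (rule expect_add[OF K Bochner_Integration.integrable_diff[OF integrable_const_Q I2] I'])
    also have "expect n K (\<lambda>x d. zeros n d - (\<Sum>i<n. W (x i))) = expect n K (\<lambda>x. zeros n) - expect n K (\<lambda>x d. \<Sum>i<n. W (x i))"
      by (rule expect_diff[OF K integrable_const_Q I2])
    also have "expect n K (\<lambda>x d. \<Sum>i<n. W (x i)) = n * \<pi>0"
      by (simp add: expect_obs[OF K] component_Q(2)[OF _ integrable_W] integral_W Bochner_Integration.integral_sum)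
    finally have num: "expect n K (\<lambda>x d. \<Sum>i<n. (1 - of_bool (d i)) * (1 - W (x i))) = n - U - n * \<pi>0 + V"
      by (simp add: z)
    have "mFNR n K = (\<pi>1 - u + V / n) / (1 - u)"
    proof (cases "u = 1")
      \<comment> \<open>Nothing is accepted on average, and both quotients are 0 by the default of
        division.\<close>
      case True
      then have "n - U = 0" using n by (simp add: u_def)
      then show ?thesis using True by (simp add: rates_eq[OF K] num z)
    next
      case False
      have nu: "n * u = U" "n * (V / n) = V" using n by (auto simp: u_def)
      have pi: "\<pi>1 = 1 - \<pi>0" using pi_sum by simp
      have "n * (\<pi>1 - u + V / n) = n - U - n * \<pi>0 + V" "n * (1 - u) = n - U"
        unfolding distrib_left right_diff_distrib nu pi by simp_all
      moreover have "(n * (\<pi>1 - u + V / n)) / (n * (1 - u)) = (\<pi>1 - u + V / n) / (1 - u)"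
        using n by (intro mult_divide_mult_cancel_left) auto
      ultimately show ?thesis unfolding rates_eq[OF K] num z by simp
    qed
    then show ?thesis using Au u by (auto simp: b_def intro!: divide_right_mono)
  qed
  finally show ?thesis .
qed

section \<open>Neyman-Pearson and oracle rules\<close>

text \<open>Conditional probability of the decision \<open>t\<close> given the observation;
  \<open>mass\<close> is its mean under \<open>P\<close>.\<close>

definition lik :: "real \<Rightarrow> bool \<Rightarrow> 'a \<Rightarrow> real" where
  "lik u t y = (if t then rej u y else 1 - rej u y)"

definition mass :: "real \<Rightarrow> bool \<Rightarrow> real" where
  "mass u t = (if t then u else 1 - u)"

lemma integrable_lik: "u \<in> {0..1} \<Longrightarrow> integrable P (lik u t)"
  using integrable_rej[of u] by (cases t) (auto simp: lik_def[abs_def])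

lemma integral_lik: "u \<in> {0..1} \<Longrightarrow> (LINT y|P. lik u t y) = mass u t"
  using integrable_rej[of u] P.prob_space by (cases t) (auto simp: lik_def mass_def integral_rej)

lemma integrable_lik_W: assumes u: "u \<in> {0..1}" shows "integrable P (\<lambda>y. lik u t y * W y)"
proof (cases t)
  case True
  then show ?thesis using integrable_W_rej[OF u] by (simp add: lik_def mult.commute)
next
  case False
  have "integrable P (\<lambda>y. W y - W y * rej u y)"
    by (intro Bochner_Integration.integrable_diff integrable_W integrable_W_rej u)
  then show ?thesis using False by (simp add: lik_def algebra_simps)
qed

lemma integral_lik_W_True: "(LINT y|P. lik u True y * W y) = A u"
  by (simp add: lik_def A_def mult.commute)

text \<open>The product form survives \<open>u = 1\<close>: there the numerator
  \<open>\<pi>1 - 1 + A 1\<close> vanishes too.\<close>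

lemma integral_lik_W_False:
  assumes u: "u \<in> {0..1}" shows "(LINT y|P. lik u False y * (1 - W y)) = b u * (1 - u)"
proof -
  have "(LINT y|P. lik u False y * (1 - W y)) = (LINT y|P. lik u False y - (W y - W y * rej u y))"
    by (intro Bochner_Integration.integral_cong) (auto simp: lik_def algebra_simps)
  also have "\<dots> = (1 - u) - (\<pi>0 - A u)"
    using u integrable_W integrable_W_rej[OF u] integrable_lik[OF u]
    by (simp add: integral_lik mass_def integral_W A_def)
  also have "\<dots> = \<pi>1 - u + A u" using pi_sum by simp
  also have "\<dots> = b u * (1 - u)"
    using A_1 pi_sum by (cases "u = 1") (auto simp: b_def)
  finally show ?thesis .
qed

lemma weight_NP:
  assumes \<alpha>: "0 \<le> \<alpha>" and d: "d \<in> labelings n"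
  shows "weight (NP_rule n p \<alpha>) x d = (\<Prod>i<n. lik (u_star p \<alpha>) (d i) (x i))"
proof -
  let ?u = "u_star p \<alpha>"
  interpret F: finite_product_prob_space "\<lambda>i. measure_pmf (S p ?u (x i))" "{..<n}"
    by unfold_locales auto
  have "{d} = Pi\<^sub>E {..<n} (\<lambda>i. {d i})"
    using d by (subst PiE_singleton) (auto simp: PiE_def)
  then have "weight (NP_rule n p \<alpha>) x d = (\<Prod>i<n. measure (measure_pmf (S p ?u (x i))) {d i})"
    unfolding weight_def NP_rule_def by (simp add: F.finite_measure_PiM_emb)
  also have "\<dots> = (\<Prod>i<n. lik ?u (d i) (x i))"
    using u_star_range[OF \<alpha>]
    by (intro prod.cong refl) (auto simp: measure_pmf_single lik_def pmf_S)
  finally show ?thesis .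
qed

text \<open>With independent observations and independent coins the weight factorizes over
  coordinates, and a function of \<open>x i\<close> changes factor \<open>i\<close> only.\<close>

lemma integral_weight_NP:
  assumes \<alpha>: "0 \<le> \<alpha>" and d: "d \<in> labelings n" and i: "i < n"
    and h: "integrable P (\<lambda>y. lik (u_star p \<alpha>) (d i) y * h y)"
  shows "(LINT x|Q n. weight (NP_rule n p \<alpha>) x d * h (x i))
    = (LINT y|P. lik (u_star p \<alpha>) (d i) y * h y) * (\<Prod>j\<in>{..<n} - {i}. mass (u_star p \<alpha>) (d j))"
proof -
  let ?u = "u_star p \<alpha>"
  interpret PP: product_sigma_finite "\<lambda>_::nat. P"
    by (auto simp: product_sigma_finite_def P.sigma_finite_measure_axioms)
  define F where "F j y = (if j = i then lik ?u (d j) y * h y else lik ?u (d j) y)" for j y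
  have split: "(\<Prod>j<n. G j) = G i * (\<Prod>j\<in>{..<n} - {i}. G j)" for G :: "nat \<Rightarrow> real"
    using i by (intro prod.remove) auto
  have "(LINT x|Q n. weight (NP_rule n p \<alpha>) x d * h (x i)) = (LINT x|Q n. (\<Prod>j<n. F j (x j)))"
    by (intro Bochner_Integration.integral_cong refl)
       (simp add: weight_NP[OF \<alpha> d] split F_def)
  also have "\<dots> = (\<Prod>j<n. LINT y|P. F j y)"
  proof (intro PP.product_integral_prod)
    fix j
    show "integrable P (F j)"
      using h integrable_lik[OF u_star_range[OF \<alpha>]] by (cases "j = i") (auto simp: F_def[abs_def])
  qed simp
  also have "\<dots> = (LINT y|P. lik ?u (d i) y * h y) * (\<Prod>j\<in>{..<n} - {i}. mass ?u (d j))"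
    by (simp add: split F_def integral_lik[OF u_star_range[OF \<alpha>]])
  finally show ?thesis .
qed

lemma integral_weight_NP_1:
  assumes \<alpha>: "0 \<le> \<alpha>" and d: "d \<in> labelings n" and i: "i < n"
  shows "(LINT x|Q n. weight (NP_rule n p \<alpha>) x d)
    = mass (u_star p \<alpha>) (d i) * (\<Prod>j\<in>{..<n} - {i}. mass (u_star p \<alpha>) (d j))"
  using integral_weight_NP[OF assms, of "\<lambda>_. 1"] integral_lik[OF u_star_range[OF \<alpha>]] integrable_lik[OF u_star_range[OF \<alpha>]]
  by simp

text \<open>The pairs of observation and decision are independent over coordinates, so given the
  whole decision vector a rejected coordinate is null with probability at most \<alpha>. Hence
  \<open>g\<close> may depend on the whole vector, which admits the random denominator of
  FDP.\<close>

lemma NP_rejected: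
  assumes \<alpha>: "0 \<le> \<alpha>" and g: "\<And>d. d \<in> labelings n \<Longrightarrow> 0 \<le> g d"
  shows "expect n (NP_rule n p \<alpha>) (\<lambda>x d. \<Sum>i<n. of_bool (d i) * g d * W (x i))
    \<le> \<alpha> * expect n (NP_rule n p \<alpha>) (\<lambda>x d. \<Sum>i<n. of_bool (d i) * g d)"
proof -
  let ?K = "NP_rule n p \<alpha>"
  let ?u = "u_star p \<alpha>"
  note K = NP_rule_in_decision_rules[of n p \<alpha>]
  have u: "?u \<in> {0..1}" by (rule u_star_range[OF \<alpha>])
  have "(LINT x|Q n. weight ?K x d * (\<Sum>i<n. of_bool (d i) * g d * W (x i)))
      \<le> \<alpha> * (LINT x|Q n. weight ?K x d * (\<Sum>i<n. of_bool (d i) * g d))" if d: "d \<in> labelings n" for d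
  proof -
    have "(LINT x|Q n. weight ?K x d * (\<Sum>i<n. of_bool (d i) * g d * W (x i)))
       = (LINT x|Q n. (\<Sum>i<n. of_bool (d i) * g d * (weight ?K x d * W (x i))))"
      by (intro Bochner_Integration.integral_cong refl) (auto simp: sum_distrib_left intro!: sum.cong)
    also have "\<dots> = (\<Sum>i<n. of_bool (d i) * g d * (LINT x|Q n. weight ?K x d * W (x i)))"
      using integrable_weight[OF K d integrable_W_component] by (subst Bochner_Integration.integral_sum) auto
    also have "\<dots> \<le> (\<Sum>i<n. of_bool (d i) * g d * (\<alpha> * (LINT x|Q n. weight ?K x d)))"
    proof (intro sum_mono)
      fix i assume "i \<in> {..<n}"
      then have i: "i < n" by simp
      show "of_bool (d i) * g d * (LINT x|Q n. weight ?K x d * W (x i))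
          \<le> of_bool (d i) * g d * (\<alpha> * (LINT x|Q n. weight ?K x d))"
      proof (cases "d i")
        case True
        have "(LINT x|Q n. weight ?K x d * W (x i)) \<le> \<alpha> * (LINT x|Q n. weight ?K x d)"
          unfolding integral_weight_NP[OF \<alpha> d i integrable_lik_W[OF u]] integral_weight_NP_1[OF \<alpha> d i]
            mult.assoc[symmetric]
          using True A_u_star[OF \<alpha>] u
          by (intro mult_right_mono prod_nonneg) (auto simp: integral_lik_W_True mass_def)
        then show ?thesis using g[OF d] by (intro mult_left_mono) auto
      qed simp
    qed
    also have "\<dots> = \<alpha> * (LINT x|Q n. weight ?K x d * (\<Sum>i<n. of_bool (d i) * g d))"
      by (simp only: integral_mult_left_zero sum_distrib_right[symmetric]) (simp only: mult_ac)
    finally show ?thesis .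
  qed
  then have "(\<Sum>d\<in>labelings n. LINT x|Q n. weight ?K x d * (\<Sum>i<n. of_bool (d i) * g d * W (x i)))
     \<le> \<alpha> * (\<Sum>d\<in>labelings n. LINT x|Q n. weight ?K x d * (\<Sum>i<n. of_bool (d i) * g d))"
    unfolding sum_distrib_left by (rule sum_mono)
  moreover have "integrable (Q n) (\<lambda>x. \<Sum>i<n. of_bool (d i) * g d * W (x i))" for d
    by (intro Bochner_Integration.integrable_sum integrable_mult_right integrable_W_component) auto
  ultimately show ?thesis by (simp only: expect_sum[OF K] expect_sum[OF K integrable_const_Q])
qed

text \<open>Given the decision vector, an accepted coordinate is non-null with probability exactly
  \<open>v \<alpha>\<close>; for \<open>u_star p \<alpha> = 1\<close> acceptance has mass 0 and both
  sides vanish.\<close>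

lemma NP_accepted:
  assumes \<alpha>: "0 \<le> \<alpha>"
  shows "expect n (NP_rule n p \<alpha>) (\<lambda>x d. \<Sum>i<n. (1 - of_bool (d i)) * g d * (1 - W (x i)))
    = v \<alpha> * expect n (NP_rule n p \<alpha>) (\<lambda>x d. \<Sum>i<n. (1 - of_bool (d i)) * g d)"
proof -
  let ?K = "NP_rule n p \<alpha>"
  let ?u = "u_star p \<alpha>"
  note K = NP_rule_in_decision_rules[of n p \<alpha>]
  have u: "?u \<in> {0..1}" by (rule u_star_range[OF \<alpha>])
  have I: "integrable (Q n) (\<lambda>x. 1 - W (x i))" if "i < n" for i
    using that by (intro Bochner_Integration.integrable_diff) auto
  have "(LINT x|Q n. weight ?K x d * (\<Sum>i<n. (1 - of_bool (d i)) * g d * (1 - W (x i))))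
      = v \<alpha> * (LINT x|Q n. weight ?K x d * (\<Sum>i<n. (1 - of_bool (d i)) * g d))" if d: "d \<in> labelings n" for d
  proof -
    have "(LINT x|Q n. weight ?K x d * (\<Sum>i<n. (1 - of_bool (d i)) * g d * (1 - W (x i))))
       = (LINT x|Q n. (\<Sum>i<n. (1 - of_bool (d i)) * g d * (weight ?K x d * (1 - W (x i)))))"
      by (intro Bochner_Integration.integral_cong refl) (auto simp: sum_distrib_left intro!: sum.cong)
    also have "\<dots> = (\<Sum>i<n. (1 - of_bool (d i)) * g d * (LINT x|Q n. weight ?K x d * (1 - W (x i))))"
      using integrable_weight[OF K d I] by (subst Bochner_Integration.integral_sum) auto
    also have "\<dots> = (\<Sum>i<n. (1 - of_bool (d i)) * g d * (v \<alpha> * (LINT x|Q n. weight ?K x d)))"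
    proof (intro sum.cong refl)
      fix i assume "i \<in> {..<n}"
      then have i: "i < n" by simp
      have L: "integrable P (\<lambda>y. lik ?u (d i) y * (1 - W y))"
        using Bochner_Integration.integrable_diff[OF integrable_lik[OF u] integrable_lik_W[OF u]]
        by (simp add: right_diff_distrib)
      show "(1 - of_bool (d i)) * g d * (LINT x|Q n. weight ?K x d * (1 - W (x i)))
          = (1 - of_bool (d i)) * g d * (v \<alpha> * (LINT x|Q n. weight ?K x d))"
      proof (cases "d i")
        case False
        have "(LINT x|Q n. weight ?K x d * (1 - W (x i))) = v \<alpha> * (LINT x|Q n. weight ?K x d)"
          unfolding integral_weight_NP[OF \<alpha> d i L] integral_weight_NP_1[OF \<alpha> d i]
          using False by (simp only: integral_lik_W_False[OF u]) (simp add: mass_def v_def)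
        then show ?thesis by simp
      qed simp
    qed
    also have "\<dots> = v \<alpha> * (LINT x|Q n. weight ?K x d * (\<Sum>i<n. (1 - of_bool (d i)) * g d))"
      by (simp only: integral_mult_left_zero sum_distrib_right[symmetric]) (simp only: mult_ac)
    finally show ?thesis .
  qed
  then have "(\<Sum>d\<in>labelings n. LINT x|Q n. weight ?K x d * (\<Sum>i<n. (1 - of_bool (d i)) * g d * (1 - W (x i))))
     = v \<alpha> * (\<Sum>d\<in>labelings n. LINT x|Q n. weight ?K x d * (\<Sum>i<n. (1 - of_bool (d i)) * g d))"
    unfolding sum_distrib_left by (rule sum.cong[OF refl])
  moreover have "integrable (Q n) (\<lambda>x. \<Sum>i<n. (1 - of_bool (d i)) * g d * (1 - W (x i)))" for d
    by (intro Bochner_Integration.integrable_sum integrable_mult_right I) auto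
  ultimately show ?thesis by (simp only: expect_sum[OF K] expect_sum[OF K integrable_const_Q])
qed

section \<open>Rates of the Neyman-Pearson rules\<close>

lemma FDR_NP: assumes \<alpha>: "0 \<le> \<alpha>" shows "FDR n (NP_rule n p \<alpha>) \<le> \<alpha>"
proof -
  note K = NP_rule_in_decision_rules[of n p \<alpha>]
  have "FDR n (NP_rule n p \<alpha>) \<le> \<alpha> * expect n (NP_rule n p \<alpha>) (\<lambda>x d. \<Sum>i<n. of_bool (d i) * (1 / max 1 (ones n d)))"
    unfolding rates_eq(1)[OF K] using NP_rejected[OF \<alpha>, of n "\<lambda>d. 1 / max 1 (ones n d)"] by simp
  also have "\<dots> \<le> \<alpha> * expect n (NP_rule n p \<alpha>) (\<lambda>x d. 1)"
  proof (intro mult_left_mono expect_mono K integrable_const_Q \<alpha>)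
    fix d
    \<comment> \<open>The normalized weights of the rejected coordinates add up to 1, or to 0 if
      nothing is rejected.\<close>
    have "(\<Sum>i<n. of_bool (d i) * (1 / max 1 (ones n d))) = ones n d / max 1 (ones n d)"
      unfolding ones_def sum_distrib_right[symmetric] by (simp only: times_divide_eq_right mult_1_right)
    then show "(\<Sum>i<n. of_bool (d i) * (1 / max 1 (ones n d))) \<le> 1" by simp
  qed
  also have "\<dots> = \<alpha>" by (simp add: expect_const[OF K])
  finally show ?thesis .
qed

text \<open>The normalized weights of the accepted coordinates add up to 1 unless everything is
  rejected, an event of probability \<open>u_star p \<alpha> ^ n\<close>.\<close>

lemma FNR_NP:
  assumes \<alpha>: "0 \<le> \<alpha>" and n: "n \<ge> 1"
  shows "FNR n (NP_rule n p \<alpha>) = v \<alpha> * (1 - u_star p \<alpha> ^ n)"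
proof -
  note K = NP_rule_in_decision_rules[of n p \<alpha>]
  let ?d = "\<lambda>i\<in>{..<n}. True"
  have "FNR n (NP_rule n p \<alpha>) = v \<alpha> * expect n (NP_rule n p \<alpha>) (\<lambda>x d. \<Sum>i<n. (1 - of_bool (d i)) * (1 / max 1 (zeros n d)))"
    unfolding rates_eq(2)[OF K] using NP_accepted[OF \<alpha>, of n "\<lambda>d. 1 / max 1 (zeros n d)"] by simp
  also have "expect n (NP_rule n p \<alpha>) (\<lambda>x d. \<Sum>i<n. (1 - of_bool (d i)) * (1 / max 1 (zeros n d)))
     = expect n (NP_rule n p \<alpha>) (\<lambda>x d. 1 - of_bool (d = ?d))"
    unfolding expect_def
  proof (intro Bochner_Integration.integral_cong refl sum.cong arg_cong2[where f = "(*)"])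
    fix d assume d: "d \<in> labelings n"
    have z: "(\<Sum>i<n. (1 - of_bool (d i)) * (1 / max 1 (zeros n d))) = zeros n d / max 1 (zeros n d)"
      unfolding zeros_def by (simp only: sum_distrib_right[symmetric]) simp
    show "(\<Sum>i<n. (1 - of_bool (d i)) * (1 / max 1 (zeros n d))) = 1 - of_bool (d = ?d)"
    proof (cases "d = ?d")
      case True
      then have "zeros n d = 0" by (auto simp: zeros_def)
      then show ?thesis using True z by simp
    next
      case False
      have "\<exists>i<n. \<not> d i"
      proof (rule ccontr)
        assume "\<not> ?thesis"
        then have "d = ?d" using d by (intro extensionalityI[of _ "{..<n}"]) (auto simp: PiE_def)
        with False show False by simp
      qed
      then obtain i where i: "i < n" "\<not> d i" by blast
      have "(\<Sum>i\<in>{i}. 1 - of_bool (d i)) \<le> zeros n d"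
        unfolding zeros_def using i by (intro sum_mono2) auto
      then have "1 \<le> zeros n d" using i by simp
      then show ?thesis using False z by simp
    qed
  qed
  also have "\<dots> = 1 - expect n (NP_rule n p \<alpha>) (\<lambda>x d. of_bool (d = ?d))"
    unfolding expect_diff[OF K integrable_const_Q integrable_const_Q] expect_const[OF K] ..
  also have "expect n (NP_rule n p \<alpha>) (\<lambda>x d. of_bool (d = ?d)) = (LINT x|Q n. weight (NP_rule n p \<alpha>) x ?d)"
    unfolding expect_def
  proof (intro Bochner_Integration.integral_cong refl)
    fix x
    have "(\<Sum>d\<in>labelings n. weight (NP_rule n p \<alpha>) x d * of_bool (d = ?d))
        = weight (NP_rule n p \<alpha>) x ?d * of_bool (?d = ?d)
          + (\<Sum>d\<in>labelings n - {?d}. weight (NP_rule n p \<alpha>) x d * of_bool (d = ?d))"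
      by (rule sum.remove[OF finite_labelings]) simp
    also have "(\<Sum>d\<in>labelings n - {?d}. weight (NP_rule n p \<alpha>) x d * of_bool (d = ?d)) = 0"
      by (rule sum.neutral) simp
    finally show "(\<Sum>d\<in>labelings n. weight (NP_rule n p \<alpha>) x d * of_bool (d = ?d)) = weight (NP_rule n p \<alpha>) x ?d"
      by (simp only: simp_thms of_bool_eq mult_1_right add_0_right)
  qed
  \<comment> \<open>The factorization singles out a coordinate; coordinate 0 exists because
    \<open>n \<ge> 1\<close>.\<close>
  also have "\<dots> = mass (u_star p \<alpha>) (?d 0) * (\<Prod>j\<in>{..<n} - {0}. mass (u_star p \<alpha>) (?d j))"
    using n by (intro integral_weight_NP_1[OF \<alpha>]) auto
  also have "\<dots> = (\<Prod>j<n. mass (u_star p \<alpha>) (?d j))"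
    using n by (intro prod.remove[symmetric]) auto
  also have "\<dots> = u_star p \<alpha> ^ n" by (simp add: mass_def)
  finally show ?thesis .
qed

lemma FNR_NP_tendsto:
  assumes \<alpha>: "0 \<le> \<alpha>"
  shows "(\<lambda>n. FNR n (NP_rule n p \<alpha>)) \<longlonglongrightarrow> v \<alpha>"
proof -
  have "(\<lambda>n. v \<alpha> * (1 - u_star p \<alpha> ^ n)) \<longlonglongrightarrow> v \<alpha>"
  proof (cases "u_star p \<alpha> = 1")
    case True
    then show ?thesis by (simp add: v_def b_1)
  next
    case False
    then have "(\<lambda>n. u_star p \<alpha> ^ n) \<longlonglongrightarrow> 0"
      using u_star_range[OF \<alpha>] by (intro LIMSEQ_power_zero) auto
    then have "(\<lambda>n. v \<alpha> * (1 - u_star p \<alpha> ^ n)) \<longlonglongrightarrow> v \<alpha> * (1 - 0)"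
      by (intro tendsto_mult tendsto_diff tendsto_const)
    then show ?thesis by simp
  qed
  then show ?thesis
    by (rule Lim_transform_eventually) (auto simp: eventually_sequentially FNR_NP[OF \<alpha>] intro!: exI[of _ 1])
qed

lemma mFDR_NP: assumes \<alpha>: "0 \<le> \<alpha>" shows "mFDR n (NP_rule n p \<alpha>) \<le> \<alpha>"
proof -
  note K = NP_rule_in_decision_rules[of n p \<alpha>]
  have U: "expect n (NP_rule n p \<alpha>) (\<lambda>x. ones n) \<ge> 0" using ones_range by (intro expect_nonneg) auto
  have "expect n (NP_rule n p \<alpha>) (\<lambda>x d. \<Sum>i<n. of_bool (d i) * W (x i)) \<le> \<alpha> * expect n (NP_rule n p \<alpha>) (\<lambda>x. ones n)"
    using NP_rejected[OF \<alpha>, of n "\<lambda>_. 1"] by (simp only: mult_1_right ones_def[abs_def])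
  then show ?thesis
    unfolding rates_eq(3)[OF K] using U \<alpha> by (cases "expect n (NP_rule n p \<alpha>) (\<lambda>x. ones n) = 0") (auto simp: divide_le_eq)
qed

lemma mFNR_NP: assumes \<alpha>: "0 \<le> \<alpha>" shows "mFNR n (NP_rule n p \<alpha>) \<le> v \<alpha>"
proof -
  note K = NP_rule_in_decision_rules[of n p \<alpha>]
  have "expect n (NP_rule n p \<alpha>) (\<lambda>x d. \<Sum>i<n. (1 - of_bool (d i)) * (1 - W (x i))) = v \<alpha> * expect n (NP_rule n p \<alpha>) (\<lambda>x. zeros n)"
    using NP_accepted[OF \<alpha>, of n "\<lambda>_. 1"] by (simp only: mult_1_right zeros_def[abs_def])
  then show ?thesis
    unfolding rates_eq(4)[OF K] using v_range[OF \<alpha>] by (cases "expect n (NP_rule n p \<alpha>) (\<lambda>x. zeros n) = 0") auto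
qed

lemma mFNR_star_eq:
  assumes \<alpha>: "0 \<le> \<alpha>" and n: "n \<ge> 1"
  shows "mFNR_star n \<alpha> = v \<alpha>"
proof (rule antisym)
  let ?A = "{K \<in> decision_rules n. mFDR n K \<le> \<alpha>}"
  have NP: "NP_rule n p \<alpha> \<in> ?A" using mFDR_NP[OF \<alpha>] NP_rule_in_decision_rules by auto
  have "bdd_below (mFNR n ` ?A)" using rates_nonneg(3) by (intro bdd_belowI[of _ 0]) auto
  then have "mFNR_star n \<alpha> \<le> mFNR n (NP_rule n p \<alpha>)"
    unfolding mFNR_star_def using NP by (rule cINF_lower)
  then show "mFNR_star n \<alpha> \<le> v \<alpha>" using mFNR_NP[OF \<alpha>, of n] by simp
  show "v \<alpha> \<le> mFNR_star n \<alpha>"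
    unfolding mFNR_star_def using NP by (intro cINF_greatest le_mFNR[OF _ n \<alpha>]) auto
qed

section \<open>Mixtures of two Neyman-Pearson rules\<close>

lemma weight_OR:
  assumes "\<alpha>1 \<noteq> \<alpha>2" "(\<alpha> - \<alpha>1) / (\<alpha>2 - \<alpha>1) \<in> {0..1}" and x: "x \<in> space (Q n)" and d: "d \<in> labelings n"
  shows "weight (OR_rule n p \<alpha> \<alpha>1 \<alpha>2) x d
    = (\<alpha> - \<alpha>1) / (\<alpha>2 - \<alpha>1) * weight (NP_rule n p \<alpha>2) x d + (1 - (\<alpha> - \<alpha>1) / (\<alpha>2 - \<alpha>1)) * weight (NP_rule n p \<alpha>1) x d"
proof -
  let ?w = "(\<alpha> - \<alpha>1) / (\<alpha>2 - \<alpha>1)"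
  note NP = rule_prob_space[OF NP_rule_in_decision_rules x]
  have sub: "NP_rule n p \<beta> x \<in> space (subprob_algebra (bools n))" for \<beta>
    using NP[of p \<beta>] by (auto simp: space_subprob_algebra intro: prob_space_imp_subprob_space)
  have e: "emeasure (NP_rule n p \<beta> x) {d} = ennreal (weight (NP_rule n p \<beta>) x d)" for \<beta>
    using prob_space.finite_measure[OF NP(1)] by (simp add: weight_def finite_measure.emeasure_eq_measure)
  have "emeasure (OR_rule n p \<alpha> \<alpha>1 \<alpha>2 x) {d}
     = (\<integral>\<^sup>+t. emeasure (if t then NP_rule n p \<alpha>2 x else NP_rule n p \<alpha>1 x) {d} \<partial>bernoulli_pmf ?w)"
    unfolding OR_rule_def if_not_P[OF assms(1)]
    using sub d by (intro emeasure_bind[where N = "bools n"]) (auto simp: bools_eq)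
  also have "\<dots> = ennreal (weight (NP_rule n p \<alpha>2) x d) * ennreal ?w + ennreal (weight (NP_rule n p \<alpha>1) x d) * ennreal (1 - ?w)"
    using assms(2) by (subst nn_integral_bernoulli_pmf) (auto simp: e)
  also have "\<dots> = ennreal (?w * weight (NP_rule n p \<alpha>2) x d + (1 - ?w) * weight (NP_rule n p \<alpha>1) x d)"
  proof -
    have "ennreal r * ennreal w + ennreal s * ennreal (1 - w) = ennreal (w * r + (1 - w) * s)"
      if "w \<in> {0..1}" "0 \<le> r" "0 \<le> s" for w r s :: real
      using that by (simp add: mult.commute flip: ennreal_mult ennreal_plus)
    then show ?thesis using assms(2) weight_nonneg by blast
  qed
  finally have "emeasure (OR_rule n p \<alpha> \<alpha>1 \<alpha>2 x) {d}
    = ennreal (?w * weight (NP_rule n p \<alpha>2) x d + (1 - ?w) * weight (NP_rule n p \<alpha>1) x d)" .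
  moreover have "0 \<le> ?w * weight (NP_rule n p \<alpha>2) x d + (1 - ?w) * weight (NP_rule n p \<alpha>1) x d"
    using assms(2) weight_nonneg by (intro add_nonneg_nonneg mult_nonneg_nonneg) auto
  ultimately show ?thesis
    unfolding weight_def[of "OR_rule n p \<alpha> \<alpha>1 \<alpha>2"] measure_def by (simp only: enn2real_ennreal)
qed

lemma expect_OR:
  assumes "\<alpha>1 \<noteq> \<alpha>2" "(\<alpha> - \<alpha>1) / (\<alpha>2 - \<alpha>1) \<in> {0..1}"
    and H: "\<And>d. d \<in> labelings n \<Longrightarrow> integrable (Q n) (\<lambda>x. H x d)"
  shows "expect n (OR_rule n p \<alpha> \<alpha>1 \<alpha>2) H
    = (\<alpha> - \<alpha>1) / (\<alpha>2 - \<alpha>1) * expect n (NP_rule n p \<alpha>2) H + (1 - (\<alpha> - \<alpha>1) / (\<alpha>2 - \<alpha>1)) * expect n (NP_rule n p \<alpha>1) H"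
proof -
  let ?w = "(\<alpha> - \<alpha>1) / (\<alpha>2 - \<alpha>1)"
  let ?E = "\<lambda>\<beta> x. \<Sum>d\<in>labelings n. weight (NP_rule n p \<beta>) x d * H x d"
  have I: "integrable (Q n) (?E \<beta>)" for \<beta>
    by (intro integrable_expect NP_rule_in_decision_rules H)
  have "expect n (OR_rule n p \<alpha> \<alpha>1 \<alpha>2) H = (LINT x|Q n. ?w * ?E \<alpha>2 x + (1 - ?w) * ?E \<alpha>1 x)"
    unfolding expect_def
    by (intro Bochner_Integration.integral_cong refl)
      (simp add: weight_OR[OF assms(1,2)] distrib_right sum.distrib sum_distrib_left mult.assoc del: times_divide_eq_left)
  also have "\<dots> = ?w * (LINT x|Q n. ?E \<alpha>2 x) + (1 - ?w) * (LINT x|Q n. ?E \<alpha>1 x)"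
    using I by (subst Bochner_Integration.integral_add) (auto simp del: times_divide_eq_left)
  finally show ?thesis by (simp add: expect_def)
qed

text \<open>One coin for the whole vector mixes the kernels, so every expectation is mixed with the
  same weights. The quotients mFDR and mFNR are not affine in this way.\<close>

lemma rates_OR:
  assumes "\<alpha>1 \<noteq> \<alpha>2" "(\<alpha> - \<alpha>1) / (\<alpha>2 - \<alpha>1) \<in> {0..1}"
  shows "FDR n (OR_rule n p \<alpha> \<alpha>1 \<alpha>2) = (\<alpha> - \<alpha>1) / (\<alpha>2 - \<alpha>1) * FDR n (NP_rule n p \<alpha>2)
      + (1 - (\<alpha> - \<alpha>1) / (\<alpha>2 - \<alpha>1)) * FDR n (NP_rule n p \<alpha>1)"
    and "FNR n (OR_rule n p \<alpha> \<alpha>1 \<alpha>2) = (\<alpha> - \<alpha>1) / (\<alpha>2 - \<alpha>1) * FNR n (NP_rule n p \<alpha>2)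
      + (1 - (\<alpha> - \<alpha>1) / (\<alpha>2 - \<alpha>1)) * FNR n (NP_rule n p \<alpha>1)"
proof -
  show "FDR n (OR_rule n p \<alpha> \<alpha>1 \<alpha>2) = (\<alpha> - \<alpha>1) / (\<alpha>2 - \<alpha>1) * FDR n (NP_rule n p \<alpha>2)
      + (1 - (\<alpha> - \<alpha>1) / (\<alpha>2 - \<alpha>1)) * FDR n (NP_rule n p \<alpha>1)"
    unfolding rates_eq(1)[OF OR_rule_in_decision_rules] rates_eq(1)[OF NP_rule_in_decision_rules]
    by (intro expect_OR assms Bochner_Integration.integrable_sum integrable_mult_right integrable_W_component) auto
  show "FNR n (OR_rule n p \<alpha> \<alpha>1 \<alpha>2) = (\<alpha> - \<alpha>1) / (\<alpha>2 - \<alpha>1) * FNR n (NP_rule n p \<alpha>2)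
      + (1 - (\<alpha> - \<alpha>1) / (\<alpha>2 - \<alpha>1)) * FNR n (NP_rule n p \<alpha>1)"
    unfolding rates_eq(2)[OF OR_rule_in_decision_rules] rates_eq(2)[OF NP_rule_in_decision_rules]
    by (intro expect_OR assms Bochner_Integration.integrable_sum integrable_mult_right
        Bochner_Integration.integrable_diff integrable_const_Q integrable_W_component) auto
qed

section \<open>Asymptotic lower bound\<close>

text \<open>Centred coordinates are orthogonal, so the empirical mean has variance at most
  \<open>1 / n\<close>; the first moment then follows from a weighted arithmetic-geometric mean
  inequality.\<close>

lemma mean_abs_deviation:
  assumes n: "n \<ge> 1" and h[measurable]: "h \<in> borel_measurable M"
    and h1: "\<And>y. y \<in> space M \<Longrightarrow> \<bar>h y\<bar> \<le> (1 :: real)"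
  shows "(LINT x|Q n. \<bar>(\<Sum>i<n. h (x i)) / n - (LINT y|P. h y)\<bar>) \<le> 1 / sqrt n"
    and "integrable (Q n) (\<lambda>x. \<bar>(\<Sum>i<n. h (x i)) / n - (LINT y|P. h y)\<bar>)"
proof -
  interpret PP: product_sigma_finite "\<lambda>_::nat. P"
    by (auto simp: product_sigma_finite_def P.sigma_finite_measure_axioms)
  define \<mu> where "\<mu> = (LINT y|P. h y)"
  define g where "g y = h y - \<mu>" for y
  have hI: "integrable P h" by (rule integrable_bounded[OF h h1])
  have gI: "integrable P g" unfolding g_def[abs_def] using hI by simp
  have g0: "(LINT y|P. g y) = 0"
    unfolding g_def using hI P.prob_space by (simp add: \<mu>_def)
  have hh: "h y * h y \<le> 1" if "y \<in> space M" for y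
    using abs_square_le_1[of "h y"] h1[OF that] by (simp add: power2_eq_square)
  have h2I: "integrable P (\<lambda>y. h y * h y)"
    using hh by (intro integrable_bounded[of _ 1]) auto
  have g2: "(LINT y|P. g y * g y) \<le> 1" and g2I: "integrable P (\<lambda>y. g y * g y)"
  proof -
    have e: "g y * g y = h y * h y - 2 * \<mu> * h y + \<mu> * \<mu>" for y by (simp add: g_def algebra_simps)
    show "integrable P (\<lambda>y. g y * g y)" unfolding e using hI h2I by simp
    have "(LINT y|P. h y * h y) \<le> (LINT y|P. 1)"
      using hh by (intro integral_mono h2I) auto
    then have "(LINT y|P. h y * h y) \<le> 1" using P.prob_space by simp
    moreover have "(LINT y|P. g y * g y) = (LINT y|P. h y * h y) - 2 * \<mu> * \<mu> + \<mu> * \<mu>"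
      unfolding e using hI h2I P.prob_space by (simp add: \<mu>_def)
    ultimately show "(LINT y|P. g y * g y) \<le> 1" using zero_le_square[of \<mu>] by linarith
  qed
  have cross: "integrable (Q n) (\<lambda>x. g (x i) * g (x j))"
    "(LINT x|Q n. g (x i) * g (x j)) = (if i = j then LINT y|P. g y * g y else 0)"
    if i: "i < n" and j: "j < n" for i j
  proof -
    have "integrable (Q n) (\<lambda>x. g (x i) * g (x j)) \<and>
      (LINT x|Q n. g (x i) * g (x j)) = (if i = j then LINT y|P. g y * g y else 0)"
    proof (cases "i = j")
      case True
      then show ?thesis using component_Q[OF i g2I] by simp
    next
      case False
      \<comment> \<open>Padding with constant factors 1 turns the cross term into a full product
        over coordinates, one factor of which integrates to 0.\<close>
      define F where "F k = (if k = i \<or> k = j then g else (\<lambda>_. 1))" for k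
      have FI: "integrable P (F k)" for k using gI by (auto simp: F_def)
      have e: "(\<Prod>k<n. F k (x k)) = g (x i) * g (x j)" for x
      proof -
        have "(\<Prod>k<n. F k (x k)) = (\<Prod>k\<in>{i, j}. F k (x k))"
          using i j by (intro prod.mono_neutral_right) (auto simp: F_def)
        then show ?thesis using False by (simp add: F_def)
      qed
      have "(LINT x|Q n. (\<Prod>k<n. F k (x k))) = (\<Prod>k<n. LINT y|P. F k y)"
        using FI by (intro PP.product_integral_prod) auto
      also have "\<dots> = 0"
        using i g0 by (intro prod_zero bexI[of _ i]) (auto simp: F_def)
      finally show ?thesis
        using PP.product_integrable_prod[of "{..<n}" F] FI False by (simp add: e)
    qed
    then show "integrable (Q n) (\<lambda>x. g (x i) * g (x j))"
      "(LINT x|Q n. g (x i) * g (x j)) = (if i = j then LINT y|P. g y * g y else 0)" by auto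
  qed
  define Y where "Y x = (\<Sum>i<n. h (x i)) / n - \<mu>" for x
  have Y: "Y x = (\<Sum>i<n. g (x i)) / n" for x
    using n by (simp add: Y_def g_def sum_subtractf diff_divide_distrib)
  have YI: "integrable (Q n) Y"
    unfolding Y using component_Q(1)[OF _ gI]
    by (intro integrable_divide_zero Bochner_Integration.integrable_sum) auto
  have Y2: "Y x ^ 2 = (\<Sum>i<n. \<Sum>j<n. g (x i) * g (x j)) / n ^ 2" for x
    by (simp add: Y power2_eq_square sum_product)
  have Y2I: "integrable (Q n) (\<lambda>x. Y x ^ 2)"
    unfolding Y2 by (intro integrable_divide_zero Bochner_Integration.integrable_sum cross) auto
  have "(LINT x|Q n. (\<Sum>i<n. \<Sum>j<n. g (x i) * g (x j))) = (\<Sum>i<n. \<Sum>j<n. if i = j then LINT y|P. g y * g y else 0)"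
  proof -
    have "(LINT x|Q n. (\<Sum>i<n. \<Sum>j<n. g (x i) * g (x j))) = (\<Sum>i<n. LINT x|Q n. (\<Sum>j<n. g (x i) * g (x j)))"
      by (intro Bochner_Integration.integral_sum Bochner_Integration.integrable_sum cross) auto
    also have "\<dots> = (\<Sum>i<n. \<Sum>j<n. LINT x|Q n. g (x i) * g (x j))"
      by (intro sum.cong refl Bochner_Integration.integral_sum cross) auto
    also have "\<dots> = (\<Sum>i<n. \<Sum>j<n. if i = j then LINT y|P. g y * g y else 0)"
      by (intro sum.cong refl cross) auto
    finally show ?thesis .
  qed
  also have "\<dots> = n * (LINT y|P. g y * g y)" by simp
  finally have "(LINT x|Q n. Y x ^ 2) = n * (LINT y|P. g y * g y) / n ^ 2"
    unfolding Y2 by simp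
  also have "\<dots> = (LINT y|P. g y * g y) / n" using n by (simp add: power2_eq_square)
  finally have var: "(LINT x|Q n. Y x ^ 2) \<le> 1 / n"
    using g2 by (simp add: divide_right_mono)
  define s where "s = 1 / sqrt n"
  have s: "0 < s" "s * s = 1 / n" using n by (auto simp: s_def)
  \<comment> \<open>The weight \<open>s = 1 / sqrt n\<close> balances the two terms: each
    contributes at most \<open>s / 2\<close> after integration.\<close>
  have amgm: "\<bar>Y x\<bar> \<le> s / 2 + Y x ^ 2 / (2 * s)" for x
  proof -
    have "0 \<le> (\<bar>Y x\<bar> - s) ^ 2" by simp
    then have "2 * s * \<bar>Y x\<bar> \<le> s * s + Y x ^ 2" by (simp add: power2_eq_square algebra_simps)
    then show ?thesis using s(1) by (simp add: field_simps power2_eq_square)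
  qed
  have "(LINT x|Q n. \<bar>Y x\<bar>) \<le> (LINT x|Q n. s / 2 + Y x ^ 2 / (2 * s))"
    using YI Y2I amgm by (intro integral_mono) auto
  also have "\<dots> = s / 2 + (LINT x|Q n. Y x ^ 2) / (2 * s)"
    using Y2I prob_space.prob_space[OF prob_space_Q] by (subst Bochner_Integration.integral_add) auto
  also have "\<dots> \<le> s / 2 + (1 / n) / (2 * s)"
    using var s by (intro add_left_mono divide_right_mono) auto
  also have "\<dots> = s" using s by (simp flip: s(2))
  finally show "(LINT x|Q n. \<bar>(\<Sum>i<n. h (x i)) / n - (LINT y|P. h y)\<bar>) \<le> 1 / sqrt n"
    by (simp add: Y_def \<mu>_def s_def)
  show "integrable (Q n) (\<lambda>x. \<bar>(\<Sum>i<n. h (x i)) / n - (LINT y|P. h y)\<bar>)"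
    using integrable_abs[OF YI] by (simp add: Y_def \<mu>_def)
qed

section \<open>The trade-off for a fixed sample and decision vector\<close>

lemma \<psi>_mono: assumes "s \<le> t" shows "\<psi> s \<le> \<psi> t"
  unfolding \<psi>_def using assms by (intro integral_mono integrable_pos_part) auto

text \<open>For a rejected fraction \<open>u\<close> away from 0 and 1, the pair
  \<open>A u / u\<close>, \<open>b u\<close> lies on or above the curve \<open>v\<close>, and
  dividing the error by \<open>u\<close> or \<open>1 - u\<close> costs at most a factor
  \<open>1 / \<eta>\<close>. Close to the ends only one of \<open>N\<close> and \<open>F\<close> is
  bounded below, and that is enough.\<close>

lemma tradeoff_bound:
  assumes l: "0 \<le> l" and minorant: "\<And>t. t \<in> {0..1} \<Longrightarrow> c - l * t \<le> v t"
    and u: "u \<in> {0..1}" and FN: "0 \<le> F" "0 \<le> N" "N \<le> 1" "F \<le> 1" and E: "0 \<le> E" and \<eta>: "0 < \<eta>" "\<eta> \<le> 1"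
    and 1: "A u - E \<le> u * F" and 2: "\<pi>1 - u + u * F - E \<le> (1 - u) * N" and 3: "\<pi>0 - E - (1 - u) \<le> u * F"
  shows "c - (2 + l) * (\<eta> + E / \<eta>) \<le> N + l * F"
proof -
  have E': "E \<le> E / \<eta>" using E \<eta> by (simp add: le_divide_eq mult_left_le)
  have uF: "0 \<le> u * F" "u * F \<le> F" and uN: "(1 - u) * N \<le> N" and lF: "0 \<le> l * F"
    using u FN l by (auto intro: mult_left_le_one_le)
  have "0 \<le> l * (\<eta> + E / \<eta>)" using l \<eta> E by simp
  then have k: "(2 + l) * (\<eta> + E / \<eta>) \<ge> 2 * (\<eta> + E / \<eta>)" "(2 + l) * (\<eta> + E / \<eta>) \<ge> l * (\<eta> + E / \<eta>)"
    using \<eta> E by (auto simp: distrib_right)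
  consider "u < \<eta>" | "1 - \<eta> < u" | "\<eta> \<le> u" "u \<le> 1 - \<eta>" by linarith
  then show ?thesis
  proof cases
    \<comment> \<open>Almost nothing is rejected: \<open>N\<close> is nearly at least
      \<open>\<pi>1\<close>, which dominates \<open>v 0\<close> and hence \<open>c\<close>.\<close>
    assume "u < \<eta>"
    have "v 0 \<le> \<pi>1" using v_le_b[of 0 0] by (simp add: A_0 b_def)
    then have "c \<le> \<pi>1" using minorant[of 0] by simp
    then show ?thesis using 2 \<open>u < \<eta>\<close> uF uN lF k(1) E' \<eta> E by argo
  next
    \<comment> \<open>Almost everything is rejected: \<open>F\<close> is nearly at least
      \<open>\<pi>0\<close>, a level at which \<open>v\<close> is already 0.\<close>
    assume u1: "1 - \<eta> < u"
    have "v \<pi>0 \<le> 0" using v_le_b[of \<pi>0 1] pi0 by (simp add: A_1 b_1)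
    then have "c \<le> l * \<pi>0" using minorant[of \<pi>0] pi0 by simp
    also have "\<dots> \<le> l * (F + (\<eta> + E / \<eta>))"
      using 3 uF E' u1 l by (intro mult_left_mono) auto
    finally show ?thesis using k(2) FN by (simp add: distrib_left)
  next
    assume u2: "\<eta> \<le> u" "u \<le> 1 - \<eta>"
    then have u0: "0 < u" "0 < 1 - u" using \<eta> by auto
    have "v (A u / u) \<le> b u"
      using A_nonneg[OF u] u u0 by (intro v_le_b) auto
    moreover have "A u / u \<in> {0..1}" using A_nonneg[OF u] A_le[OF u] u0 by (auto simp: divide_le_eq)
    ultimately have ab: "c \<le> b u + l * (A u / u)" using minorant[of "A u / u"] by simp
    have "A u / u - E / u \<le> F" using 1 u0 by (simp add: field_simps)
    moreover have "E / u \<le> E / \<eta>" "E / (1 - u) \<le> E / \<eta>" using u2 u0 E \<eta> by (auto intro!: divide_left_mono)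
    ultimately have F: "A u / u - E / \<eta> \<le> F" and N1: "2 * E / (1 - u) \<le> 2 * (E / \<eta>)" by auto
    \<comment> \<open>The error enters the bound for \<open>N\<close> once more through
      \<open>u * F\<close>, whence the 2 in \<open>2 + l\<close>; the \<open>l\<close> stems from
      the bound for \<open>F\<close>.\<close>
    have "\<pi>1 - u + A u - 2 * E \<le> N * (1 - u)" using 1 2 by (simp add: mult.commute)
    then have "(\<pi>1 - u + A u - 2 * E) / (1 - u) \<le> N" using u0 by (simp add: divide_le_eq)
    then have "b u - 2 * (E / \<eta>) \<le> N" using N1 by (simp add: b_def diff_divide_distrib)
    moreover have "l * (A u / u - E / \<eta>) \<le> l * F" using F l by (intro mult_left_mono)
    ultimately have "b u + l * (A u / u) - (2 + l) * (E / \<eta>) \<le> N + l * F"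
      by (simp only: distrib_right right_diff_distrib)
    moreover have "(2 + l) * (E / \<eta>) \<le> (2 + l) * (\<eta> + E / \<eta>)"
      using l \<eta> by (intro mult_left_mono) auto
    ultimately show ?thesis using ab by linarith
  qed
qed

text \<open>The threshold dual to the rejected fraction varies with the decision vector, so
  \<open>m + 1\<close> grid thresholds are controlled together and \<open>1 / m\<close> pays for
  rounding to the grid. The term with \<open>\<pi>0\<close> controls the overall null
  proportion.\<close>

definition deviation :: "nat \<Rightarrow> nat \<Rightarrow> (nat \<Rightarrow> 'a) \<Rightarrow> real" where
  "deviation n m x = (\<Sum>j\<in>{..m}. \<bar>(\<Sum>i<n. max 0 (real j / real m - W (x i))) / n - \<psi> (real j / real m)\<bar>)
     + \<bar>(\<Sum>i<n. W (x i)) / n - \<pi>0\<bar> + 1 / m"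

text \<open>The \<open>m + 1\<close> grid terms and the mean of \<open>W\<close> each contribute at
  most \<open>1 / sqrt n\<close>.\<close>

lemma integral_deviation:
  fixes n m :: nat
  assumes n: "n \<ge> 1" and m: "m \<ge> 1"
  shows "integrable (Q n) (deviation n m)" and "(LINT x|Q n. deviation n m x) \<le> (m + 2) / sqrt n + 1 / m"
proof -
  have h: "\<bar>max 0 (real j / real m - W y)\<bar> \<le> 1" if "y \<in> space M" "j \<le> m" for j y
  proof -
    have "real j / real m \<le> 1" using that m by simp
    then show ?thesis using W_range[OF that(1)] by auto
  qed
  let ?D = "\<lambda>j x. \<bar>(\<Sum>i<n. max 0 (real j / real m - W (x i))) / n - \<psi> (real j / real m)\<bar>"
  let ?R = "\<lambda>x. \<bar>(\<Sum>i<n. W (x i)) / n - \<pi>0\<bar>"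
  have D: "(LINT x|Q n. ?D j x) \<le> 1 / sqrt n" "integrable (Q n) (?D j)" if "j \<le> m" for j :: nat
    using mean_abs_deviation[OF n, of "\<lambda>y. max 0 (real j / real m - W y)"] h that by (auto simp: \<psi>_def)
  have R: "(LINT x|Q n. ?R x) \<le> 1 / sqrt n" "integrable (Q n) ?R"
    using mean_abs_deviation[OF n W_measurable W_abs] by (auto simp: integral_W)
  have SD: "integrable (Q n) (\<lambda>x. \<Sum>j\<le>m. ?D j x)" using D(2) by (intro Bochner_Integration.integrable_sum) auto
  show "integrable (Q n) (deviation n m)"
    unfolding deviation_def[abs_def]
    by (intro Bochner_Integration.integrable_add SD R integrable_const_Q)
  have "(LINT x|Q n. deviation n m x) = (LINT x|Q n. (\<Sum>j\<le>m. ?D j x)) + (LINT x|Q n. ?R x) + 1 / m"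
    unfolding deviation_def
    using prob_space.prob_space[OF prob_space_Q]
    by (subst Bochner_Integration.integral_add[OF Bochner_Integration.integrable_add[OF SD R(2)] integrable_const_Q])
      (simp add: Bochner_Integration.integral_add[OF SD R(2)])
  moreover have "(LINT x|Q n. (\<Sum>j\<le>m. ?D j x)) \<le> (m + 1) * (1 / sqrt n)"
  proof -
    have "(LINT x|Q n. (\<Sum>j\<le>m. ?D j x)) = (\<Sum>j\<le>m. LINT x|Q n. ?D j x)"
      using D(2) by (intro Bochner_Integration.integral_sum) auto
    also have "\<dots> \<le> (\<Sum>j\<le>m. 1 / sqrt n)" using D(1) by (intro sum_mono) auto
    finally show ?thesis by (simp add: add.commute)
  qed
  moreover have "(m + 2) / sqrt n = (m + 1) * (1 / sqrt n) + 1 / sqrt n"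
    by (simp add: add_divide_distrib)
  ultimately show "(LINT x|Q n. deviation n m x) \<le> (m + 2) / sqrt n + 1 / m"
    using R(1) by linarith
qed

text \<open>The left-hand side is the same for all decision vectors, so that averaging over a kernel
  leaves a bound common to all rules, however they adapt to the sample.\<close>

lemma pathwise_bound:
  assumes n: "n \<ge> 1" and m: "m \<ge> 1" and x: "x \<in> space (Q n)"
    and l: "0 \<le> l" and minorant: "\<And>t. t \<in> {0..1} \<Longrightarrow> c - l * t \<le> v t" and \<eta>: "0 < \<eta>" "\<eta> \<le> 1"
  shows "c - (2 + l) * (\<eta> + deviation n m x / \<eta>)
    \<le> (\<Sum>i<n. (1 - of_bool (d i)) / max 1 (zeros n d) * (1 - W (x i)))
      + l * (\<Sum>i<n. of_bool (d i) / max 1 (ones n d) * W (x i))"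
proof -
  define D where "D j = \<bar>(\<Sum>i<n. max 0 (real j / m - W (x i))) / n - \<psi> (real j / m)\<bar>" for j
  define SW where "SW = (\<Sum>i<n. of_bool (d i) * W (x i))"
  define TW where "TW = (\<Sum>i<n. (1 - of_bool (d i)) * (1 - W (x i)))"
  define u where "u = ones n d / n"
  have F: "(\<Sum>i<n. of_bool (d i) / max 1 (ones n d) * W (x i)) = SW / max 1 (ones n d)"
    by (simp only: SW_def sum_divide_distrib times_divide_eq_left)
  have N: "(\<Sum>i<n. (1 - of_bool (d i)) / max 1 (zeros n d) * (1 - W (x i))) = TW / max 1 (zeros n d)"
    by (simp only: TW_def sum_divide_distrib times_divide_eq_left)
  have W01: "W (x i) \<in> {0..1}" if "i < n" for i using W_component[OF x that] .
  \<comment> \<open>The counts are integers, so the \<open>max 1\<close> in a denominator acts only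
    when the numerator is 0, and multiplying by \<open>u\<close> or \<open>1 - u\<close> recovers
    the plain averages exactly.\<close>
  have int: "ones n d = 0 \<or> 1 \<le> ones n d" "zeros n d = 0 \<or> 1 \<le> zeros n d"
  proof -
    have nat: "real k = 0 \<or> 1 \<le> real k" for k :: nat by (cases k) auto
    define k where "k = card ({..<n} \<inter> {i. d i})"
    have o: "ones n d = real k" by (simp add: ones_def k_def)
    have "k \<le> n" unfolding k_def using card_mono[of "{..<n}" "{..<n} \<inter> {i. d i}"] by simp
    then have "zeros n d = real (n - k)" by (simp add: zeros_eq o of_nat_diff)
    with o nat show "ones n d = 0 \<or> 1 \<le> ones n d" "zeros n d = 0 \<or> 1 \<le> zeros n d" by metis+
  qed
  have SW: "0 \<le> SW" "SW \<le> ones n d"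
    unfolding SW_def ones_def using W01 by (auto intro!: sum_nonneg sum_mono mult_left_le simp del: sum_of_bool_mult_eq sum_of_bool_eq)
  have TW: "0 \<le> TW" "TW \<le> zeros n d"
    unfolding TW_def zeros_def using W01 by (auto intro!: sum_nonneg sum_mono mult_left_le)
  have u: "u \<in> {0..1}" using ones_range[where n = n and d = d] n by (auto simp: u_def)
  have nu: "n * u = ones n d" "n * (1 - u) = zeros n d" using n by (auto simp: u_def zeros_eq right_diff_distrib)
  have uF: "n * (u * (SW / max 1 (ones n d))) = SW"
    using int(1) SW nu(1) by (auto simp flip: mult.assoc)
  have uN: "n * ((1 - u) * (TW / max 1 (zeros n d))) = TW"
    using int(2) TW nu(2) by (auto simp flip: mult.assoc)
  have cancel: "z = s / n" if "n * z = s" for z s :: real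
    using that n by (auto simp: field_simps)
  have Wsum: "TW = zeros n d - (\<Sum>i<n. W (x i)) + SW"
    unfolding TW_def SW_def zeros_def by (simp add: algebra_simps sum.distrib sum_subtractf)
  have dev: "\<bar>(\<Sum>i<n. W (x i)) / n - \<pi>0\<bar> \<le> deviation n m x" "D j + 1 / m \<le> deviation n m x" if "j \<le> m" for j
  proof -
    have "D j \<le> (\<Sum>j\<le>m. D j)" using that by (intro member_le_sum) (auto simp: D_def)
    moreover have "0 \<le> D j" by (simp add: D_def)
    moreover have "0 \<le> 1 / real m" by simp
    moreover have "deviation n m x = (\<Sum>j\<le>m. D j) + \<bar>(\<Sum>i<n. W (x i)) / n - \<pi>0\<bar> + 1 / m"
      by (simp add: deviation_def D_def)
    ultimately show "\<bar>(\<Sum>i<n. W (x i)) / n - \<pi>0\<bar> \<le> deviation n m x" "D j + 1 / m \<le> deviation n m x"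
      by linarith+
  qed
  have dev0: "0 \<le> deviation n m x" using dev(1)[of 0] by linarith
  show ?thesis unfolding F N
  proof (rule tradeoff_bound[OF l minorant u])
    show "0 \<le> SW / max 1 (ones n d)" "0 \<le> TW / max 1 (zeros n d)" "TW / max 1 (zeros n d) \<le> 1" "SW / max 1 (ones n d) \<le> 1"
      using SW TW by (auto simp: divide_le_eq)
    show "A u - deviation n m x \<le> u * (SW / max 1 (ones n d))"
    proof -
      let ?t = "Ginv u"
      \<comment> \<open>Rounding the threshold down lowers \<psi>, which is the favourable
        direction; the linear term loses at most \<open>1 / m\<close>.\<close>
      define j where "j = nat \<lfloor>?t * m\<rfloor>"
      have t: "0 \<le> ?t" "?t \<le> 1" using Ginv_range[OF u] by auto
      have tm: "?t * m \<le> m" using t by (simp add: mult_left_le_one_le)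
      have j: "real j \<le> ?t * m" "?t * m < real j + 1"
        using t unfolding j_def by (auto simp: of_nat_nat)
      then have jm: "j \<le> m" using tm by linarith
      have jt: "real j / m \<le> ?t" "?t \<le> real j / m + 1 / m" using j m by (auto simp: field_simps)
      have "(\<Sum>i<n. real j / m * of_bool (d i) - max 0 (real j / m - W (x i))) \<le> (\<Sum>i<n. W (x i) * of_bool (d i))"
        by (intro sum_mono legendre_pointwise) auto
      then have "real j / m * ones n d - (\<Sum>i<n. max 0 (real j / m - W (x i))) \<le> SW"
        unfolding SW_def ones_def sum_subtractf sum_distrib_left by (simp only: mult.commute)
      then have "(real j / m * ones n d - (\<Sum>i<n. max 0 (real j / m - W (x i)))) / n \<le> SW / n"
        by (intro divide_right_mono) auto
      then have "real j / m * u - (\<Sum>i<n. max 0 (real j / m - W (x i))) / n \<le> SW / n"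
        by (simp add: u_def diff_divide_distrib)
      moreover have "(\<Sum>i<n. max 0 (real j / m - W (x i))) / n \<le> \<psi> (real j / m) + D j" by (simp add: D_def)
      moreover have "\<psi> (real j / m) \<le> \<psi> ?t" using jt by (intro \<psi>_mono)
      moreover have "(?t - 1 / m) * u \<le> real j / m * u" using jt u by (intro mult_right_mono) auto
      moreover have "1 / m * u \<le> 1 / m" using u by (intro mult_left_le) auto
      moreover have "(?t - 1 / m) * u = ?t * u - 1 / m * u" by (simp add: left_diff_distrib)
      ultimately have "?t * u - \<psi> ?t - (D j + 1 / m) \<le> SW / n" by linarith
      then have "A u - deviation n m x \<le> SW / n" using dev(2)[OF jm] A_eq[OF u] by linarith
      also have "\<dots> = u * (SW / max 1 (ones n d))" by (rule cancel[OF uF, symmetric])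
      finally show ?thesis .
    qed
    have uF': "u * (SW / max 1 (ones n d)) = SW / n" by (rule cancel[OF uF])
    have uN': "(1 - u) * (TW / max 1 (zeros n d)) = TW / n" by (rule cancel[OF uN])
    have d0: "(\<Sum>i<n. W (x i)) / n \<le> \<pi>0 + deviation n m x" "\<pi>0 - deviation n m x \<le> (\<Sum>i<n. W (x i)) / n"
      using dev(1)[of 0] by linarith+
    have "TW / n = (1 - u) - (\<Sum>i<n. W (x i)) / n + SW / n"
      unfolding Wsum nu(2)[symmetric] using n by (simp add: add_divide_distrib diff_divide_distrib)
    then show "\<pi>1 - u + u * (SW / max 1 (ones n d)) - deviation n m x \<le> (1 - u) * (TW / max 1 (zeros n d))"
      unfolding uF' uN' using d0(1) pi_sum by linarith
    \<comment> \<open>Null mass is either rejected or sits on accepted coordinates.\<close>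
    have "(\<Sum>i<n. W (x i)) / n \<le> (SW + zeros n d) / n"
      using Wsum TW by (intro divide_right_mono) auto
    also have "\<dots> = SW / n + (1 - u)"
      unfolding nu(2)[symmetric] using n by (simp add: add_divide_distrib)
    finally show "\<pi>0 - deviation n m x - (1 - u) \<le> u * (SW / max 1 (ones n d))"
      unfolding uF' using d0(2) by linarith
  qed (use \<eta> dev0 in auto)
qed

section \<open>Uniform lower bound and passage to the limit\<close>

lemma penalized_FNR_bound:
  fixes n m :: nat
  assumes n: "n \<ge> 1" and m: "m \<ge> 1" and K: "K \<in> decision_rules n"
    and l: "0 \<le> l" and minorant: "\<And>t. t \<in> {0..1} \<Longrightarrow> c - l * t \<le> v t" and \<eta>: "0 < \<eta>" "\<eta> \<le> 1"
  shows "c - (2 + l) * (\<eta> + ((m + 2) / sqrt n + 1 / m) / \<eta>) \<le> FNR n K + l * FDR n K"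
proof -
  let ?N = "\<lambda>x d. \<Sum>i<n. (1 - of_bool (d i)) / max 1 (zeros n d) * (1 - W (x i))"
  let ?F = "\<lambda>x d. \<Sum>i<n. of_bool (d i) / max 1 (ones n d) * W (x i)"
  note D = integral_deviation[OF n m]
  have I: "integrable (Q n) (\<lambda>x. ?N x d)" "integrable (Q n) (\<lambda>x. ?F x d)" for d
    by (intro Bochner_Integration.integrable_sum integrable_mult_right
        Bochner_Integration.integrable_diff integrable_const_Q integrable_W_component; simp)+
  have DI: "integrable (Q n) (\<lambda>x. (2 + l) * (\<eta> + deviation n m x / \<eta>))"
    using D(1) by (intro integrable_mult_right Bochner_Integration.integrable_add integrable_const_Q integrable_divide_zero) auto
  have "c - (2 + l) * (\<eta> + ((m + 2) / sqrt n + 1 / m) / \<eta>) \<le> c - (2 + l) * (\<eta> + (LINT x|Q n. deviation n m x) / \<eta>)"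
    using D(2) l \<eta> by (intro diff_left_mono mult_left_mono add_left_mono divide_right_mono) auto
  also have "\<dots> = (LINT x|Q n. c - (2 + l) * (\<eta> + deviation n m x / \<eta>))"
    using D(1) DI prob_space.prob_space[OF prob_space_Q]
    by (simp add: Bochner_Integration.integral_diff Bochner_Integration.integral_add)
  also have "\<dots> = expect n K (\<lambda>x d. c - (2 + l) * (\<eta> + deviation n m x / \<eta>))"
    by (rule expect_obs[OF K, symmetric])
  also have "\<dots> \<le> expect n K (\<lambda>x d. ?N x d + l * ?F x d)"
    by (intro expect_mono K Bochner_Integration.integrable_diff Bochner_Integration.integrable_add integrable_mult_right I DI
        integrable_const_Q pathwise_bound[OF n m _ l minorant \<eta>])
  also have "\<dots> = FNR n K + l * FDR n K"
    unfolding rates_eq(1,2)[OF K] expect_cmult[symmetric]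
    by (intro expect_add K integrable_mult_right I)
  finally show ?thesis .
qed

text \<open>The parameters are chosen in the order \<eta>, \<open>m\<close>, \<open>n\<close>, each
  beating the loss caused by the earlier ones. Uniformity over the rules is what lets the bound pass
  to the infimum.\<close>

lemma penalized_FNR_eventually:
  assumes l: "0 \<le> l" and minorant: "\<And>t. t \<in> {0..1} \<Longrightarrow> c - l * t \<le> v t" and e: "0 < e"
  shows "\<forall>\<^sub>F n in sequentially. \<forall>K\<in>decision_rules n. c - e \<le> FNR n K + l * FDR n K"
proof -
  \<comment> \<open>The cutoff and the grid error each take at most a quarter of \<open>e\<close>;
    the sampling error tends to 0.\<close>
  define \<eta> where "\<eta> = min 1 (e / (4 * (2 + l)))"
  have \<eta>: "0 < \<eta>" "\<eta> \<le> 1" "(2 + l) * \<eta> \<le> e / 4"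
  proof -
    show "0 < \<eta>" "\<eta> \<le> 1" using e l by (auto simp: \<eta>_def)
    have "(2 + l) * \<eta> \<le> (2 + l) * (e / (4 * (2 + l)))" using l by (intro mult_left_mono) (auto simp: \<eta>_def)
    also have "\<dots> = e / 4" using l by (simp add: field_simps)
    finally show "(2 + l) * \<eta> \<le> e / 4" .
  qed
  obtain m :: nat where m: "4 * (2 + l) / (e * \<eta>) < m" using reals_Archimedean2 by blast
  have "0 \<le> 4 * (2 + l) / (e * \<eta>)" using l e \<eta> by simp
  then have m0: "0 < real m" using m by linarith
  then have m1: "m \<ge> 1" by simp
  have m2: "(2 + l) * (1 / m / \<eta>) < e / 4"
    using m m0 e \<eta>(1) by (simp add: field_simps)
  have "(\<lambda>n. (2 + l) * (\<eta> + ((m + 2) / sqrt n + 1 / m) / \<eta>)) \<longlonglongrightarrow> (2 + l) * (\<eta> + (0 + 1 / m) / \<eta>)"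
    by (intro tendsto_intros real_tendsto_divide_at_top[OF tendsto_const]
        filterlim_compose[OF sqrt_at_top filterlim_real_sequentially]) (use \<eta> in auto)
  moreover have "(2 + l) * (\<eta> + (0 + 1 / m) / \<eta>) < e"
    using m2 \<eta>(3) e by (simp only: distrib_left add_0_left)
  ultimately have "\<forall>\<^sub>F n in sequentially. (2 + l) * (\<eta> + ((m + 2) / sqrt n + 1 / m) / \<eta>) < e"
    by (rule order_tendstoD(2))
  then show ?thesis using eventually_ge_at_top[of 1]
  proof eventually_elim
    case (elim n)
    then show ?case using penalized_FNR_bound[OF elim(2) m1 _ l minorant \<eta>(1,2)] by fastforce
  qed
qed

text \<open>Weak duality meets an attaining mixture: an affine minorant bounds the FNR of every rule
  of level \<alpha> asymptotically by its height at \<alpha>, and these heights come arbitrarily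
  close to the mixed value.\<close>

lemma OR_optimal:
  assumes \<alpha>: "\<alpha> \<in> {0..1}" and x: "0 \<le> \<alpha>1" "\<alpha>1 \<le> \<alpha>" "\<alpha> \<le> \<alpha>2" "\<alpha>2 \<le> 1"
    and lines: "\<And>e. e > 0 \<Longrightarrow> \<exists>c l. 0 \<le> l \<and> (\<forall>t\<in>{0..1}. c - l * t \<le> v t) \<and>
        v \<alpha>1 + (\<alpha> - \<alpha>1) / (\<alpha>2 - \<alpha>1) * (v \<alpha>2 - v \<alpha>1) - e \<le> c - l * \<alpha>"
  defines "y \<equiv> v \<alpha>1 + (\<alpha> - \<alpha>1) / (\<alpha>2 - \<alpha>1) * (v \<alpha>2 - v \<alpha>1)"
  shows "FDR n (OR_rule n p \<alpha> \<alpha>1 \<alpha>2) \<le> \<alpha>"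
    and "(\<lambda>n. FNR n (OR_rule n p \<alpha> \<alpha>1 \<alpha>2)) \<longlonglongrightarrow> y"
    and "(\<lambda>n. FNR_star n \<alpha>) \<longlonglongrightarrow> y"
proof -
  let ?K = "\<lambda>n. OR_rule n p \<alpha> \<alpha>1 \<alpha>2"
  let ?w = "(\<alpha> - \<alpha>1) / (\<alpha>2 - \<alpha>1)"
  have w: "\<alpha>1 \<noteq> \<alpha>2 \<Longrightarrow> ?w \<in> {0..1}" using x by (auto simp: divide_le_eq)
  have OR: "FDR n (?K n) \<le> \<alpha>" for n
  proof (cases "\<alpha>1 = \<alpha>2")
    case True
    then show ?thesis using FDR_NP[of \<alpha> n] \<alpha> by (simp add: OR_rule_def[abs_def])
  next
    case False
    have "FDR n (?K n) \<le> ?w * \<alpha>2 + (1 - ?w) * \<alpha>1"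
      unfolding rates_OR(1)[OF False w[OF False]]
      using w[OF False] FDR_NP[of \<alpha>1 n] FDR_NP[of \<alpha>2 n] x
      by (intro add_mono mult_left_mono) auto
    \<comment> \<open>The coin's weights make \<alpha> the barycentre of the two levels.\<close>
    also have "\<dots> = \<alpha>1 + ?w * (\<alpha>2 - \<alpha>1)" by (simp only: left_diff_distrib right_diff_distrib mult_1_left)
    also have "\<dots> = \<alpha>" using False by simp
    finally show ?thesis .
  qed
  then show "FDR n (?K n) \<le> \<alpha>" .
  show lim: "(\<lambda>n. FNR n (?K n)) \<longlonglongrightarrow> y"
  proof (cases "\<alpha>1 = \<alpha>2")
    case True
    then show ?thesis using FNR_NP_tendsto[of \<alpha>] \<alpha> x by (simp add: OR_rule_def[abs_def] y_def)
  next
    case False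
    have "(\<lambda>n. FNR n (?K n)) \<longlonglongrightarrow> ?w * v \<alpha>2 + (1 - ?w) * v \<alpha>1"
      unfolding rates_OR(2)[OF False w[OF False]]
      using x by (intro tendsto_add tendsto_mult tendsto_const FNR_NP_tendsto) auto
    also have "?w * v \<alpha>2 + (1 - ?w) * v \<alpha>1 = y"
      unfolding y_def by (simp only: left_diff_distrib right_diff_distrib mult_1_left)
    finally show ?thesis .
  qed
  have mem: "?K n \<in> {K \<in> decision_rules n. FDR n K \<le> \<alpha>}" for n
    using OR OR_rule_in_decision_rules by auto
  have upper: "FNR_star n \<alpha> \<le> FNR n (?K n)" for n
    unfolding FNR_star_def
    by (intro cINF_lower mem bdd_belowI[of _ 0]) (auto intro: rates_nonneg)
  show "(\<lambda>n. FNR_star n \<alpha>) \<longlonglongrightarrow> y"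
  proof (rule order_tendstoI)
    fix z assume "y < z"
    from order_tendstoD(2)[OF lim this] show "\<forall>\<^sub>F n in sequentially. FNR_star n \<alpha> < z"
      by eventually_elim (use upper in \<open>rule le_less_trans\<close>)
  next
    fix z assume z: "z < y"
    \<comment> \<open>One third is spent on the affine minorant, one on the finite-sample error, and
      the last keeps the inequality strict.\<close>
    define e where "e = (y - z) / 3"
    have e: "0 < e" "z < y - e - e" using z by (auto simp: e_def field_simps)
    from lines[OF e(1)] obtain c l where cl: "0 \<le> l" "\<And>t. t \<in> {0..1} \<Longrightarrow> c - l * t \<le> v t" "y - e \<le> c - l * \<alpha>"
      unfolding y_def by blast
    have "\<forall>\<^sub>F n in sequentially. \<forall>K\<in>decision_rules n. c - e \<le> FNR n K + l * FDR n K"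
      by (rule penalized_FNR_eventually[OF cl(1) _ e(1)]) (rule cl(2))
    then show "\<forall>\<^sub>F n in sequentially. z < FNR_star n \<alpha>"
    proof eventually_elim
      case (elim n)
      have "c - e - l * \<alpha> \<le> FNR_star n \<alpha>"
        unfolding FNR_star_def
      proof (rule cINF_greatest)
        show "{K \<in> decision_rules n. FDR n K \<le> \<alpha>} \<noteq> {}" using mem by blast
        fix K assume K: "K \<in> {K \<in> decision_rules n. FDR n K \<le> \<alpha>}"
        then have "l * FDR n K \<le> l * \<alpha>" using cl(1) by (intro mult_left_mono) auto
        moreover have "c - e \<le> FNR n K + l * FDR n K" using elim K by auto
        ultimately show "c - e - l * \<alpha> \<le> FNR n K" by linarith
      qed
      then show ?case using cl(3) e(2) by linarith
    qed
  qed
qed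

lemma two_group_optimality:
  assumes \<alpha>: "\<alpha> \<in> {0..1}"
  shows "convergent (\<lambda>n. FNR_star n \<alpha>)
    \<and> (\<forall>m\<ge>1. FNR_limit \<alpha> = Sup {C \<alpha> | C. convex_on {0..1} C \<and> (\<forall>t\<in>{0..1}. C t \<le> mFNR_star m t)})
    \<and> (\<exists>\<alpha>1 \<alpha>2. 0 \<le> \<alpha>1 \<and> \<alpha>1 \<le> \<alpha> \<and> \<alpha> \<le> \<alpha>2 \<and> \<alpha>2 \<le> 1
        \<and> (\<forall>n\<ge>1. FDR n (OR_rule n p \<alpha> \<alpha>1 \<alpha>2) \<le> \<alpha>)
        \<and> (\<lambda>n. FNR n (OR_rule n p \<alpha> \<alpha>1 \<alpha>2)) \<longlonglongrightarrow> FNR_limit \<alpha>)"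
proof -
  have "v t \<in> {0..1}" if "t \<in> {0..1}" for t using v_range[of t] that by auto
  from convex_minorant_contact[OF v_lsc this v_1 \<alpha>] obtain \<alpha>1 \<alpha>2
    where x: "0 \<le> \<alpha>1" "\<alpha>1 \<le> \<alpha>" "\<alpha> \<le> \<alpha>2" "\<alpha>2 \<le> 1"
    and lines: "\<And>e. e > 0 \<Longrightarrow> \<exists>c l. 0 \<le> l \<and> (\<forall>t\<in>{0..1}. c - l * t \<le> v t) \<and>
        v \<alpha>1 + (\<alpha> - \<alpha>1) / (\<alpha>2 - \<alpha>1) * (v \<alpha>2 - v \<alpha>1) - e \<le> c - l * \<alpha>"
    by blast
  note OR = OR_optimal[OF \<alpha> x lines]
  have lim: "FNR_limit \<alpha> = v \<alpha>1 + (\<alpha> - \<alpha>1) / (\<alpha>2 - \<alpha>1) * (v \<alpha>2 - v \<alpha>1)"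
    unfolding FNR_limit_def by (rule limI[OF OR(3)])
  have "FNR_limit \<alpha> = Sup {C \<alpha> | C. convex_on {0..1} C \<and> (\<forall>t\<in>{0..1}. C t \<le> mFNR_star m t)}" if "m \<ge> 1" for m
  proof -
    \<comment> \<open>For \<open>m \<ge> 1\<close> the marginal curve is \<open>v\<close> whatever
      \<open>m\<close> is, so the sets of minorants coincide.\<close>
    have "(\<forall>t\<in>{0..1}. C t \<le> mFNR_star m t) \<longleftrightarrow> (\<forall>t\<in>{0..1}. C t \<le> v t)" for C
      using that by (intro ball_cong refl) (simp add: mFNR_star_eq)
    then show ?thesis unfolding lim by (simp only: Sup_convex_minorants[OF x lines])
  qed
  moreover have "convergent (\<lambda>n. FNR_star n \<alpha>)" using OR(3) by (rule convergentI)
  moreover have "(\<lambda>n. FNR n (OR_rule n p \<alpha> \<alpha>1 \<alpha>2)) \<longlonglongrightarrow> FNR_limit \<alpha>"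
    unfolding lim by (rule OR(2))
  ultimately show ?thesis using x OR(1) by blast
qed

end

theorem theorem1:
  fixes M :: "'a measure" and f0 f1 :: "'a \<Rightarrow> real" and \<pi>0 \<pi>1 :: real and p :: "real \<Rightarrow> real"
  assumes model: "two_group M f0 f1 \<pi>0 \<pi>1"
    and ties: "two_group.tie_breaking M f0 f1 \<pi>0 \<pi>1 p"
  shows "\<forall>\<alpha>\<in>{0..1}.
      convergent (\<lambda>n. two_group.FNR_star M f0 f1 \<pi>1 n \<alpha>)
    \<and> (\<forall>m\<ge>1. two_group.FNR_limit M f0 f1 \<pi>1 \<alpha>
          = Sup {C \<alpha> | C. convex_on {0..1} C
                \<and> (\<forall>t\<in>{0..1}. C t \<le> two_group.mFNR_star M f0 f1 \<pi>1 m t)})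
    \<and> (\<exists>\<alpha>1 \<alpha>2. 0 \<le> \<alpha>1 \<and> \<alpha>1 \<le> \<alpha> \<and> \<alpha> \<le> \<alpha>2 \<and> \<alpha>2 \<le> 1
        \<and> (\<forall>n\<ge>1. two_group.FDR M f0 f1 \<pi>1 n (two_group.OR_rule M f0 f1 \<pi>0 \<pi>1 n p \<alpha> \<alpha>1 \<alpha>2) \<le> \<alpha>)
        \<and> (\<lambda>n. two_group.FNR M f0 f1 \<pi>1 n (two_group.OR_rule M f0 f1 \<pi>0 \<pi>1 n p \<alpha> \<alpha>1 \<alpha>2))
            \<longlonglongrightarrow> two_group.FNR_limit M f0 f1 \<pi>1 \<alpha>)"
proof -
  interpret two_group_ties M f0 f1 \<pi>0 \<pi>1 p
    using model ties by (auto simp: two_group_ties_def two_group_ties_axioms_def)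
  show ?thesis using two_group_optimality by blast
qed

end
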